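(* Let $a\colon\mathbb N_0\to\mathbb C$ be an automatic sequence. Then there exists a decomposition $a(n)=a_{\mathrm{str}}(n)+a_{\mathrm{uni}}(n)$ for all $n\in\mathbb N_0$, where $a_{\mathrm{str}}$ is weakly structured and $a_{\mathrm{uni}}$ is highly Gowers uniform.
   Context: For $k\ge2$, $\Sigma_k=\{0,\dots,k-1\}$, $\Sigma_k^*$ is the set of finite words, $(n)_k$ the base-$k$ expansion of $n$ without leading zeros, and $\mathbf w^{\mathrm{rev}}$ the reversal of a word $\mathbf w$. A $k$-automaton $(S,s_0,\Sigma_k,\delta,\Omega,\tau)$ (finite $S$, $\delta\colon S\times\Sigma_k\to S$ extended to words by $\delta(s,\mathbf{uv})=\delta(\delta(s,\mathbf u),\mathbf v)$, $\tau\colon S\to\Omega$) produces, reading forwards, $n\mapsto\tau(\delta(s_0,(n)_k))$, and reading backwards, $n\mapsto\tau(\delta(s_0,(n)_k^{\mathrm{rev}}))$. A sequence is $k$-automatic if produced by a $k$-automaton (equivalently reading forwards or backwards). An automaton is synchronising if there is a word $\mathbf w$ such that $\delta(s,\mathbf w)$ does not depend on $s\in S$. A sequence is forwards (resp.\ backwards) synchronising $k$-automatic if it is produced by a synchronising $k$-automaton reading input forwards (resp.\ backwards). A $k$-automatic sequence $a\colon\mathbb N_0\to\Omega$ is weakly structured in base $k$ if there exist a periodic sequence $a_{\mathrm{per}}\colon\mathbb N_0\to\Omega_{\mathrm{per}}$ with period coprime to $k$, a forwards synchronising $k$-automatic sequence $a_{\mathrm{fs}}\colon\mathbb N_0\to\Omega_{\mathrm{fs}}$,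 a backwards synchronising $k$-automatic sequence $a_{\mathrm{bs}}\colon\mathbb N_0\to\Omega_{\mathrm{bs}}$ and a map $F\colon\Omega_{\mathrm{per}}\times\Omega_{\mathrm{fs}}\times\Omega_{\mathrm{bs}}\to\Omega$ with $a(n)=F(a_{\mathrm{per}}(n),a_{\mathrm{fs}}(n),a_{\mathrm{bs}}(n))$ for all $n$. "Weakly structured" means weakly structured in base $k$ for some $k\ge2$ (the paper remarks that if $a$ is $k$-automatic, $a_{\mathrm{str}}$ is weakly structured in some base that is a power of $k$, not necessarily in base $k$ itself). Gowers norms: for a finite abelian group $Z$, $\|f\|_{U^d(Z)}^{2^d}=\mathbb{E}_{(n_0,\dots,n_d)\in Z^{d+1}}\prod_{\omega\in\{0,1\}^d}\mathcal{C}^{|\omega|}f(n_0+\sum_i\omega_in_i)$ ($\mathcal C$ complex conjugation, $|\omega|$ number of ones); $[N]=\{0,\dots,N-1\}$, $\|f\|_{U^d[N]}=\|1_{[N]}f\|_{U^d(\mathbb Z/\tilde N\mathbb Z)}/\|1_{[N]}\|_{U^d(\mathbb Z/\tilde N\mathbb Z)}$ with $\tilde N$ the least prime $>2dN$. A bounded $a$ is highly Gowers uniform if for every $d\ge1$ there is $c_d>0$ with $\|a\|_{U^d[N]}\ll N^{-c_d}$. *)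

theory Defs
  imports
    "HOL-Analysis.Analysis"
    "HOL-Algebra.Elementary_Groups"
    "HOL-Algebra.FiniteProduct"
    "HOL-Computational_Algebra.Primes"
begin

section \<open>Automata and automatic sequences\<close>

text \<open>
  Most significant digit first, without leading zeros; in particular the expansion of 0 is the
  empty word.  The guard \<open>k < 2\<close> only serves termination.
\<close>
function base_expansion :: "nat \<Rightarrow> nat \<Rightarrow> nat list" where
  "base_expansion k n =
     (if n = 0 \<or> k < 2 then [] else base_expansion k (n div k) @ [n mod k])"
  by auto
termination
  by (relation "Wellfounded.measure snd") auto

declare base_expansion.simps [simp del]

text \<open>The out_map set \<open>\<Omega>\<close> of an automaton is the type \<open>'o\<close>.\<close>
record ('s, 'o) automaton =
  states :: "'s set"
  init_state :: 's
  step :: "'s \<Rightarrow> nat \<Rightarrow> 's"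
  out_map :: "'s \<Rightarrow> 'o"

definition k_automaton :: "nat \<Rightarrow> ('s, 'o) automaton \<Rightarrow> bool" where
  "k_automaton k A \<longleftrightarrow>
     finite (states A) \<and> init_state A \<in> states A \<and> (\<forall>s\<in>states A. \<forall>j<k. step A s j \<in> states A)"

definition run :: "('s, 'o) automaton \<Rightarrow> 's \<Rightarrow> nat list \<Rightarrow> 's" where
  "run A s w = foldl (step A) s w"

definition synchronising :: "nat \<Rightarrow> ('s, 'o) automaton \<Rightarrow> bool" where
  "synchronising k A \<longleftrightarrow>
     (\<exists>w\<in>lists {..<k}. \<forall>s\<in>states A. \<forall>t\<in>states A. run A s w = run A t w)"

definition produces_forwards :: "nat \<Rightarrow> ('s, 'o) automaton \<Rightarrow> (nat \<Rightarrow> 'o) \<Rightarrow> bool" where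
  "produces_forwards k A a \<longleftrightarrow> (\<forall>n. a n = out_map A (run A (init_state A) (base_expansion k n)))"

definition produces_backwards :: "nat \<Rightarrow> ('s, 'o) automaton \<Rightarrow> (nat \<Rightarrow> 'o) \<Rightarrow> bool" where
  "produces_backwards k A a \<longleftrightarrow> (\<forall>n. a n = out_map A (run A (init_state A) (rev (base_expansion k n))))"

text \<open>
  Since state sets are finite, quantifying over automata whose states are natural numbers loses
  no generality; see \<open>automaton_nat_states\<close> below.
\<close>
definition automatic_in_base :: "nat \<Rightarrow> (nat \<Rightarrow> 'o) \<Rightarrow> bool" where
  "automatic_in_base k a \<longleftrightarrow>
     (\<exists>A :: (nat, 'o) automaton. k_automaton k A \<and> produces_forwards k A a)"

definition forwards_synchronising :: "nat \<Rightarrow> (nat \<Rightarrow> 'o) \<Rightarrow> bool" where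
  "forwards_synchronising k a \<longleftrightarrow>
     (\<exists>A :: (nat, 'o) automaton. k_automaton k A \<and> synchronising k A \<and> produces_forwards k A a)"

definition backwards_synchronising :: "nat \<Rightarrow> (nat \<Rightarrow> 'o) \<Rightarrow> bool" where
  "backwards_synchronising k a \<longleftrightarrow>
     (\<exists>A :: (nat, 'o) automaton. k_automaton k A \<and> synchronising k A \<and> produces_backwards k A a)"

definition automatic :: "(nat \<Rightarrow> 'o) \<Rightarrow> bool" where
  "automatic a \<longleftrightarrow> (\<exists>k\<ge>2. automatic_in_base k a)"


section \<open>Weakly structured sequences\<close>

definition periodic_with :: "nat \<Rightarrow> (nat \<Rightarrow> 'o) \<Rightarrow> bool" where
  "periodic_with q a \<longleftrightarrow> q > 0 \<and> (\<forall>n. a (n + q) = a n)"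

text \<open>
  The three component sequences take finitely many values, so letting them take values in the
  natural numbers loses no generality; see \<open>weakly_structured_in_baseI\<close> below.
\<close>
definition weakly_structured_in_base :: "nat \<Rightarrow> (nat \<Rightarrow> 'o) \<Rightarrow> bool" where
  "weakly_structured_in_base k a \<longleftrightarrow>
     automatic_in_base k a \<and>
     (\<exists>(a_per :: nat \<Rightarrow> nat) (a_fs :: nat \<Rightarrow> nat) (a_bs :: nat \<Rightarrow> nat) (F :: nat \<times> nat \<times> nat \<Rightarrow> 'o).
        (\<exists>q. coprime q k \<and> periodic_with q a_per) \<and>
        forwards_synchronising k a_fs \<and>
        backwards_synchronising k a_bs \<and>
        (\<forall>n. a n = F (a_per n, a_fs n, a_bs n)))"

definition weakly_structured :: "(nat \<Rightarrow> 'o) \<Rightarrow> bool" where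
  "weakly_structured a \<longleftrightarrow> (\<exists>k\<ge>2. weakly_structured_in_base k a)"


subsection \<open>Independence of the choice of state and value types\<close>

lemma base_expansion_lists: "base_expansion k n \<in> lists {..<k}"
  by (induction k n rule: base_expansion.induct)
     (subst base_expansion.simps, auto)

lemma run_in_states:
  assumes "k_automaton k A" "s \<in> states A" "w \<in> lists {..<k}"
  shows "run A s w \<in> states A"
  using assms(3,2)
proof (induction w arbitrary: s)
  case Nil
  then show ?case by (simp add: run_def)
next
  case (Cons j w)
  then have "step A s j \<in> states A"
    using assms(1) by (auto simp: k_automaton_def)
  with Cons show ?case by (auto simp: run_def)
qed

lemma automaton_nat_states:
  fixes A :: "('s, 'o) automaton"
  assumes A: "k_automaton k A"
  obtains B :: "(nat, 'o) automaton"
  where "k_automaton k B"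
    and "\<And>w. w \<in> lists {..<k} \<Longrightarrow> out_map B (run B (init_state B) w) = out_map A (run A (init_state A) w)"
    and "synchronising k A \<Longrightarrow> synchronising k B"
proof -
  from A have fin: "finite (states A)" and init: "init_state A \<in> states A"
    and tr: "\<And>s j. s \<in> states A \<Longrightarrow> j < k \<Longrightarrow> step A s j \<in> states A"
    by (auto simp: k_automaton_def)
  obtain f :: "'s \<Rightarrow> nat" where f: "inj_on f (states A)"
    using finite_imp_inj_to_nat_seg[OF fin] by metis
  define g where "g = inv_into (states A) f"
  have gf: "g (f s) = s" if "s \<in> states A" for s
    using f that by (simp add: g_def)
  define B where "B = \<lparr>states = f ` states A, init_state = f (init_state A),
      step = (\<lambda>s j. f (step A (g s) j)), out_map = (\<lambda>s. out_map A (g s))\<rparr>"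
  have runB: "run B (f s) w = f (run A s w)" if "s \<in> states A" "w \<in> lists {..<k}" for s w
    using that(2,1)
  proof (induction w arbitrary: s)
    case Nil
    then show ?case by (simp add: run_def)
  next
    case (Cons j w)
    then have "step A s j \<in> states A" using tr by auto
    with Cons show ?case by (simp add: run_def B_def gf)
  qed
  show thesis
  proof
    show "k_automaton k B"
      using fin init tr by (auto simp: k_automaton_def B_def gf)
    fix w assume w: "w \<in> lists {..<k}"
    have "init_state B = f (init_state A)" "\<And>s. out_map B s = out_map A (g s)"
      by (simp_all add: B_def)
    then show "out_map B (run B (init_state B) w) = out_map A (run A (init_state A) w)"
      using runB[OF init w] gf run_in_states[OF A init w] by simp
  next
    assume "synchronising k A"
    then obtain w where w: "w \<in> lists {..<k}"
      and *: "\<And>s t. s \<in> states A \<Longrightarrow> t \<in> states A \<Longrightarrow> run A s w = run A t w"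
      unfolding synchronising_def by blast
    have "run B x w = run B y w" if "x \<in> states B" "y \<in> states B" for x y
    proof -
      from that obtain s t where "s \<in> states A" "t \<in> states A" "x = f s" "y = f t"
        by (auto simp: B_def)
      with runB[OF _ w] * show ?thesis by metis
    qed
    with w show "synchronising k B"
      unfolding synchronising_def by blast
  qed
qed

lemma automatic_in_baseI:
  fixes A :: "('s, 'o) automaton"
  assumes "k_automaton k A" "produces_forwards k A a"
  shows "automatic_in_base k a"
  using assms(2) unfolding automatic_in_base_def produces_forwards_def
  by (metis automaton_nat_states[OF assms(1)] base_expansion_lists)

lemma forwards_synchronisingI:
  fixes A :: "('s, 'o) automaton"
  assumes "k_automaton k A" "synchronising k A" "produces_forwards k A a"
  shows "forwards_synchronising k a"
  using assms(2,3) unfolding forwards_synchronising_def produces_forwards_def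
  by (metis automaton_nat_states[OF assms(1)] base_expansion_lists)

lemma backwards_synchronisingI:
  fixes A :: "('s, 'o) automaton"
  assumes "k_automaton k A" "synchronising k A" "produces_backwards k A a"
  shows "backwards_synchronising k a"
proof -
  have "rev (base_expansion k n) \<in> lists {..<k}" for n
    using base_expansion_lists[of k n] by (auto simp: in_lists_conv_set)
  then show ?thesis
    using assms(2,3) unfolding backwards_synchronising_def produces_backwards_def
    by (metis automaton_nat_states[OF assms(1)])
qed

lemma finite_range_periodic:
  assumes "periodic_with q a"
  shows "finite (range a)"
proof -
  from assms have q: "q > 0" and p: "\<And>n. a (n + q) = a n" by (auto simp: periodic_with_def)
  have "a (r + m * q) = a r" for r m
    by (induction m) (simp_all add: p add.assoc[symmetric] add.left_commute add.commute[of q])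
  then have "a n = a (n mod q)" for n
    by (metis mod_div_mult_eq)
  then have "range a \<subseteq> a ` {..<q}"
    using q by (metis image_eqI image_subsetI lessThan_iff mod_less_divisor)
  then show ?thesis by (rule finite_subset) simp
qed

lemma finite_range_automaton:
  assumes A: "k_automaton k A" and w: "\<And>n :: nat. w n \<in> lists {..<k}"
  shows "finite (range (\<lambda>n. out_map A (run A (init_state A) (w n))))"
proof (rule finite_subset)
  show "range (\<lambda>n. out_map A (run A (init_state A) (w n))) \<subseteq> out_map A ` states A"
    using run_in_states[OF A _ w] A by (auto simp: k_automaton_def)
  show "finite (out_map A ` states A)"
    using A by (simp add: k_automaton_def)
qed

lemma forwards_synchronising_finite_range:
  assumes "forwards_synchronising k a"
  shows "finite (range a)"
proof -
  obtain A :: "(nat, _) automaton" where A: "k_automaton k A" "produces_forwards k A a"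
    using assms by (auto simp: forwards_synchronising_def)
  then have "a = (\<lambda>n. out_map A (run A (init_state A) (base_expansion k n)))"
    by (auto simp: produces_forwards_def)
  with finite_range_automaton[OF A(1) base_expansion_lists] show ?thesis by simp
qed

lemma backwards_synchronising_finite_range:
  assumes "backwards_synchronising k a"
  shows "finite (range a)"
proof -
  obtain A :: "(nat, _) automaton" where A: "k_automaton k A" "produces_backwards k A a"
    using assms by (auto simp: backwards_synchronising_def)
  then have *: "a = (\<lambda>n. out_map A (run A (init_state A) (rev (base_expansion k n))))"
    by (auto simp: produces_backwards_def)
  have "rev (base_expansion k n) \<in> lists {..<k}" for n
    using base_expansion_lists[of k n] by (auto simp: in_lists_conv_set)
  from finite_range_automaton[OF A(1) this] show ?thesis by (subst *) simp
qed

lemma forwards_synchronising_map: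
  assumes "forwards_synchronising k a"
  shows "forwards_synchronising k (\<lambda>n. h (a n))"
proof -
  obtain A :: "(nat, _) automaton"
    where A: "k_automaton k A" "synchronising k A" "produces_forwards k A a"
    using assms by (auto simp: forwards_synchronising_def)
  define B where "B = \<lparr>states = states A, init_state = init_state A, step = step A,
    out_map = (\<lambda>s. h (out_map A s))\<rparr>"
  have "run B = run A" by (intro ext) (simp add: run_def B_def)
  with A have "k_automaton k B" "synchronising k B" "produces_forwards k B (\<lambda>n. h (a n))"
    by (simp_all add: B_def k_automaton_def synchronising_def produces_forwards_def)
  then show ?thesis by (rule forwards_synchronisingI)
qed

lemma backwards_synchronising_map:
  assumes "backwards_synchronising k a"
  shows "backwards_synchronising k (\<lambda>n. h (a n))"
proof -
  obtain A :: "(nat, _) automaton"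
    where A: "k_automaton k A" "synchronising k A" "produces_backwards k A a"
    using assms by (auto simp: backwards_synchronising_def)
  define B where "B = \<lparr>states = states A, init_state = init_state A, step = step A,
    out_map = (\<lambda>s. h (out_map A s))\<rparr>"
  have "run B = run A" by (intro ext) (simp add: run_def B_def)
  with A have "k_automaton k B" "synchronising k B" "produces_backwards k B (\<lambda>n. h (a n))"
    by (simp_all add: B_def k_automaton_def synchronising_def produces_backwards_def)
  then show ?thesis by (rule backwards_synchronisingI)
qed

lemma weakly_structured_in_baseI:
  fixes a_per :: "nat \<Rightarrow> 'p" and a_fs :: "nat \<Rightarrow> 'f" and a_bs :: "nat \<Rightarrow> 'b"
    and F :: "'p \<times> 'f \<times> 'b \<Rightarrow> 'o"
  assumes "automatic_in_base k a"
    and per: "coprime q k" "periodic_with q a_per"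
    and fs: "forwards_synchronising k a_fs"
    and bs: "backwards_synchronising k a_bs"
    and F: "\<And>n. a n = F (a_per n, a_fs n, a_bs n)"
  shows "weakly_structured_in_base k a"
proof -
  obtain p :: "'p \<Rightarrow> nat" where p: "inj_on p (range a_per)"
    using finite_imp_inj_to_nat_seg[OF finite_range_periodic[OF per(2)]] by metis
  obtain f :: "'f \<Rightarrow> nat" where f: "inj_on f (range a_fs)"
    using finite_imp_inj_to_nat_seg[OF forwards_synchronising_finite_range[OF fs]] by metis
  obtain b :: "'b \<Rightarrow> nat" where b: "inj_on b (range a_bs)"
    using finite_imp_inj_to_nat_seg[OF backwards_synchronising_finite_range[OF bs]] by metis
  define G where "G = (\<lambda>(x, y, z). F (inv_into (range a_per) p x,
    inv_into (range a_fs) f y, inv_into (range a_bs) b z))"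
  have "a n = G (p (a_per n), f (a_fs n), b (a_bs n))" for n
    using F p f b by (simp add: G_def)
  moreover have "periodic_with q (\<lambda>n. p (a_per n))"
    using per(2) by (simp add: periodic_with_def)
  ultimately show ?thesis
    unfolding weakly_structured_in_base_def
    using assms(1) per(1) forwards_synchronising_map[OF fs] backwards_synchronising_map[OF bs]
    by blast
qed


section \<open>Gowers norms\<close>

text \<open>
  For \<open>d \<ge> 1\<close> the average is a nonnegative real number, so taking its modulus before extracting the
  root does not change it.  Tuples \<open>(n\<^sub>0, \<dots>, n\<^sub>d)\<close> are extensional functions on \<open>{0..d}\<close>, and the
  group is written multiplicatively, following the library.
\<close>
definition gowers_norm :: "nat \<Rightarrow> ('g, 'm) monoid_scheme \<Rightarrow> ('g \<Rightarrow> complex) \<Rightarrow> real" where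
  "gowers_norm d Z f =
     root (2 ^ d) (cmod
       ((\<Sum>n \<in> {0..d} \<rightarrow>\<^sub>E carrier Z.
           \<Prod>\<omega> \<in> {1..d} \<rightarrow>\<^sub>E {0, 1 :: nat}.
             (cnj ^^ (\<Sum>i\<in>{1..d}. \<omega> i))
               (f (n 0 \<otimes>\<^bsub>Z\<^esub> (\<Otimes>\<^bsub>Z\<^esub>i\<in>{1..d}. n i [^]\<^bsub>Z\<^esub> \<omega> i))))
        / of_nat (card ({0..d} \<rightarrow>\<^sub>E carrier Z))))"

definition interval_modulus :: "nat \<Rightarrow> nat \<Rightarrow> nat" where
  "interval_modulus d N = (LEAST p. prime p \<and> p > 2 * d * N)"

text \<open>
  The carrier of \<^const>\<open>integer_mod_group\<close> at a modulus \<open>m > 0\<close> is \<open>{0..<m}\<close>, so \<open>{0..<N}\<close> is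
  identified with its image in the cyclic group.
\<close>
definition interval_restrict :: "nat \<Rightarrow> (nat \<Rightarrow> complex) \<Rightarrow> int \<Rightarrow> complex" where
  "interval_restrict N f x = (if x \<in> {0..<int N} then f (nat x) else 0)"

definition gowers_norm_interval :: "nat \<Rightarrow> nat \<Rightarrow> (nat \<Rightarrow> complex) \<Rightarrow> real" where
  "gowers_norm_interval d N f =
     gowers_norm d (integer_mod_group (interval_modulus d N)) (interval_restrict N f) /
     gowers_norm d (integer_mod_group (interval_modulus d N)) (interval_restrict N (\<lambda>_. 1))"

definition highly_gowers_uniform :: "(nat \<Rightarrow> complex) \<Rightarrow> bool" where
  "highly_gowers_uniform a \<longleftrightarrow>
     bounded (range a) \<and>
     (\<forall>d\<ge>1. \<exists>c>0. \<exists>C. \<forall>N\<ge>1. gowers_norm_interval d N a \<le> C * real N powr (- c))"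

end

theory Submission
  imports Defs
begin

text \<open>
  Let \<open>T\<close> be the transition monoid of an automaton that ignores leading zeros. After passing to a
  power of the base, some digit \<open>p > 0\<close> acts as an idempotent \<open>e\<close> of the minimal ideal of \<open>T\<close>, so that
  \<open>eTe\<close> is a finite group, and a word \<open>x\<close> containing \<open>p\<close> is determined by its right ideal, which can be
  read off backwards by a synchronising automaton, by its left ideal, which can be read off forwards,
  and by the group element \<open>e x e\<close>.

  Let \<open>G0\<close> be the normal subgroup of all \<open>g\<close> such that for every \<open>d\<close> there is a \<open>d\<close>-dimensional cube of
  integers whose group elements are \<open>e\<close> at all vertices but the last and \<open>g\<close> at the last one. Modulo
  \<open>G0\<close> the last vertex of a cube is determined by the other ones; applied to arithmetic progressions
  this shows that \<open>n \<mapsto> e x e\<close> is periodic modulo \<open>G0\<close>, with period coprime to the base after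
  appending digits \<open>p\<close>. Averaging over \<open>G0\<close>-cosets therefore yields a weakly structured sequence.

  The remainder has mean zero along every \<open>G0\<close>-coset. In a Gowers average over \<open>d\<close>-dimensional cubes,
  the digits in a fixed block of positions may be replaced by those of the above cubes, which changes
  only one vertex; summing over \<open>G0\<close> these contributions cancel. So each block of digits gains a
  factor less than 1, and there are about \<open>log N\<close> blocks.
\<close>

text \<open>The obstacle is the carry: digit products do not respect addition. The constructions
  therefore arrange cubes of integers in blocks of digits whose vertex sums do not overflow into the
  next block. The digit \<open>p\<close> acts as a separator: since it represents \<open>e\<close>,
  the map \<open>h\<close> is multiplicative across it, and cubes of group elements are multiplied
  by concatenating cubes of integers. In the Gowers average the incoming carries cannot be
  prevented, but for \<open>d\<close>-dimensional cubes they are at most \<open>d\<close>, and this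
  bound reproduces itself from block to block.

  The base is enlarged twice: first to turn a word for an idempotent into a single digit, then to
  make the length of a word irrelevant modulo \<open>G0\<close>. The intersection over all
  dimensions in \<open>G0\<close> is needed because cubes are corrected on faces of every smaller
  dimension; by finiteness a single \<open>d\<close> already realises it.\<close>

section \<open>Products along digit expansions\<close>

text \<open>Only the \<open>l\<close> least significant digits of \<open>n\<close> enter, padded with zeros if need be.\<close>
primrec digit_prod :: "nat \<Rightarrow> (nat \<Rightarrow> 'm::monoid_mult) \<Rightarrow> nat \<Rightarrow> nat \<Rightarrow> 'm" where
  "digit_prod k D 0 n = 1"
| "digit_prod k D (Suc l) n = digit_prod k D l (n div k) * D (n mod k)"

lemma digit_prod_split:
  "digit_prod k D (l + m) n = digit_prod k D l (n div k ^ m) * digit_prod k D m n"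
  by (induction m arbitrary: n) (simp_all add: div_mult2_eq mult.assoc)

lemma digit_prod_mod: "digit_prod k D l (n mod k ^ l) = digit_prod k D l n"
proof (induction l arbitrary: n)
  case (Suc l)
  have "(n mod (k * k ^ l)) div k = (n div k) mod k ^ l"
  proof (cases "k = 0")
    case False
    then show ?thesis
      by (simp add: mod_mult2_eq)
  qed simp
  moreover have "(n mod (k * k ^ l)) mod k = n mod k"
    by (simp add: mod_mult2_eq)
  ultimately show ?case
    using Suc by simp
qed simp

lemma digit_prod_concat:
  assumes "b < k ^ m"
  shows "digit_prod k D (l + m) (a * k ^ m + b) = digit_prod k D l a * digit_prod k D m b"
proof -
  have "(a * k ^ m + b) div k ^ m = a"
    using assms by (cases "k ^ m = 0") auto
  moreover have "digit_prod k D m (a * k ^ m + b) = digit_prod k D m b"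
    using assms digit_prod_mod[of k D m "a * k ^ m + b"] by simp
  ultimately show ?thesis
    by (simp only: digit_prod_split)
qed

lemma digit_prod_base_power:
  "digit_prod (k ^ t) (digit_prod k D t) l n = digit_prod k D (t * l) n"
proof (induction l arbitrary: n)
  case (Suc l)
  have "digit_prod k D (t * Suc l) n = digit_prod k D (t * l + t) n"
    by (simp add: add.commute)
  then show ?case
    by (simp only: digit_prod.simps Suc digit_prod_split digit_prod_mod)
qed simp

lemma digit_prod_in:
  assumes "1 \<in> T" "\<And>x y. x \<in> T \<Longrightarrow> y \<in> T \<Longrightarrow> x * y \<in> T" "\<And>j. j < k \<Longrightarrow> D j \<in> T" "0 < k"
  shows "digit_prod k D l n \<in> T"
  using assms by (induction l arbitrary: n) auto

primrec repdigit :: "nat \<Rightarrow> nat \<Rightarrow> nat \<Rightarrow> nat" where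
  "repdigit k p 0 = 0"
| "repdigit k p (Suc s) = k * repdigit k p s + p"

lemma repdigit_add: "repdigit k p (s + t) = repdigit k p s * k ^ t + repdigit k p t"
  by (induction t) (simp_all add: algebra_simps)

lemma repdigit_less:
  assumes "p < k"
  shows "repdigit k p s < k ^ s"
proof (induction s)
  case (Suc s)
  then have "k * Suc (repdigit k p s) \<le> k * k ^ s"
    by (intro mult_le_mono2) simp
  with assms show ?case by simp
qed simp

lemma repdigit_ge:
  assumes "2 \<le> k" "0 < p"
  shows "s \<le> repdigit k p s"
proof (induction s)
  case (Suc s)
  have "2 * repdigit k p s \<le> k * repdigit k p s"
    using assms by (intro mult_le_mono1)
  then have "Suc s \<le> k * repdigit k p s + p"
    using Suc assms by linarith
  then show ?case by simp
qed simp

section \<open>The kernel group of a finite monoid\<close>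

text \<open>
  The digit \<open>p\<close> represents an idempotent \<open>e\<close> of the minimal ideal of \<open>T\<close>, and \<open>eTe\<close> is a group
  whose exponent divides \<open>N\<close>.
\<close>
locale digit_monoid =
  fixes k p N :: nat and D :: "nat \<Rightarrow> 'm::monoid_mult" and T :: "'m set"
  assumes k_ge: "2 \<le> k" and p_pos: "0 < p" and p_less: "p < k" and N_ge: "2 \<le> N"
    and fin: "finite T" and one_in: "1 \<in> T"
    and mult_in: "\<And>x y. x \<in> T \<Longrightarrow> y \<in> T \<Longrightarrow> x * y \<in> T"
    and digit_in: "\<And>j. j < k \<Longrightarrow> D j \<in> T"
    and idem: "D p * D p = D p"
    and exponent: "\<And>x. x \<in> T \<Longrightarrow> (D p * x * D p) ^ N = D p"
begin

abbreviation e :: 'm where "e \<equiv> D p"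

abbreviation E :: "nat \<Rightarrow> nat \<Rightarrow> 'm" where "E \<equiv> digit_prod k D"

definition h :: "nat \<Rightarrow> nat \<Rightarrow> 'm" where "h l n = e * E l n * e"

definition G :: "'m set" where "G = (\<lambda>x. e * x * e) ` T"

definition ginv :: "'m \<Rightarrow> 'm" where "ginv x = x ^ (N - 1)"

section \<open>The group \<open>G\<close> and its inverses\<close>

lemma e_in: "e \<in> T"
  using digit_in p_less by blast

lemma E_in: "E l n \<in> T"
  using digit_prod_in[of T k D] one_in mult_in digit_in k_ge by auto

lemma idem_left: "e * (e * x) = e * x"
  by (simp add: mult.assoc[symmetric] idem)

lemma G_in: "x \<in> G \<Longrightarrow> x \<in> T"
  by (auto simp: G_def intro: mult_in e_in)

lemma GI: "x \<in> T \<Longrightarrow> e * x * e \<in> G"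
  by (auto simp: G_def)

lemma h_in_G: "h l n \<in> G"
  by (auto simp: h_def G_def intro: E_in)

lemma e_in_G: "e \<in> G"
  using GI[OF one_in] by (simp add: idem)

lemma G_left: "x \<in> G \<Longrightarrow> e * x = x"
  by (auto simp: G_def mult.assoc idem idem_left)

lemma G_right: "x \<in> G \<Longrightarrow> x * e = x"
  by (auto simp: G_def mult.assoc idem)

declare G_left [simp] G_right [simp]

lemma G_mult: "x \<in> G \<Longrightarrow> y \<in> G \<Longrightarrow> x * y \<in> G"
  by (metis GI G_in G_left G_right mult.assoc mult_in)

lemma G_power: "x \<in> G \<Longrightarrow> x ^ Suc i \<in> G"
  by (induction i) (auto intro: G_mult)

lemma G_exponent: "x \<in> G \<Longrightarrow> x ^ N = e"
  unfolding G_def using exponent by blast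

lemma ginv_in: "x \<in> G \<Longrightarrow> ginv x \<in> G"
  \<comment> \<open>\<open>N\<close> at least 2 makes the exponent \<open>N - 1\<close> positive;
    exponent 0 would give \<open>1\<close>, which may lie outside \<open>G\<close>.\<close>
  using G_power[of x "N - 2"] N_ge by (simp add: ginv_def Suc_diff_Suc numeral_2_eq_2)

lemma ginv_right [simp]: "x \<in> G \<Longrightarrow> x * ginv x = e"
  using G_exponent[of x] N_ge by (simp add: ginv_def flip: power_Suc)

lemma ginv_left [simp]: "x \<in> G \<Longrightarrow> ginv x * x = e"
  using G_exponent[of x] N_ge by (simp add: ginv_def flip: power_Suc2)

lemma ginv_right' [simp]: "x \<in> G \<Longrightarrow> x * (ginv x * y) = e * y"
  by (simp flip: mult.assoc)

lemma ginv_left' [simp]: "x \<in> G \<Longrightarrow> ginv x * (x * y) = e * y"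
  by (simp flip: mult.assoc)

lemma G_left' [simp]: "x \<in> G \<Longrightarrow> e * (x * y) = x * y"
  by (simp flip: mult.assoc)

lemma G_right' [simp]: "x \<in> G \<Longrightarrow> x * (e * y) = x * y"
  by (simp flip: mult.assoc)

lemma G_eqI:
  assumes "x \<in> G" "y \<in> G" "x * y = e"
  shows "y = ginv x"
  by (metis assms G_left G_right ginv_in ginv_left mult.assoc)

lemma ginv_e [simp]: "ginv e = e"
  by (metis G_left e_in_G ginv_in ginv_right)

lemma ginv_ginv [simp]: "x \<in> G \<Longrightarrow> ginv (ginv x) = x"
  by (metis G_eqI ginv_in ginv_left)

lemma ginv_mult: "x \<in> G \<Longrightarrow> y \<in> G \<Longrightarrow> ginv (x * y) = ginv y * ginv x"
  by (rule G_eqI[symmetric]) (auto simp: mult.assoc G_mult ginv_in)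

text \<open>
  Rees coordinates: \<open>x \<in> TeT\<close> equals \<open>\<alpha> x * (e * x * e) * \<beta> x\<close>, where \<open>\<alpha> x\<close> only depends on the
  right ideal and \<open>\<beta> x\<close> only on the left ideal generated by \<open>x\<close>.
\<close>
definition \<alpha> :: "'m \<Rightarrow> 'm" where "\<alpha> x = x * e * ginv (e * x * e)"

definition \<beta> :: "'m \<Rightarrow> 'm" where "\<beta> x = ginv (e * x * e) * e * x"

lemma alpha_in: "x \<in> T \<Longrightarrow> \<alpha> x \<in> T"
  by (simp add: \<alpha>_def mult_in e_in G_in[OF ginv_in] GI)

lemma beta_in: "x \<in> T \<Longrightarrow> \<beta> x \<in> T"
  by (simp add: \<beta>_def mult_in e_in G_in[OF ginv_in] GI)

lemma alpha_factor:
  assumes "x \<in> T"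
  shows "x * e = \<alpha> x * (e * x * e)"
proof -
  have "ginv (e * x * e) * (e * x * e) = e"
    using assms by (intro ginv_left GI)
  then show ?thesis
    by (simp add: \<alpha>_def mult.assoc idem)
qed

lemma beta_factor:
  assumes "x \<in> T"
  shows "e * x = (e * x * e) * \<beta> x"
proof -
  have "(e * x * e) * ginv (e * x * e) = e"
    using assms by (intro ginv_right GI)
  then show ?thesis
    by (simp add: \<beta>_def mult.assoc[symmetric] idem)
qed

text \<open>A factor \<open>g\<close> on the right also multiplies \<open>e * x * e\<close> by
  \<open>g\<close>, and the inverse inside \<open>\<alpha>\<close> removes it again.\<close>

lemma alpha_absorb:
  assumes "x \<in> T" "g \<in> G"
  shows "\<alpha> (x * g) = \<alpha> x"
proof -
  have "ginv (e * (x * g) * e) = ginv ((e * x * e) * g)"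
    using assms by (simp add: mult.assoc)
  also have "\<dots> = ginv g * ginv (e * x * e)"
    using assms by (simp add: ginv_mult GI)
  finally show ?thesis
    using assms by (simp add: \<alpha>_def mult.assoc ginv_in GI)
qed

lemma beta_absorb:
  assumes "x \<in> T" "g \<in> G"
  shows "\<beta> (g * x) = \<beta> x"
proof -
  have "ginv (e * (g * x) * e) = ginv (g * (e * x * e))"
    using assms by (simp add: mult.assoc)
  also have "\<dots> = ginv (e * x * e) * ginv g"
    using assms by (simp add: ginv_mult GI)
  finally show ?thesis
    using assms by (simp add: \<beta>_def mult.assoc ginv_in GI)
qed

lemma alpha_right_e: "x \<in> T \<Longrightarrow> \<alpha> (x * e) = \<alpha> x"
  by (simp add: alpha_absorb e_in_G)

lemma beta_left_e: "x \<in> T \<Longrightarrow> \<beta> (e * x) = \<beta> x"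
  by (simp add: beta_absorb e_in_G)

text \<open>This makes \<open>\<alpha> x\<close> usable as the state of an automaton that prepends
  digits: \<open>x * e\<close> and \<open>\<alpha> x\<close> differ by a group element on the right,
  which \<open>\<alpha>\<close> does not see.\<close>

lemma alpha_step:
  assumes "x \<in> T" "y \<in> T"
  shows "\<alpha> (y * \<alpha> x) = \<alpha> (y * x)"
proof -
  have "\<alpha> (y * x) = \<alpha> (y * x * e)"
    using assms by (simp add: alpha_right_e mult_in)
  also have "y * x * e = y * \<alpha> x * (e * x * e)"
    using alpha_factor[OF assms(1)] by (simp add: mult.assoc)
  also have "\<alpha> \<dots> = \<alpha> (y * \<alpha> x)"
    using assms by (intro alpha_absorb mult_in alpha_in GI)
  finally show ?thesis ..
qed

lemma beta_step:
  assumes "x \<in> T" "y \<in> T"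
  shows "\<beta> (\<beta> x * y) = \<beta> (x * y)"
proof -
  have "\<beta> (x * y) = \<beta> (e * (x * y))"
    using assms by (simp add: beta_left_e mult_in)
  also have "e * (x * y) = (e * x * e) * (\<beta> x * y)"
    using beta_factor[OF assms(1)] by (metis mult.assoc)
  also have "\<beta> \<dots> = \<beta> (\<beta> x * y)"
    using assms by (intro beta_absorb mult_in beta_in GI)
  finally show ?thesis ..
qed

text \<open>The reset behind synchronisation: once \<open>e\<close> is the leftmost factor, what
  follows no longer affects the right ideal.\<close>

lemma alpha_e_left:
  assumes "x \<in> T"
  shows "\<alpha> (e * x) = e"
  using ginv_right[OF GI[OF assms]] by (simp add: \<alpha>_def mult.assoc idem_left)

lemma beta_e_right:
  assumes "x \<in> T"
  shows "\<beta> (x * e) = e"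
  using ginv_left[OF GI[OF assms]] by (simp add: \<beta>_def mult.assoc idem)

end

section \<open>Cubes in the kernel group\<close>

definition vertex :: "(nat \<Rightarrow> 'a::comm_monoid_add) \<Rightarrow> nat set \<Rightarrow> 'a" where
  "vertex n A = n 0 + sum n A"

lemma vertex_mono:
  fixes n :: "nat \<Rightarrow> nat"
  assumes "A \<subseteq> B" "finite B"
  shows "vertex n A \<le> vertex n B"
  using assms by (simp add: vertex_def sum_mono2)

text \<open>The digit \<open>p\<close> between the two words supplies the inner \<open>e\<close>
  that splits the product into two elements of \<open>G\<close>.\<close>

lemma (in digit_monoid) h_concat:
  assumes "b < k ^ m"
  shows "h (l + Suc m) (a * k ^ Suc m + (p * k ^ m + b)) = h l a * h m b"
proof -
  have "p * k ^ m + b < k ^ Suc m"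
  proof -
    have "p * k ^ m + b < Suc p * k ^ m"
      using assms by simp
    also have "\<dots> \<le> k * k ^ m"
      using p_less by (intro mult_le_mono1) simp
    finally show ?thesis by simp
  qed
  then have "E (l + Suc m) (a * k ^ Suc m + (p * k ^ m + b)) = E l a * E (Suc m) (p * k ^ m + b)"
    by (rule digit_prod_concat)
  also have "E (Suc m) (p * k ^ m + b) = E (1 + m) (p * k ^ m + b)"
    by simp
  also have "\<dots> = E 1 p * E m b"
    by (rule digit_prod_concat) fact
  also have "E 1 p = e"
    using p_less by simp
  finally show ?thesis
    by (simp add: h_def mult.assoc idem_left)
qed

locale word_monoid = digit_monoid +
  assumes words: "\<And>x. x \<in> T \<Longrightarrow> \<exists>l n. n < k ^ l \<and> x = digit_prod k D l n"
begin

text \<open>All vertices share one word length, and the bound at the top vertex makes all of them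
  fit into it. \<open>Q d\<close> plays the role of a Host-Kra cube group for digit words.\<close>

definition Q :: "nat \<Rightarrow> (nat set \<Rightarrow> 'a) set" where
  "Q d = {c. \<exists>l n. vertex n {1..d} < k ^ l \<and> (\<forall>A\<subseteq>{1..d}. c A = h l (vertex n A))}"

lemma QI:
  assumes "vertex n {1..d} < k ^ l" "\<And>A. A \<subseteq> {1..d} \<Longrightarrow> c A = h l (vertex n A)"
  shows "c \<in> Q d"
  using assms unfolding Q_def by blast

lemma Q_in_G: "c \<in> Q d \<Longrightarrow> A \<subseteq> {1..d} \<Longrightarrow> c A \<in> G"
  by (auto simp: Q_def h_in_G)

text \<open>The integer cubes are concatenated edge by edge; the separator \<open>p\<close> goes
  into the base point alone, so that every vertex contains it exactly once.\<close>

lemma Q_mult: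
  assumes "c \<in> Q d" "c' \<in> Q d"
  shows "(\<lambda>A. c A * c' A) \<in> Q d"
proof -
  obtain l n where n: "vertex n {1..d} < k ^ l" "\<And>A. A \<subseteq> {1..d} \<Longrightarrow> c A = h l (vertex n A)"
    using assms(1) by (auto simp: Q_def)
  obtain l' n' where n': "vertex n' {1..d} < k ^ l'" "\<And>A. A \<subseteq> {1..d} \<Longrightarrow> c' A = h l' (vertex n' A)"
    using assms(2) by (auto simp: Q_def)
  define m where "m i = n i * k ^ Suc l' + ((if i = 0 then p * k ^ l' else 0) + n' i)" for i
  have v: "vertex m A = vertex n A * k ^ Suc l' + (p * k ^ l' + vertex n' A)" if "A \<subseteq> {1..d}" for A
  proof -
    have "sum m A = (\<Sum>i\<in>A. n i * k ^ Suc l' + n' i)"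
      using that by (intro sum.cong) (auto simp: m_def)
    also have "\<dots> = sum n A * k ^ Suc l' + sum n' A"
      by (simp only: sum.distrib sum_distrib_right)
    finally show ?thesis
      by (simp add: vertex_def m_def algebra_simps)
  qed
  have le: "vertex n' A < k ^ l'" if "A \<subseteq> {1..d}" for A
    using vertex_mono[OF that, of n'] n'(1) by simp
  show ?thesis
  proof (rule QI)
    have "vertex m {1..d} < vertex n {1..d} * k ^ Suc l' + (p * k ^ l' + k ^ l')"
      using v[of "{1..d}"] le[of "{1..d}"] by simp
    also have "\<dots> = vertex n {1..d} * k ^ Suc l' + Suc p * k ^ l'"
      by simp
    also have "\<dots> \<le> vertex n {1..d} * k ^ Suc l' + k * k ^ l'"
      using p_less by (intro add_left_mono mult_le_mono1) simp
    also have "\<dots> = Suc (vertex n {1..d}) * k ^ Suc l'"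
      by simp
    also have "\<dots> \<le> k ^ l * k ^ Suc l'"
      using n(1) by (intro mult_le_mono1) simp
    also have "\<dots> = k ^ (l + Suc l')"
      by (rule power_add[symmetric])
    finally show "vertex m {1..d} < k ^ (l + Suc l')" .
  next
    fix A :: "nat set" assume A: "A \<subseteq> {1..d}"
    show "c A * c' A = h (l + Suc l') (vertex m A)"
      unfolding v[OF A] h_concat[OF le[OF A]] using n(2)[OF A] n'(2)[OF A] by simp
  qed
qed

lemma Q_const:
  assumes "x \<in> G"
  shows "(\<lambda>_. x) \<in> Q d"
proof -
  obtain l n where n: "n < k ^ l" "x = h l n"
    using assms words unfolding G_def h_def by blast
  have v: "vertex (\<lambda>i. if i = 0 then n else 0) A = n" if "A \<subseteq> {1..d}" for A
    using that by (auto simp: vertex_def intro!: sum.neutral)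
  show ?thesis
    by (rule QI[of "\<lambda>i. if i = 0 then n else 0" d l]) (simp_all add: n v)
qed

lemma Q_power:
  assumes "c \<in> Q d"
  shows "(\<lambda>A. c A ^ Suc i) \<in> Q d"
proof (induction i)
  case (Suc i)
  then show ?case
    using Q_mult[OF assms Suc] by simp
qed (use assms in simp)

lemma Q_ginv:
  assumes "c \<in> Q d"
  shows "(\<lambda>A. ginv (c A)) \<in> Q d"
  using Q_power[OF assms, of "N - 2"] N_ge by (simp add: ginv_def Suc_diff_Suc numeral_2_eq_2)

lemma Q_cong:
  assumes "c \<in> Q d" "\<And>A. A \<subseteq> {1..d} \<Longrightarrow> c A = c' A"
  shows "c' \<in> Q d"
  using assms unfolding Q_def by (smt (verit) mem_Collect_eq)

text \<open>Directions outside \<open>B\<close> receive edges of length 0.\<close>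

lemma Q_reindex:
  assumes "c \<in> Q m" "B \<subseteq> {1..d}" "bij_betw f B {1..m}"
  shows "(\<lambda>A. c (f ` (A \<inter> B))) \<in> Q d"
proof -
  obtain l n where n: "vertex n {1..m} < k ^ l" "\<And>A. A \<subseteq> {1..m} \<Longrightarrow> c A = h l (vertex n A)"
    using assms(1) by (auto simp: Q_def)
  define n' where "n' i = (if i = 0 then n 0 else if i \<in> B then n (f i) else 0)" for i
  have inj: "inj_on f B" and img: "f ` B = {1..m}"
    using assms(3) by (auto simp: bij_betw_def)
  have finB: "finite B"
    using assms(2) finite_subset by blast
  have v: "vertex n' A = vertex n (f ` (A \<inter> B))" if "A \<subseteq> {1..d}" for A
  proof -
    have "sum n' A = sum n' (A \<inter> B)"
      using that finite_subset[OF that] by (intro sum.mono_neutral_right) (auto simp: n'_def)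
    also have "\<dots> = sum (n \<circ> f) (A \<inter> B)"
      using that by (intro sum.cong) (auto simp: n'_def)
    also have "\<dots> = sum n (f ` (A \<inter> B))"
      using inj by (intro sum.reindex[symmetric]) (auto intro: inj_on_subset)
    finally show ?thesis
      by (simp add: vertex_def n'_def)
  qed
  show ?thesis
  proof (rule QI)
    have "{1..d} \<inter> B = B"
      using assms(2) by blast
    then show "vertex n' {1..d} < k ^ l"
      using v[of "{1..d}"] n(1) img by simp
  next
    fix A :: "nat set" assume A: "A \<subseteq> {1..d}"
    have "f ` (A \<inter> B) \<subseteq> {1..m}"
      using img by blast
    then show "c (f ` (A \<inter> B)) = h l (vertex n' A)"
      using n(2) v[OF A] by simp
  qed
qed

section \<open>Group elements at the last vertex of a cube\<close>

definition cube_top :: "nat \<Rightarrow> 'a set" where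
  "cube_top d = {g. (\<lambda>A. if {1..d} \<subseteq> A then g else e) \<in> Q d}"

definition G0 :: "'a set" where
  "G0 = (\<Inter>d. cube_top d)"

lemma cube_top_in_G: "g \<in> cube_top d \<Longrightarrow> g \<in> G"
  unfolding cube_top_def using Q_in_G[of _ d "{1..d}"] by fastforce

text \<open>Restriction to the face of all vertices containing \<open>Suc d\<close>; the edge in
  that direction moves into the base point.\<close>

lemma cube_top_Suc: "cube_top (Suc d) \<subseteq> cube_top d"
proof
  fix g assume "g \<in> cube_top (Suc d)"
  then obtain l n where n: "vertex n {1..Suc d} < k ^ l"
    "\<And>A. A \<subseteq> {1..Suc d} \<Longrightarrow> (if {1..Suc d} \<subseteq> A then g else e) = h l (vertex n A)"
    by (auto simp: cube_top_def Q_def)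
  define n' where "n' i = (if i = 0 then n 0 + n (Suc d) else n i)" for i
  have v: "vertex n' A = vertex n (insert (Suc d) A)" if "A \<subseteq> {1..d}" for A
  proof -
    have "sum n' A = sum n A"
      using that by (intro sum.cong) (auto simp: n'_def)
    moreover have "Suc d \<notin> A" "finite A"
      using that finite_subset by auto
    ultimately show ?thesis
      by (simp add: vertex_def n'_def)
  qed
  have ins: "insert (Suc d) {1..d} = {1..Suc d}"
    by auto
  have "(\<lambda>A. if {1..d} \<subseteq> A then g else e) \<in> Q d"
  proof (rule QI)
    show "vertex n' {1..d} < k ^ l"
      using v[of "{1..d}"] n(1) ins by simp
  next
    fix A :: "nat set" assume A: "A \<subseteq> {1..d}"
    have "{1..Suc d} \<subseteq> insert (Suc d) A \<longleftrightarrow> {1..d} \<subseteq> A"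
      unfolding ins[symmetric] by auto
    moreover have "insert (Suc d) A \<subseteq> {1..Suc d}"
      using A by auto
    ultimately show "(if {1..d} \<subseteq> A then g else e) = h l (vertex n' A)"
      using n(2)[of "insert (Suc d) A"] v[OF A] by simp
  qed
  then show "g \<in> cube_top d"
    by (simp add: cube_top_def)
qed

lemma cube_top_mult:
  assumes "g \<in> cube_top d" "g' \<in> cube_top d"
  shows "g * g' \<in> cube_top d"
proof -
  have "(\<lambda>A. (if {1..d} \<subseteq> A then g else e) * (if {1..d} \<subseteq> A then g' else e)) \<in> Q d"
    using assms by (intro Q_mult) (auto simp: cube_top_def)
  then show ?thesis
    unfolding cube_top_def mem_Collect_eq by (rule Q_cong) (auto simp: idem)
qed

lemma cube_top_e: "e \<in> cube_top d"
  using Q_const[OF e_in_G, of d] by (simp add: cube_top_def)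

lemma cube_top_ginv:
  assumes "g \<in> cube_top d"
  shows "ginv g \<in> cube_top d"
proof -
  have "(\<lambda>A. ginv (if {1..d} \<subseteq> A then g else e)) \<in> Q d"
    using assms by (intro Q_ginv) (auto simp: cube_top_def)
  then show ?thesis
    unfolding cube_top_def mem_Collect_eq by (rule Q_cong) auto
qed

text \<open>Normality comes from the constant cubes: every element of \<open>T\<close> is a word, so
  all constants from \<open>G\<close> belong to \<open>Q d\<close>.\<close>

lemma cube_top_conj:
  assumes "g \<in> cube_top d" "x \<in> G"
  shows "x * g * ginv x \<in> cube_top d"
proof -
  have "(\<lambda>A. x * (if {1..d} \<subseteq> A then g else e) * ginv x) \<in> Q d"
    using assms by (intro Q_mult Q_const ginv_in) (auto simp: cube_top_def)
  then show ?thesis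
    unfolding cube_top_def mem_Collect_eq by (rule Q_cong) (use assms in auto)
qed

lemma G0_in_G: "g \<in> G0 \<Longrightarrow> g \<in> G"
  using cube_top_in_G by (auto simp: G0_def)

lemma G0_e: "e \<in> G0"
  by (simp add: G0_def cube_top_e)

lemma G0_mult: "g \<in> G0 \<Longrightarrow> g' \<in> G0 \<Longrightarrow> g * g' \<in> G0"
  by (simp add: G0_def cube_top_mult)

lemma G0_ginv: "g \<in> G0 \<Longrightarrow> ginv g \<in> G0"
  by (simp add: G0_def cube_top_ginv)

lemma G0_conj: "g \<in> G0 \<Longrightarrow> x \<in> G \<Longrightarrow> x * g * ginv x \<in> G0"
  by (simp add: G0_def cube_top_conj)

lemma G0_stable: "\<exists>d. cube_top d = G0"
proof -
  have anti: "cube_top d' \<subseteq> cube_top d" if "d \<le> d'" for d d'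
    using lift_Suc_antimono_le[of cube_top, OF cube_top_Suc that] .
  have fin_top: "finite (cube_top d)" for d
    using cube_top_in_G G_in fin by (meson finite_subset subsetI)
  define d where "d = (ARG_MIN (\<lambda>d. card (cube_top d)) d. True)"
  have min: "card (cube_top d) \<le> card (cube_top d')" for d'
    unfolding d_def by (rule arg_min_nat_le) simp
  have "cube_top d \<subseteq> cube_top d'" for d'
  proof (cases "d' \<le> d")
    case False
    then have "cube_top d' \<subseteq> cube_top d"
      using anti by simp
    then have "cube_top d' = cube_top d"
      using min[of d'] fin_top by (meson card_subset_eq card_mono le_antisym)
    then show ?thesis by simp
  qed (use anti in simp)
  then show ?thesis
    unfolding G0_def by (intro exI[of _ d]) auto
qed

text \<open>
  The values of \<open>c\<close> are made trivial from the bottom of the cube upwards, each time dividing by a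
  cube supported on an upper face; \<open>U\<close> contains the vertices still to be treated.
\<close>
lemma Q_top_in_G0_aux:
  assumes "cube_top d = G0" "c \<in> Q d" "\<And>A. A \<subset> {1..d} \<Longrightarrow> c A \<in> G0"
    and "U \<subseteq> Pow {1..d}" "\<And>A B. A \<in> U \<Longrightarrow> A \<subseteq> B \<Longrightarrow> B \<subseteq> {1..d} \<Longrightarrow> B \<in> U"
    and "\<And>A. A \<subseteq> {1..d} \<Longrightarrow> A \<notin> U \<Longrightarrow> c A = e"
  shows "c {1..d} \<in> G0"
  using assms(2-)
proof (induction "card U" arbitrary: U c rule: less_induct)
  case less
  note c = less.prems(1) and c0 = less.prems(2) and U = less.prems(3) and up = less.prems(4)
    and triv = less.prems(5)
  have finU: "finite U"
    using U by (rule finite_subset) simp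
  show ?case
  proof (cases "\<exists>A\<in>U. A \<noteq> {1..d}")
    case False
    have "(\<lambda>A. if {1..d} \<subseteq> A then c {1..d} else e) \<in> Q d"
      using c
    proof (rule Q_cong)
      fix A :: "nat set" assume A: "A \<subseteq> {1..d}"
      show "c A = (if {1..d} \<subseteq> A then c {1..d} else e)"
      proof (cases "A = {1..d}")
        case neq: False
        with False have "A \<notin> U" by blast
        then have "c A = e" using triv[OF A] by blast
        moreover have "\<not> {1..d} \<subseteq> A" using neq A by blast
        ultimately show ?thesis by simp
      qed simp
    qed
    then have "c {1..d} \<in> cube_top d"
      by (simp only: cube_top_def mem_Collect_eq)
    then show ?thesis
      using assms(1) by simp
  next
    case True
    \<comment> \<open>Least cardinality keeps \<open>U - {A}\<close> closed under supersets;
      excluding the top vertex ensures that \<open>c A\<close> lies in \<open>G0\<close>.\<close>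
    then obtain A where A: "A \<in> U" "A \<noteq> {1..d}"
      and Amin: "\<And>B. B \<in> U \<Longrightarrow> B \<noteq> {1..d} \<Longrightarrow> card A \<le> card B"
      using ex_has_least_nat[of "\<lambda>A. A \<in> U \<and> A \<noteq> {1..d}" _ card] by blast
    have Asub: "A \<subseteq> {1..d}"
      using A U by blast
    then have finA: "finite A"
      using finite_subset by blast
    have cA: "c A \<in> G0"
      using c0 Asub A(2) by blast
    define g where "g = ginv (c A)"
    have g: "g \<in> G0"
      unfolding g_def using cA by (rule G0_ginv)
    obtain f where f: "bij_betw f A {1..card A}"
      using finA by (metis finite_same_card_bij card_atLeastAtMost diff_Suc_1 finite_atLeastAtMost)
    \<comment> \<open>Here \<open>G0\<close> has to consist of top values in dimension
      \<open>card A\<close>, not only in dimension \<open>d\<close>.\<close>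
    have "(\<lambda>B. if {1..card A} \<subseteq> B then g else e) \<in> Q (card A)"
      using g by (auto simp: G0_def cube_top_def)
    from Q_reindex[OF this Asub f]
    have up_face: "(\<lambda>B. if A \<subseteq> B then g else e) \<in> Q d"
    proof (rule Q_cong)
      fix B
      have "{1..card A} \<subseteq> f ` (B \<inter> A) \<longleftrightarrow> A \<subseteq> B"
      proof
        assume "{1..card A} \<subseteq> f ` (B \<inter> A)"
        then have "f ` A \<subseteq> f ` (B \<inter> A)"
          using f by (simp add: bij_betw_def)
        then have "A \<subseteq> B \<inter> A"
          using f by (subst (asm) inj_on_image_subset_iff[of f A]) (auto simp: bij_betw_def)
        then show "A \<subseteq> B" by blast
      next
        assume "A \<subseteq> B"
        then have "B \<inter> A = A" by blast
        then show "{1..card A} \<subseteq> f ` (B \<inter> A)"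
          using f by (simp add: bij_betw_def)
      qed
      then show "(if {1..card A} \<subseteq> f ` (B \<inter> A) then g else e) = (if A \<subseteq> B then g else e)"
        by simp
    qed
    define c' where "c' = (\<lambda>B. c B * (if A \<subseteq> B then g else e))"
    have c': "c' \<in> Q d"
      unfolding c'_def using c up_face by (rule Q_mult)
    have "c' {1..d} \<in> G0"
    proof (rule less.hyps[of "U - {A}"])
      show "card (U - {A}) < card U"
        using finU A(1) by (meson card_Diff1_less)
      show "c' \<in> Q d" by fact
      show "c' B \<in> G0" if "B \<subset> {1..d}" for B
        using c0[OF that] g G0_e by (simp add: c'_def G0_mult)
      show "U - {A} \<subseteq> Pow {1..d}"
        using U by blast
      show "C \<in> U - {A}" if "B \<in> U - {A}" "B \<subseteq> C" "C \<subseteq> {1..d}" for B C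
      proof -
        have "C \<in> U"
          using up that by blast
        moreover have "C \<noteq> A"
        proof
          assume "C = A"
          then have "B \<subset> A"
            using that by blast
          then have "card B < card A" "B \<noteq> {1..d}"
            using finA Asub psubset_card_mono by blast+
          then show False
            using Amin that(1) by fastforce
        qed
        ultimately show ?thesis by blast
      qed
      show "c' B = e" if "B \<subseteq> {1..d}" "B \<notin> U - {A}" for B
      proof (cases "B = A")
        case True
        then show ?thesis
          using cA by (simp add: c'_def g_def G0_in_G)
      next
        case False
        then have "B \<notin> U" using that by blast
        moreover from this have "\<not> A \<subseteq> B"
          using up A(1) that(1) by blast
        ultimately show ?thesis
          using triv that(1) by (simp add: c'_def idem)
      qed
    qed
    moreover have "c {1..d} \<in> G"
      using Q_in_G[OF c] by blast
    ultimately have "c {1..d} * g \<in> G0" "c {1..d} \<in> G"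
      using Asub by (simp_all add: c'_def)
    then have "(c {1..d} * g) * c A \<in> G0"
      using cA G0_mult by blast
    moreover have "(c {1..d} * g) * c A = c {1..d}"
      using \<open>c {1..d} \<in> G\<close> cA by (simp add: g_def mult.assoc G0_in_G)
    ultimately show ?thesis by simp
  qed
qed

text \<open>Applied to a quotient of two cubes, this says that modulo \<open>G0\<close> the last
  vertex is a function of the others.\<close>

lemma Q_top_in_G0:
  assumes "cube_top d = G0" "c \<in> Q d" "\<And>A. A \<subset> {1..d} \<Longrightarrow> c A \<in> G0"
  shows "c {1..d} \<in> G0"
  by (rule Q_top_in_G0_aux[OF assms, of "Pow {1..d}"]) auto

section \<open>Cosets of \<open>G0\<close> along progressions\<close>

definition coset :: "'a \<Rightarrow> 'a set" where
  "coset x = (\<lambda>g. x * g) ` G0"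

lemma coset_eq_iff:
  assumes "x \<in> G" "y \<in> G"
  shows "coset x = coset y \<longleftrightarrow> ginv x * y \<in> G0"
proof
  assume "coset x = coset y"
  moreover have "y \<in> coset y"
    using assms G0_e by (auto simp: coset_def intro!: image_eqI[of _ _ e])
  ultimately obtain g where "g \<in> G0" "y = x * g"
    by (auto simp: coset_def)
  then show "ginv x * y \<in> G0"
    using assms by (simp add: G0_in_G)
next
  assume *: "ginv x * y \<in> G0"
  have y: "y = x * (ginv x * y)"
    using assms by simp
  have x: "x = y * ginv (ginv x * y)"
    using assms by (simp add: ginv_mult ginv_in)
  show "coset x = coset y"
  proof (intro equalityI subsetI)
    fix z assume "z \<in> coset x"
    then obtain g where "g \<in> G0" "z = x * g"
      by (auto simp: coset_def)
    then show "z \<in> coset y"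
      using x * by (auto simp: coset_def mult.assoc[symmetric] intro!: image_eqI[of _ _ "ginv (ginv x * y) * g"] G0_mult G0_ginv)
  next
    fix z assume "z \<in> coset y"
    then obtain g where "g \<in> G0" "z = y * g"
      by (auto simp: coset_def)
    then show "z \<in> coset x"
      using y * by (auto simp: coset_def mult.assoc[symmetric] intro!: image_eqI[of _ _ "ginv x * y * g"] G0_mult)
  qed
qed

text \<open>With all edges equal to 1 the vertices are \<open>x\<close>, ..., \<open>x + d\<close>,
  and only the last vertex attains \<open>x + d\<close>. The quotient of the cubes at
  \<open>x\<close> and \<open>y\<close> is in \<open>Q d\<close> even if their word lengths
  differ.\<close>

lemma coset_step:
  assumes "cube_top d = G0" "x + d < k ^ l" "y + d < k ^ l'"
    and "\<And>j. j < d \<Longrightarrow> coset (h l (x + j)) = coset (h l' (y + j))"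
  shows "coset (h l (x + d)) = coset (h l' (y + d))"
proof -
  define n :: "nat \<Rightarrow> nat \<Rightarrow> nat" where "n x i = (if i = 0 then x else 1)" for x i
  have v: "vertex (n x) A = x + card A" if "A \<subseteq> {1..d}" for A x
  proof -
    have "sum (n x) A = (\<Sum>i\<in>A. 1)"
      using that by (intro sum.cong) (auto simp: n_def)
    then show ?thesis
      by (simp add: vertex_def n_def)
  qed
  have "(\<lambda>A. h l (vertex (n x) A)) \<in> Q d" "(\<lambda>A. h l' (vertex (n y) A)) \<in> Q d"
    using assms(2,3) v by (auto intro!: QI)
  then have Q: "(\<lambda>A. ginv (h l (vertex (n x) A)) * h l' (vertex (n y) A)) \<in> Q d"
    using Q_mult Q_ginv by blast
  have "ginv (h l (vertex (n x) {1..d})) * h l' (vertex (n y) {1..d}) \<in> G0"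
  proof (rule Q_top_in_G0[OF assms(1) Q])
    fix A :: "nat set" assume A: "A \<subset> {1..d}"
    then have "card A < d"
      using psubset_card_mono[of "{1..d}" A] by simp
    then show "ginv (h l (vertex (n x) A)) * h l' (vertex (n y) A) \<in> G0"
      using A assms(4) v by (simp add: psubset_imp_subset coset_eq_iff[symmetric] h_in_G)
  qed
  then show ?thesis
    using v by (simp add: coset_eq_iff h_in_G)
qed

end

section \<open>Periodicity modulo the cube subgroup\<close>

lemma iterate_local_period:
  fixes f :: "nat \<Rightarrow> 'x"
  assumes "\<And>z. B \<le> z \<Longrightarrow> z + s < M \<Longrightarrow> f z = f (z + s)" "B \<le> z" "z + i * s < M"
  shows "f z = f (z + i * s)"
  using assms(3)
proof (induction i)
  case (Suc i)
  then have "z + i * s + s < M"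
    by (simp add: algebra_simps)
  then have "f z = f (z + i * s)" "f (z + i * s) = f (z + i * s + s)"
    using Suc.IH assms(1)[of "z + i * s"] assms(2) by auto
  then show ?case
    by (simp add: algebra_simps)
qed simp

text \<open>As long as \<open>q\<close> and \<open>k\<close> have a common factor, their gcd is
  moved into one more factor \<open>k\<close>.\<close>

lemma coprime_part:
  fixes q k :: nat
  assumes "0 < q" "0 < k"
  shows "\<exists>q' s. 0 < q' \<and> coprime q' k \<and> q dvd k ^ s * q'"
  using assms(1)
proof (induction q rule: less_induct)
  case (less q)
  show ?case
  proof (cases "coprime q k")
    case True
    then show ?thesis
      using less.prems by (intro exI[of _ q] exI[of _ 0]) simp
  next
    case False
    define g where "g = gcd q k"
    have "g \<noteq> 1" "0 < g"
      using False less.prems by (auto simp: g_def coprime_iff_gcd_eq_1)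
    obtain r where r: "q = g * r"
      unfolding g_def by (meson dvdE gcd_dvd1)
    then have "0 < r" "r < q"
      using \<open>g \<noteq> 1\<close> \<open>0 < g\<close> less.prems by auto
    then obtain q' s where q': "0 < q'" "coprime q' k" "r dvd k ^ s * q'"
      using less.IH by blast
    have "g * r dvd k * (k ^ s * q')"
      using q'(3) by (intro mult_dvd_mono) (simp_all add: g_def)
    then have "q dvd k ^ Suc s * q'"
      by (simp add: r mult.assoc)
    then show ?thesis
      using q' by blast
  qed
qed

text \<open>Two repdigits agree modulo \<open>q\<close>; their difference is a repdigit times a
  power of \<open>k\<close>, and the latter is invertible modulo \<open>q\<close>.\<close>

lemma repdigit_divisible:
  assumes "coprime q k" "0 < q"
  shows "\<exists>t>0. q dvd repdigit k p t"
proof -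
  have "\<not> inj (\<lambda>s. repdigit k p s mod q)"
  proof
    assume "inj (\<lambda>s. repdigit k p s mod q)"
    then have "infinite (range (\<lambda>s. repdigit k p s mod q))"
      by (rule range_inj_infinite)
    moreover have "range (\<lambda>s. repdigit k p s mod q) \<subseteq> {..<q}"
      using assms(2) by auto
    ultimately show False
      by (meson finite_lessThan finite_subset)
  qed
  then obtain s s' where "s < s'" and eq: "repdigit k p s mod q = repdigit k p s' mod q"
    unfolding inj_def by (metis linorder_neqE_nat)
  define t where "t = s' - s"
  have "repdigit k p s' = repdigit k p t * k ^ s + repdigit k p s"
    using \<open>s < s'\<close> repdigit_add[of k p t s] by (simp add: t_def)
  then have "q dvd repdigit k p t * k ^ s"
    using eq by (metis add_diff_cancel_right' le_add2 mod_eq_dvd_iff_nat)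
  then have "q dvd repdigit k p t"
    using assms(1) by (simp add: coprime_dvd_mult_left_iff)
  then show ?thesis
    using \<open>s < s'\<close> by (intro exI[of _ t]) (simp add: t_def)
qed

lemma repdigit_dvd_mult: "q dvd repdigit k p t \<Longrightarrow> q dvd repdigit k p (t * m)"
  by (induction m) (simp_all add: repdigit_add)

context digit_monoid
begin

lemma finite_G: "finite G"
  unfolding G_def using fin by (rule finite_imageI)

lemma E_repdigit: "E s (repdigit k p s) = e ^ s"
proof (induction s)
  case (Suc s)
  have "(k * repdigit k p s + p) div k = repdigit k p s" "(k * repdigit k p s + p) mod k = p"
    using p_less by (auto simp: div_mult_self3)
  with Suc show ?case
    by (simp del: power_Suc add: power_Suc2)
qed simp

lemma e_power: "0 < s \<Longrightarrow> e ^ s = e"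
proof (induction s)
  case (Suc s)
  then show ?case
    by (cases s) (simp_all add: idem)
qed simp

lemma e_mult_power [simp]: "e * e ^ s = e" "e ^ s * e = e"
  using e_power[of "Suc s"] by (simp_all flip: power_Suc power_Suc2)

lemma h_prepend:
  assumes "y < k ^ l"
  shows "h (s + l) (repdigit k p s * k ^ l + y) = h l y"
proof -
  have "e * (e ^ s * E l y) * e = (e * e ^ s) * E l y * e"
    by (simp only: mult.assoc)
  then show ?thesis
    unfolding h_def digit_prod_concat[OF assms] E_repdigit by simp
qed

lemma h_append: "h (l + s) (y * k ^ s + repdigit k p s) = h l y"
proof -
  have "e * (E l y * e ^ s) * e = e * E l y * (e ^ s * e)"
    by (simp only: mult.assoc)
  then show ?thesis
    unfolding h_def digit_prod_concat[OF repdigit_less[OF p_less]] E_repdigit by simp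
qed

lemma prepend_less:
  assumes "y < k ^ l"
  shows "repdigit k p s * k ^ l + y < k ^ (s + l)"
proof -
  have "repdigit k p s * k ^ l + y < Suc (repdigit k p s) * k ^ l"
    using assms by simp
  also have "\<dots> \<le> k ^ s * k ^ l"
    using repdigit_less[OF p_less, of s] by (intro mult_le_mono1) simp
  finally show ?thesis
    by (simp add: power_add)
qed

end

context word_monoid
begin

text \<open>A window of \<open>d\<close> consecutive cosets determines the next one, as in a
  recurrence of order \<open>d\<close>.\<close>

lemma coset_propagate:
  assumes "cube_top d = G0" "\<And>j. j < d \<Longrightarrow> coset (h l (x + j)) = coset (h l (y + j))"
    and "x \<le> y" "y + m < k ^ l"
  shows "coset (h l (x + m)) = coset (h l (y + m))"
  using assms(4)
proof (induction m rule: less_induct)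
  case (less m)
  show ?case
  proof (cases "m < d")
    case False
    then obtain i where i: "m = i + d"
      by (metis add.commute le_Suc_ex not_less)
    have "coset (h l ((x + i) + d)) = coset (h l ((y + i) + d))"
    proof (rule coset_step[OF assms(1)])
      show "(x + i) + d < k ^ l" "(y + i) + d < k ^ l"
        using less.prems assms(3) i by simp_all
      show "coset (h l (x + i + j)) = coset (h l (y + i + j))" if "j < d" for j
        using less.IH[of "i + j"] less.prems i that by (simp add: add.assoc)
    qed
    then show ?thesis
      by (simp add: i add.assoc)
  qed (use assms(2) in simp)
qed

text \<open>Two of the first \<open>B + 1\<close> windows coincide, but which ones may depend on
  \<open>l\<close>. The factorial is a multiple of every possible gap and yields a period valid for
  all \<open>l\<close>.\<close>

lemma coset_eventually_periodic:
  "\<exists>B q. 0 < q \<and> (\<forall>l z. B \<le> z \<longrightarrow> z + q < k ^ l \<longrightarrow> coset (h l z) = coset (h l (z + q)))"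
proof -
  obtain d where d: "cube_top d = G0"
    using G0_stable by blast
  define L where "L = {xs. set xs \<subseteq> coset ` G \<and> length xs = d}"
  have finL: "finite L"
    unfolding L_def by (intro finite_lists_length_eq finite_imageI finite_G)
  define B where "B = card L"
  have "coset (h l z) = coset (h l (z + fact B))" if z: "B \<le> z" "z + fact B < k ^ l" for l z
  proof -
    define f where "f x = map (\<lambda>j. coset (h l (x + j))) [0..<d]" for x
    have "f ` {..B} \<subseteq> L"
      by (auto simp: f_def L_def h_in_G)
    then have "card (f ` {..B}) \<le> B"
      unfolding B_def using finL by (intro card_mono)
    then have "\<not> inj_on f {..B}"
      by (intro pigeonhole) simp
    then obtain x y where xy: "x < y" "y \<le> B" "f x = f y"
      unfolding inj_on_def by (metis atMost_iff linorder_neqE_nat)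
    have agree: "coset (h l (x + j)) = coset (h l (y + j))" if "j < d" for j
      using arg_cong[OF xy(3), of "\<lambda>xs. xs ! j"] that by (simp add: f_def)
    have loc: "coset (h l u) = coset (h l (u + (y - x)))" if "x \<le> u" "u + (y - x) < k ^ l" for u
      using coset_propagate[OF d agree, of "u - x"] that xy(1) by (simp add: add.commute)
    have "(y - x) dvd fact B"
      using xy by (intro dvd_fact) auto
    then obtain i where "fact B = i * (y - x)"
      by (metis dvd_def mult.commute)
    then show ?thesis
      using iterate_local_period[of x "y - x" "k ^ l" "\<lambda>u. coset (h l u)" z i] loc z xy by simp
  qed
  then show ?thesis
    by (intro exI[of _ B] exI[of _ "fact B"]) simp
qed

text \<open>Digits \<open>p\<close> at either end are invisible to \<open>h\<close>. Leading ones
  push the argument beyond the preperiod; trailing ones multiply a shift by a power of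
  \<open>k\<close>, which absorbs the part of the period not coprime to \<open>k\<close>.\<close>

lemma coset_periodic_coprime:
  "\<exists>q>0. coprime q k \<and> (\<forall>l z. z + q < k ^ l \<longrightarrow> coset (h l z) = coset (h l (z + q)))"
proof -
  obtain B q where q: "0 < q"
    and ev: "\<And>l z. B \<le> z \<Longrightarrow> z + q < k ^ l \<Longrightarrow> coset (h l z) = coset (h l (z + q))"
    using coset_eventually_periodic by blast
  have per: "coset (h l z) = coset (h l (z + q))" if "z + q < k ^ l" for l z
  proof -
    define a where "a = repdigit k p B * k ^ l"
    have "B * 1 \<le> repdigit k p B * k ^ l"
      using repdigit_ge[OF k_ge p_pos] k_ge by (intro mult_le_mono) simp_all
    then have "B \<le> a + z"
      by (simp add: a_def)
    moreover have "a + z + q < k ^ (B + l)"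
      using prepend_less[OF that, of B] by (simp add: a_def add.assoc)
    ultimately have "coset (h (B + l) (a + z)) = coset (h (B + l) (a + z + q))"
      by (rule ev)
    then show ?thesis
      using h_prepend[of z l B] h_prepend[of "z + q" l B] that by (simp add: a_def add.assoc)
  qed
  obtain q' s where q': "0 < q'" "coprime q' k" "q dvd k ^ s * q'"
    using coprime_part[OF q, of k] k_ge by auto
  then obtain i where i: "k ^ s * q' = i * q"
    by (metis dvd_def mult.commute)
  have "coset (h l z) = coset (h l (z + q'))" if "z + q' < k ^ l" for l z
  proof -
    define u where "u = z * k ^ s + repdigit k p s"
    have shift: "u + i * q = (z + q') * k ^ s + repdigit k p s"
      by (simp add: u_def algebra_simps flip: i)
    have "u + i * q < (z + q') * k ^ s + k ^ s"
      unfolding shift using repdigit_less[OF p_less] by simp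
    also have "\<dots> = Suc (z + q') * k ^ s"
      by simp
    also have "\<dots> \<le> k ^ l * k ^ s"
      using that by (intro mult_le_mono1) simp
    finally have "u + i * q < k ^ (l + s)"
      by (simp add: power_add)
    then have "coset (h (l + s) u) = coset (h (l + s) (u + i * q))"
      using iterate_local_period[of 0 q "k ^ (l + s)" "\<lambda>z. coset (h (l + s) z)" u i] per by simp
    then show ?thesis
      unfolding shift h_append by (simp add: u_def h_append)
  qed
  then show ?thesis
    using q' by blast
qed

text \<open>Words of different lengths are compared after padding the shorter one with leading
  digits \<open>p\<close>. Padding by a multiple of \<open>t\<close> adds a multiple of
  \<open>q\<close>, hence the restriction to lengths divisible by \<open>t\<close>.\<close>

lemma coset_residue:
  "\<exists>q t. 0 < q \<and> 0 < t \<and> coprime q k \<and>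
     (\<forall>l l' n n'. n < k ^ (t * l) \<longrightarrow> n' < k ^ (t * l') \<longrightarrow> n mod q = n' mod q \<longrightarrow>
        coset (h (t * l) n) = coset (h (t * l') n'))"
proof -
  obtain q where q: "0 < q" "coprime q k"
    and per: "\<And>l z. z + q < k ^ l \<Longrightarrow> coset (h l z) = coset (h l (z + q))"
    using coset_periodic_coprime by blast
  obtain t where t: "0 < t" "q dvd repdigit k p t"
    using repdigit_divisible[OF q(2,1)] by blast
  have le: "coset (h l n) = coset (h l n')"
    if "n \<le> n'" "n' < k ^ l" "n mod q = n' mod q" for l n n'
  proof -
    have "q dvd n' - n"
      using that by (simp flip: mod_eq_dvd_iff_nat)
    then obtain i where "n' - n = i * q"
      by (metis dvd_def mult.commute)
    then have "n' = n + i * q"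
      using that(1) by simp
    then show ?thesis
      using iterate_local_period[of 0 q "k ^ l" "\<lambda>z. coset (h l z)" n i] per that by simp
  qed
  have same: "coset (h l n) = coset (h l n')"
    if "n < k ^ l" "n' < k ^ l" "n mod q = n' mod q" for l n n'
    using le[OF _ that(2,3)] le[OF _ that(1) that(3)[symmetric]] nat_le_linear[of n n'] by metis
  have "coset (h (t * l) n) = coset (h (t * l') n')"
    if *: "l \<le> l'" "n < k ^ (t * l)" "n' < k ^ (t * l')" "n mod q = n' mod q" for l l' n n'
  proof -
    define s where "s = t * (l' - l)"
    have len: "s + t * l = t * l'"
      using *(1) by (simp add: s_def flip: distrib_left)
    have "(repdigit k p s * k ^ (t * l) + n) mod q = n mod q"
      using repdigit_dvd_mult[OF t(2), of "l' - l"] by (auto simp: s_def mult.assoc elim!: dvdE)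
    then have "coset (h (s + t * l) (repdigit k p s * k ^ (t * l) + n)) = coset (h (s + t * l) n')"
      using prepend_less[OF *(2), of s] *(3) unfolding len *(4) by (intro same)
    then show ?thesis
      using h_prepend[OF *(2), of s] len by simp
  qed
  then have "coset (h (t * l) n) = coset (h (t * l') n')"
    if "n < k ^ (t * l)" "n' < k ^ (t * l')" "n mod q = n' mod q" for l l' n n'
    using that by (cases "l \<le> l'") (simp, metis nat_le_linear)
  then show ?thesis
    using q t(1) by (intro exI[of _ q] exI[of _ t]) blast
qed

end

text \<open>The properties of \<open>G0\<close> after the second change of base:
  \<open>H_residue\<close> serves the structured part, \<open>H_cube\<close> the uniform
  part.\<close>

locale uniform_monoid = digit_monoid +
  fixes H :: "'a set" and q :: nat
  assumes H_sub: "H \<subseteq> digit_monoid.G p D T"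
    and e_in_H: "D p \<in> H"
    and H_mult: "\<And>x y. x \<in> H \<Longrightarrow> y \<in> H \<Longrightarrow> x * y \<in> H"
    and H_conj: "\<And>x g. g \<in> H \<Longrightarrow> x \<in> digit_monoid.G p D T \<Longrightarrow> x * g * digit_monoid.ginv N x \<in> H"
    and q_pos: "0 < q" and q_coprime: "coprime q k"
    and H_cube: "\<And>d g. g \<in> H \<Longrightarrow> \<exists>l n. vertex n {1..d} < k ^ l \<and>
      (\<forall>A\<subseteq>{1..d}. digit_monoid.h k p D l (vertex n A) = (if {1..d} \<subseteq> A then g else D p))"
    and H_residue: "\<And>l l' n n'. n < k ^ l \<Longrightarrow> n' < k ^ l' \<Longrightarrow> n mod q = n' mod q \<Longrightarrow>
      (\<lambda>g. digit_monoid.h k p D l n * g) ` H = (\<lambda>g. digit_monoid.h k p D l' n' * g) ` H"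

lemma (in digit_monoid) digit_monoid_power:
  assumes "0 < t"
  shows "digit_monoid (k ^ t) (repdigit k p t) N (E t) T"
proof
  have eq: "E t (repdigit k p t) = e"
    using assms by (simp add: E_repdigit e_power)
  show "2 \<le> k ^ t"
    using assms k_ge self_le_power[of k t] by linarith
  show "0 < repdigit k p t"
    using assms repdigit_ge[OF k_ge p_pos, of t] by linarith
  show "E t (repdigit k p t) * E t (repdigit k p t) = E t (repdigit k p t)"
    by (simp add: eq idem)
  show "(E t (repdigit k p t) * x * E t (repdigit k p t)) ^ N = E t (repdigit k p t)" if "x \<in> T" for x
    using exponent[OF that] by (simp add: eq)
qed (use N_ge fin one_in mult_in E_in repdigit_less[OF p_less] in auto)

lemma (in word_monoid) uniform_monoid_power:
  "\<exists>q t. 0 < t \<and> uniform_monoid (k ^ t) (repdigit k p t) N (E t) T G0 q"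
proof -
  obtain q t where q: "0 < q" "coprime q k" and t: "0 < t"
    and res: "\<And>l l' n n'. n < k ^ (t * l) \<Longrightarrow> n' < k ^ (t * l') \<Longrightarrow> n mod q = n' mod q \<Longrightarrow>
        coset (h (t * l) n) = coset (h (t * l') n')"
    using coset_residue by metis
  have eq: "E t (repdigit k p t) = e"
    using t by (simp add: E_repdigit e_power)
  interpret P: digit_monoid "k ^ t" "repdigit k p t" N "E t" T
    using t by (rule digit_monoid_power)
  have G_eq: "P.G = G"
    unfolding P.G_def G_def eq ..
  have h_eq: "P.h l n = h (t * l) n" for l n
    unfolding P.h_def h_def eq digit_prod_base_power ..
  have "uniform_monoid (k ^ t) (repdigit k p t) N (E t) T G0 q"
  proof (intro uniform_monoid.intro P.digit_monoid_axioms uniform_monoid_axioms.intro, unfold G_eq h_eq eq)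
    show "G0 \<subseteq> G"
      using G0_in_G by blast
    show "coprime q (k ^ t)"
      using q by simp
    fix d g assume "g \<in> G0"
    then obtain l n where n: "vertex n {1..d} < k ^ l"
      "\<And>A. A \<subseteq> {1..d} \<Longrightarrow> (if {1..d} \<subseteq> A then g else e) = h l (vertex n A)"
      unfolding G0_def cube_top_def Q_def by blast
    \<comment> \<open>Length \<open>l\<close> in base \<open>k\<close> is extended to
      \<open>t * l\<close>, that is \<open>l\<close> digits in base \<open>k ^ t\<close>. The
      padding consists of digits \<open>p\<close>, because leading zeros enter \<open>E\<close> and
      could change the group element.\<close>
    define s where "s = (t - 1) * l"
    have s: "s + l = t * l"
      using t by (simp add: s_def diff_mult_distrib)
    define n' where "n' i = (if i = 0 then repdigit k p s * k ^ l else 0) + n i" for i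
    have v: "vertex n' A = repdigit k p s * k ^ l + vertex n A" if "A \<subseteq> {1..d}" for A
    proof -
      have "sum n' A = sum n A"
        using that by (intro sum.cong) (auto simp: n'_def)
      then show ?thesis
        by (simp add: vertex_def n'_def)
    qed
    have less: "vertex n A < k ^ l" if "A \<subseteq> {1..d}" for A
      using vertex_mono[OF that, of n] n(1) by simp
    show "\<exists>l n. vertex n {1..d} < (k ^ t) ^ l \<and>
        (\<forall>A\<subseteq>{1..d}. h (t * l) (vertex n A) = (if {1..d} \<subseteq> A then g else e))"
    proof (intro exI[of _ l] exI[of _ n'] conjI allI impI)
      show "vertex n' {1..d} < (k ^ t) ^ l"
        using prepend_less[OF n(1), of s] v[of "{1..d}"] s by (simp flip: power_mult)
      show "h (t * l) (vertex n' A) = (if {1..d} \<subseteq> A then g else e)" if "A \<subseteq> {1..d}" for A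
        unfolding v[OF that] s[symmetric] h_prepend[OF less[OF that]] using n(2)[OF that] by simp
    qed
  next
    fix l l' n n' assume "n < (k ^ t) ^ l" "n' < (k ^ t) ^ l'" "n mod q = n' mod q"
    then show "(\<lambda>g. h (t * l) n * g) ` G0 = (\<lambda>g. h (t * l') n' * g) ` G0"
      using res[of n l n' l'] by (simp add: coset_def flip: power_mult)
  qed (use q G0_e G0_mult G0_conj in auto)
  then show ?thesis
    using t by blast
qed

section \<open>The structured part\<close>

context digit_monoid
begin

section \<open>Automata for the Rees coordinates\<close>

definition X :: "nat \<Rightarrow> 'm" where
  "X n = prod_list (map D (base_expansion k n))"

lemma X_0 [simp]: "X 0 = 1"
  by (simp add: X_def base_expansion.simps)

lemma X_rec: "0 < n \<Longrightarrow> X n = X (n div k) * D (n mod k)"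
  unfolding X_def using k_ge by (subst base_expansion.simps) simp

lemma X_eq_E: "\<exists>l. n < k ^ l \<and> X n = E l n"
proof (induction n rule: less_induct)
  case (less n)
  show ?case
  proof (cases "n = 0")
    case True
    then show ?thesis by (intro exI[of _ 0]) simp
  next
    case False
    then have "n div k < n"
      using k_ge by simp
    then obtain l where l: "n div k < k ^ l" "X (n div k) = E l (n div k)"
      using less by blast
    have "n < k ^ Suc l"
      using l(1) k_ge by (simp add: div_less_iff_less_mult mult.commute)
    moreover have "X n = E (Suc l) n"
      using False l(2) by (simp add: X_rec)
    ultimately show ?thesis by blast
  qed
qed

lemma X_in: "X n \<in> T"
  using X_eq_E[of n] E_in by auto

text \<open>Behind a nonzero prefix the zeros padding \<open>r\<close> are genuine digits, so
  \<open>E\<close> and \<open>X\<close> fit together.\<close>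

lemma X_concat:
  assumes "0 < m" "r < k ^ L"
  shows "X (m * k ^ L + r) = X m * E L r"
  using assms(2)
proof (induction L arbitrary: r)
  case (Suc L)
  have "(m * k ^ Suc L + r) div k = m * k ^ L + r div k"
    using k_ge by (simp add: mult.left_commute)
  moreover have "(m * k ^ Suc L + r) mod k = r mod k"
    by (simp add: mult.left_commute)
  moreover have "r div k < k ^ L"
    using Suc.prems k_ge by (simp add: div_less_iff_less_mult mult.commute)
  moreover have "0 < m * k ^ Suc L + r"
    using assms(1) k_ge by simp
  ultimately show ?case
    by (simp only: X_rec Suc.IH digit_prod.simps mult.assoc)
qed simp

lemma automatic_function_of_X: "automatic_in_base k (\<lambda>n. f (X n))"
proof (rule automatic_in_baseI)
  define A where "A = \<lparr>states = T, init_state = 1, step = (\<lambda>x j. x * D j), out_map = f\<rparr>"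
  show "k_automaton k A"
    using fin one_in by (auto simp: A_def k_automaton_def intro: mult_in digit_in)
  have "run A x w = x * prod_list (map D w)" for x w
    by (induction w arbitrary: x) (auto simp: run_def A_def mult.assoc)
  then have "out_map A (run A (init_state A) (base_expansion k n)) = f (X n)" for n
    by (simp add: A_def X_def)
  then show "produces_forwards k A (\<lambda>n. f (X n))"
    by (simp add: produces_forwards_def)
qed

text \<open>Reading forwards multiplies on the right, which \<open>beta_step\<close> turns into
  transitions; the one-letter word \<open>p\<close> sends every state to \<open>e\<close>.\<close>

lemma forwards_synchronising_beta: "forwards_synchronising k (\<lambda>n. \<beta> (X n))"
proof (rule forwards_synchronisingI)
  define A where "A = \<lparr>states = \<beta> ` T, init_state = \<beta> 1, step = (\<lambda>x j. \<beta> (x * D j)), out_map = id\<rparr>"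
  show "k_automaton k A"
    using fin one_in by (auto simp: A_def k_automaton_def intro: mult_in digit_in beta_in)
  have run: "run A (\<beta> x) w = \<beta> (x * prod_list (map D w))" if "x \<in> T" "w \<in> lists {..<k}" for x w
    using that(2,1)
  proof (induction w arbitrary: x)
    case (Cons j w)
    then have j: "D j \<in> T" by (simp add: digit_in)
    have "run A (\<beta> x) (j # w) = run A (\<beta> (\<beta> x * D j)) w"
      by (simp add: run_def A_def)
    also have "\<dots> = \<beta> (x * D j * prod_list (map D w))"
      unfolding beta_step[OF Cons.prems j] using Cons.IH j Cons.prems by (blast intro: mult_in)
    finally show ?case
      by (simp add: mult.assoc)
  qed (simp add: run_def)
  have "run A s [p] = e" if "s \<in> states A" for s
  proof -
    obtain x where x: "x \<in> T" "s = \<beta> x"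
      using \<open>s \<in> states A\<close> by (auto simp: A_def)
    then show ?thesis
      using run[OF x(1), of "[p]"] p_less by (simp add: beta_e_right)
  qed
  then show "synchronising k A"
    unfolding synchronising_def using p_less by (intro bexI[of _ "[p]"]) auto
  have "out_map A (run A (init_state A) (base_expansion k n)) = \<beta> (X n)" for n
    using run[OF one_in base_expansion_lists] by (simp add: A_def X_def)
  then show "produces_forwards k A (\<lambda>n. \<beta> (X n))"
    by (simp add: produces_forwards_def)
qed

lemma backwards_synchronising_alpha: "backwards_synchronising k (\<lambda>n. \<alpha> (X n))"
proof (rule backwards_synchronisingI)
  define A where "A = \<lparr>states = \<alpha> ` T, init_state = \<alpha> 1, step = (\<lambda>x j. \<alpha> (D j * x)), out_map = id\<rparr>"
  show "k_automaton k A"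
    using fin one_in by (auto simp: A_def k_automaton_def intro: mult_in digit_in alpha_in)
  have run: "run A (\<alpha> x) w = \<alpha> (prod_list (map D (rev w)) * x)" if "x \<in> T" "w \<in> lists {..<k}" for x w
    using that(2,1)
  proof (induction w arbitrary: x)
    case (Cons j w)
    then have j: "D j \<in> T" by (simp add: digit_in)
    have "run A (\<alpha> x) (j # w) = run A (\<alpha> (D j * \<alpha> x)) w"
      by (simp add: run_def A_def)
    also have "\<dots> = \<alpha> (prod_list (map D (rev w)) * (D j * x))"
      unfolding alpha_step[OF Cons.prems j] using Cons.IH j Cons.prems by (blast intro: mult_in)
    finally show ?case
      by (simp add: mult.assoc)
  qed (simp add: run_def)
  have "run A s [p] = e" if "s \<in> states A" for s
  proof -
    obtain x where x: "x \<in> T" "s = \<alpha> x"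
      using \<open>s \<in> states A\<close> by (auto simp: A_def)
    then show ?thesis
      using run[OF x(1), of "[p]"] p_less by (simp add: alpha_e_left)
  qed
  then show "synchronising k A"
    unfolding synchronising_def using p_less by (intro bexI[of _ "[p]"]) auto
  have "rev (base_expansion k n) \<in> lists {..<k}" for n
    using base_expansion_lists[of k n] by (auto simp: in_lists_conv_set)
  then have "out_map A (run A (init_state A) (rev (base_expansion k n))) = \<alpha> (X n)" for n
    using run[OF one_in] by (simp add: A_def X_def)
  then show "produces_backwards k A (\<lambda>n. \<alpha> (X n))"
    by (simp add: produces_backwards_def)
qed

end

context uniform_monoid
begin

section \<open>Averages over cosets of \<open>H\<close>\<close>

lemma H_in_G: "x \<in> H \<Longrightarrow> x \<in> G"
  using H_sub by blast

lemma H_ginv: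
  assumes "x \<in> H"
  shows "ginv x \<in> H"
proof -
  have "x ^ Suc i \<in> H" for i
    using assms by (induction i) (auto intro: H_mult)
  from this[of "N - 2"] show ?thesis
    using N_ge by (simp add: ginv_def Suc_diff_Suc numeral_2_eq_2)
qed

lemma finite_H: "finite H"
  using H_sub finite_G by (rule finite_subset)

lemma card_H_pos: "0 < card H"
  using finite_H e_in_H by (auto simp: card_gt_0_iff)

text \<open>On \<open>TeT\<close> this averages \<open>f\<close> over all elements with the Rees
  coordinates of \<open>x\<close> and the same coset of \<open>H\<close>. The formula makes sense
  for every \<open>x\<close>, but cancellation is only claimed for products through
  \<open>e\<close>.\<close>

definition coset_mean :: "('a \<Rightarrow> complex) \<Rightarrow> 'a \<Rightarrow> complex" where
  "coset_mean f x = (\<Sum>y\<in>(\<lambda>g. e * x * e * g) ` H. f (\<alpha> x * y * \<beta> x)) / of_nat (card H)"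

lemma weakly_structured_coset_mean: "weakly_structured_in_base k (\<lambda>n. coset_mean f (X n))"
proof (rule weakly_structured_in_baseI)
  show "automatic_in_base k (\<lambda>n. coset_mean f (X n))"
    by (rule automatic_function_of_X)
  show "coprime q k" by (rule q_coprime)
  show "periodic_with q (\<lambda>n. n mod q)"
    using q_pos by (simp add: periodic_with_def)
  show "forwards_synchronising k (\<lambda>n. \<beta> (X n))" "backwards_synchronising k (\<lambda>n. \<alpha> (X n))"
    by (rule forwards_synchronising_beta backwards_synchronising_alpha)+
  fix n
  obtain l where l: "n < k ^ l" "X n = E l n"
    using X_eq_E by blast
  \<comment> \<open>The residue itself represents its class; any length in which it fits gives the
    same coset, and \<open>n mod q\<close> digits suffice.\<close>
  have "n mod q < k ^ (n mod q)"
    using k_ge by (intro less_le_trans[OF less_exp power_mono]) simp_all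
  then have "(\<lambda>g. h l n * g) ` H = (\<lambda>g. h (n mod q) (n mod q) * g) ` H"
    by (intro H_residue l) simp_all
  then have "(\<lambda>g. e * X n * e * g) ` H = (\<lambda>g. h (n mod q) (n mod q) * g) ` H"
    by (simp only: l(2) h_def)
  then show "coset_mean f (X n) =
      (\<lambda>(r, b, a). (\<Sum>y\<in>(\<lambda>g. h r r * g) ` H. f (a * y * b)) / of_nat (card H))
        (n mod q, \<beta> (X n), \<alpha> (X n))"
    by (simp add: coset_mean_def)
qed

text \<open>Normality carries \<open>H\<close> to the other side of \<open>b\<close>, where it
  absorbs \<open>g\<close>.\<close>

lemma coset_conj:
  assumes "a \<in> G" "b \<in> G" "g \<in> H"
  shows "(\<lambda>y. a * g * b * y) ` H = (\<lambda>y. a * y * b) ` H"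
proof (intro equalityI subsetI)
  fix z assume "z \<in> (\<lambda>y. a * g * b * y) ` H"
  then obtain y where y: "y \<in> H" "z = a * g * b * y" by blast
  have "g * (b * y * ginv b) \<in> H"
    using assms y by (intro H_mult H_conj)
  moreover have "z = a * (g * (b * y * ginv b)) * b"
    using assms y by (simp add: mult.assoc H_in_G)
  ultimately show "z \<in> (\<lambda>y. a * y * b) ` H" by blast
next
  fix z assume "z \<in> (\<lambda>y. a * y * b) ` H"
  then obtain y where y: "y \<in> H" "z = a * y * b" by blast
  have "ginv b * (ginv g * y) * ginv (ginv b) \<in> H"
    using assms y by (intro H_mult H_conj ginv_in H_ginv)
  moreover have "z = a * g * b * (ginv b * (ginv g * y) * ginv (ginv b))"
    using assms y by (simp add: mult.assoc H_in_G ginv_in G_mult)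
  ultimately show "z \<in> (\<lambda>y. a * g * b * y) ` H" by blast
qed

text \<open>The value does not depend on \<open>g\<close>: the Rees coordinates of
  \<open>u * g * v\<close> are those of \<open>u\<close> and \<open>v\<close>, and its middle part
  stays in one coset of \<open>H\<close>.\<close>

lemma coset_mean_eq:
  assumes "u \<in> T" "v \<in> T" "u * e = u" "e * v = v" "g \<in> H"
  shows "coset_mean f (u * g * v) = (\<Sum>y\<in>H. f (u * y * v)) / of_nat (card H)"
proof -
  let ?x = "u * g * v"
  define a b where "a = e * u * e" and "b = e * v * e"
  have ab: "a \<in> G" "b \<in> G"
    unfolding a_def b_def using assms(1,2) by (blast intro: GI)+
  have gG: "g \<in> G" and gT: "g \<in> T"
    using assms(5) H_in_G G_in by blast+
  have xT: "?x \<in> T"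
    using assms gT by (intro mult_in)
  have be: "v * e = b"
    using assms(4) by (simp add: b_def)
  have ae: "e * u = a"
    using assms(3) by (simp add: a_def mult.assoc)
  have "\<alpha> ?x = \<alpha> (?x * e)"
    using xT by (simp add: alpha_right_e)
  also have "?x * e = u * (g * b)"
    by (simp add: mult.assoc be)
  also have "\<alpha> \<dots> = \<alpha> u"
    using assms ab gG by (intro alpha_absorb G_mult)
  finally have al: "\<alpha> ?x = \<alpha> u" .
  have "\<beta> ?x = \<beta> (e * ?x)"
    using xT by (simp add: beta_left_e)
  also have "e * ?x = (a * g) * v"
    by (simp add: mult.assoc flip: ae)
  also have "\<beta> \<dots> = \<beta> v"
    using assms ab gG by (intro beta_absorb G_mult)
  finally have bl: "\<beta> ?x = \<beta> v" .
  have mid: "e * ?x * e = a * g * b"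
    by (simp add: mult.assoc flip: ae be)
  have "(\<Sum>y\<in>(\<lambda>g'. e * ?x * e * g') ` H. f (\<alpha> ?x * y * \<beta> ?x)) =
      (\<Sum>y\<in>(\<lambda>y. a * y * b) ` H. f (\<alpha> u * y * \<beta> v))"
    unfolding mid al bl coset_conj[OF ab assms(5)] ..
  also have "\<dots> = (\<Sum>y\<in>H. f (\<alpha> u * (a * y * b) * \<beta> v))"
  proof (subst sum.reindex)
    show "inj_on (\<lambda>y. a * y * b) H"
    proof (rule inj_onI)
      fix y z assume yz: "y \<in> H" "z \<in> H" "a * y * b = a * z * b"
      then have "ginv a * (a * y * b) * ginv b = ginv a * (a * z * b) * ginv b" by simp
      then show "y = z"
        using ab yz by (simp add: mult.assoc H_in_G)
    qed
  qed (simp add: o_def)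
  also have "\<dots> = (\<Sum>y\<in>H. f (u * y * v))"
  proof (rule sum.cong[OF refl])
    fix y assume "y \<in> H"
    have "\<alpha> u * a = u"
      using alpha_factor[OF assms(1)] assms(3) by (simp add: a_def)
    moreover have "b * \<beta> v = v"
      using beta_factor[OF assms(2)] assms(4) by (simp add: b_def)
    ultimately have "\<alpha> u * (a * y * b) * \<beta> v = u * y * v"
      by (metis mult.assoc)
    then show "f (\<alpha> u * (a * y * b) * \<beta> v) = f (u * y * v)" by simp
  qed
  finally show ?thesis
    by (simp add: coset_mean_def)
qed

lemma coset_mean_cancel:
  assumes "u \<in> T" "v \<in> T" "u * e = u" "e * v = v"
  shows "(\<Sum>g\<in>H. f (u * g * v) - coset_mean f (u * g * v)) = 0"
proof -
  have "(\<Sum>g\<in>H. coset_mean f (u * g * v)) = (\<Sum>g\<in>H. (\<Sum>y\<in>H. f (u * y * v)) / of_nat (card H))"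
    using assms by (intro sum.cong refl coset_mean_eq)
  also have "\<dots> = (\<Sum>y\<in>H. f (u * y * v))"
    using card_H_pos by simp
  finally show ?thesis
    by (simp add: sum_subtractf)
qed

end

section \<open>Transition monoids\<close>

lemma finite_monoid_idempotent_power:
  fixes T :: "'m::monoid_mult set"
  assumes fin: "finite T" and one: "1 \<in> T" and mult: "\<And>x y. x \<in> T \<Longrightarrow> y \<in> T \<Longrightarrow> x * y \<in> T"
  shows "\<exists>N\<ge>2. \<forall>x\<in>T. x ^ N * x ^ N = x ^ N"
proof -
  have "\<exists>m>0. x ^ m * x ^ m = x ^ m" if "x \<in> T" for x
  proof -
    have "x ^ i \<in> T" for i
      by (induction i) (auto intro: one mult that)
    then have "finite (range (\<lambda>i. x ^ i))"
      using fin by (meson finite_subset image_subsetI)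
    then have "\<not> inj (\<lambda>i. x ^ i)"
      using range_inj_infinite by blast
    then obtain i j :: nat where ij: "i < j" "x ^ i = x ^ j"
      unfolding inj_def by (metis linorder_neqE_nat)
    define c where "c = j - i"
    have step: "x ^ (m + c) = x ^ m" if "i \<le> m" for m
    proof -
      have "x ^ (m + c) = x ^ (m - i) * x ^ j"
        using that ij by (simp add: c_def flip: power_add)
      also have "\<dots> = x ^ m"
        using that by (simp flip: ij(2) power_add)
      finally show ?thesis .
    qed
    have iter: "x ^ (m + s * c) = x ^ m" if "i \<le> m" for m s
    proof (induction s)
      case (Suc s)
      then show ?case
        using step[of "m + s * c"] that by (simp add: algebra_simps)
    qed simp
    have "0 < c"
      using ij by (simp add: c_def)
    then have "i \<le> Suc i * c"
      by (cases c) auto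
    then have "x ^ (Suc i * c) * x ^ (Suc i * c) = x ^ (Suc i * c)"
      using iter[of "Suc i * c" "Suc i"] by (simp only: power_add[symmetric])
    then show ?thesis
      using \<open>0 < c\<close> by (intro exI[of _ "Suc i * c"]) simp
  qed
  then obtain M where M: "\<And>x. x \<in> T \<Longrightarrow> 0 < M x" "\<And>x. x \<in> T \<Longrightarrow> x ^ M x * x ^ M x = x ^ M x"
    by metis
  \<comment> \<open>A common multiple of all individual exponents; the factor 2 secures the lower
    bound.\<close>
  define N where "N = 2 * prod M T"
  have "0 < prod M T"
    using M(1) by (simp add: prod_pos)
  then have "2 \<le> N"
    by (simp add: N_def)
  moreover have "x ^ N * x ^ N = x ^ N" if x: "x \<in> T" for x
  proof -
    have "M x dvd N"
      using fin x by (simp add: N_def dvd_mult dvd_prodI)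
    then obtain r where r: "N = M x * r"
      by (auto elim: dvdE)
    have "(x ^ M x) ^ Suc i = x ^ M x" for i
      by (induction i) (simp_all add: M(2)[OF x])
    then have "x ^ N = x ^ M x"
      using \<open>2 \<le> N\<close> unfolding r power_mult by (cases r) auto
    then show ?thesis
      using M(2)[OF x] by simp
  qed
  ultimately show ?thesis by blast
qed

text \<open>\<open>z\<close> generates a two-sided ideal of least cardinality. The ideal of
  \<open>a * z * b\<close> is contained in it, hence equal to it, and so contains
  \<open>z\<close>.\<close>

lemma finite_monoid_kernel:
  fixes T :: "'m::monoid_mult set"
  assumes fin: "finite T" and one: "1 \<in> T" and mult: "\<And>x y. x \<in> T \<Longrightarrow> y \<in> T \<Longrightarrow> x * y \<in> T"
  shows "\<exists>z\<in>T. \<forall>a\<in>T. \<forall>b\<in>T. \<exists>c\<in>T. \<exists>d\<in>T. z = c * (a * z * b) * d"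
proof -
  define I where "I z = (\<lambda>(a, b). a * z * b) ` (T \<times> T)" for z
  have finI: "finite (I z)" for z
    using fin by (simp add: I_def)
  obtain z where z: "z \<in> T" "\<And>y. y \<in> T \<Longrightarrow> card (I z) \<le> card (I y)"
    using ex_has_least_nat[of "\<lambda>z. z \<in> T" 1 "\<lambda>z. card (I z)"] one by blast
  have "\<exists>c\<in>T. \<exists>d\<in>T. z = c * (a * z * b) * d" if ab: "a \<in> T" "b \<in> T" for a b
  proof -
    have "I (a * z * b) \<subseteq> I z"
    proof
      fix x assume "x \<in> I (a * z * b)"
      then obtain c d where cd: "c \<in> T" "d \<in> T" "x = c * (a * z * b) * d"
        by (auto simp: I_def)
      then have "x = (c * a) * z * (b * d)"
        by (simp add: mult.assoc)
      then show "x \<in> I z"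
        using cd(1,2) ab mult unfolding I_def by (intro image_eqI[of _ _ "(c * a, b * d)"]) simp_all
    qed
    moreover have "card (I z) \<le> card (I (a * z * b))"
      using z ab mult by blast
    ultimately have "I (a * z * b) = I z"
      using finI card_seteq by metis
    moreover have "z \<in> I z"
      using one by (auto simp: I_def intro!: image_eqI[of _ _ "(1, 1)"])
    ultimately have "z \<in> I (a * z * b)"
      by simp
    then show ?thesis
      unfolding I_def by force
  qed
  with z(1) show ?thesis by blast
qed

text \<open>The idempotent power \<open>f\<close> of \<open>e * x * e\<close> satisfies
  \<open>e * f = f = f * e\<close>. Minimality writes \<open>w\<close> as a product through
  \<open>f\<close>, which gives \<open>a * b = e\<close> with \<open>f * b = b\<close>. By
  finiteness also \<open>b * a = e\<close>, and this forces \<open>f = e\<close>.\<close>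

lemma kernel_group_exponent:
  fixes T :: "'m::monoid_mult set"
  assumes one: "1 \<in> T" and mult: "\<And>x y. x \<in> T \<Longrightarrow> y \<in> T \<Longrightarrow> x * y \<in> T"
    and N: "2 \<le> N" "\<And>x. x \<in> T \<Longrightarrow> x ^ N * x ^ N = x ^ N"
    and w: "w \<in> T" "\<And>a b. a \<in> T \<Longrightarrow> b \<in> T \<Longrightarrow> \<exists>c\<in>T. \<exists>d\<in>T. w = c * (a * w * b) * d"
    and x: "x \<in> T"
  shows "(w ^ N * x * w ^ N) ^ N = w ^ N"
proof -
  have pow: "y ^ i \<in> T" if "y \<in> T" for y i
    by (induction i) (auto intro: one mult that)
  define e where "e = w ^ N"
  define y where "y = e * x * e"
  define f where "f = y ^ N"
  obtain M where M: "N = Suc M" "0 < M"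
    using N(1) by (cases N) auto
  have eT: "e \<in> T" and ee: "e * e = e"
    using pow[OF w(1)] N(2)[OF w(1)] by (auto simp: e_def)
  have yT: "y \<in> T"
    using eT x mult by (auto simp: y_def)
  have fT: "f \<in> T" and ff: "f * f = f"
    using pow[OF yT] N(2)[OF yT] by (auto simp: f_def)
  have ey: "e * y = y" "y * e = y"
    by (simp_all add: y_def mult.assoc ee) (simp add: ee flip: mult.assoc)
  have ef: "e * f = f"
    by (simp add: f_def M(1) ey flip: mult.assoc)
  have fe: "f * e = f"
    unfolding f_def M(1) power_Suc2 by (simp add: mult.assoc ey)
  have "f = e * f"
    by (simp add: ef)
  also have "\<dots> = 1 * w * (w ^ M * f)"
    by (simp add: e_def M(1) mult.assoc)
  finally have "f = 1 * w * (w ^ M * f)" .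
  then obtain c d where cd: "c \<in> T" "d \<in> T" "w = c * f * d"
    using w(2)[OF one, of "w ^ M * f"] fT pow[OF w(1)] mult by metis
  define a b where "a = e * c * f" and "b = f * (d * w ^ M) * e"
  have aT: "a \<in> T"
    using eT cd fT mult by (simp add: a_def)
  have "a * b = e * (c * f * d * w ^ M) * e"
    unfolding a_def b_def by (metis ff mult.assoc)
  also have "c * f * d * w ^ M = e"
    by (simp add: e_def M(1) flip: cd(3))
  finally have ab: "a * b = e"
    by (simp add: ee)
  have ae: "a * e = a" and ea: "e * a = a" and be: "b * e = b" and eb: "e * b = b" and fb: "f * b = b"
    unfolding a_def b_def by (metis ee ef fe ff mult.assoc)+
  have anbn: "a ^ Suc i * b ^ Suc i = e" for i
  proof (induction i)
    case (Suc i)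
    have "a ^ Suc (Suc i) * b ^ Suc (Suc i) = a * (a ^ Suc i * b ^ Suc i) * b"
      by (simp only: power_Suc2[of b] power_Suc[of a "Suc i"] mult.assoc)
    then show ?case
      by (simp only: Suc ae ab)
  qed (simp add: ab)
  \<comment> \<open>An idempotent with a right inverse is the identity of
    \<open>eTe\<close>.\<close>
  have aN: "a ^ N = e"
  proof -
    have "a ^ N = a ^ N * e"
      unfolding M(1) power_Suc2 by (simp add: mult.assoc ae)
    also have "\<dots> = (a ^ N * a ^ N) * b ^ N"
      using anbn[of M] by (simp only: M(1) mult.assoc)
    also have "\<dots> = e"
      using N(2)[OF aT] anbn[of M] by (simp only: M(1))
    finally show ?thesis .
  qed
  have "b = a ^ N * b"
    by (simp add: aN eb)
  also have "\<dots> = a ^ M * (a * b)"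
    unfolding M(1) power_Suc2 by (simp only: mult.assoc)
  also have "\<dots> = a ^ M"
  proof -
    obtain M' where "M = Suc M'"
      using M(2) by (cases M) auto
    then show ?thesis
      by (simp only: ab power_Suc2 mult.assoc ae)
  qed
  finally have "b * a = e"
    using aN by (simp add: M(1) power_Suc2 del: power_Suc)
  then have "f = e"
    by (metis fb fe mult.assoc)
  then show ?thesis
    by (simp add: f_def y_def e_def)
qed

lemma digit_prod_power_positive:
  assumes "0 < n" "n < k ^ l" "0 < l"
  shows "\<exists>l' n'. 0 < l' \<and> 0 < n' \<and> n' < k ^ l' \<and> digit_prod k D l n ^ Suc i = digit_prod k D l' n'"
proof (induction i)
  case 0
  then show ?case
    using assms by auto
next
  case (Suc i)
  then obtain l' n' where *: "0 < l'" "0 < n'" "n' < k ^ l'" "digit_prod k D l n ^ Suc i = digit_prod k D l' n'"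
    by blast
  have "n * k ^ l' + n' < Suc n * k ^ l'"
    using *(3) by simp
  also have "\<dots> \<le> k ^ l * k ^ l'"
    using assms(2) by (intro mult_le_mono1) simp
  finally have "n * k ^ l' + n' < k ^ (l + l')"
    by (simp add: power_add)
  moreover have "digit_prod k D l n ^ Suc (Suc i) = digit_prod k D (l + l') (n * k ^ l' + n')"
    unfolding digit_prod_concat[OF *(3)] power_Suc[of _ "Suc i"] *(4) ..
  ultimately show ?case
    using * by (intro exI[of _ "l + l'"] exI[of _ "n * k ^ l' + n'"]) simp
qed

lemma word_monoid_exists:
  fixes D :: "nat \<Rightarrow> 'm::monoid_mult"
  assumes k: "2 \<le> k" and fin: "finite {digit_prod k D l n |l n. n < k ^ l}"
  shows "\<exists>l p N T. 0 < l \<and> word_monoid (k ^ l) p N (digit_prod k D l) T"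
proof -
  define words where "words k D = {digit_prod k D l n |l n. n < k ^ l}" for k and D :: "nat \<Rightarrow> 'm"
  have words_one: "1 \<in> words k D" for k D
    unfolding words_def by (intro CollectI exI[of _ 0]) simp
  have words_mult: "x * y \<in> words k D" if "x \<in> words k D" "y \<in> words k D" for x y k D
  proof -
    obtain l n l' n' where *: "n < k ^ l" "x = digit_prod k D l n" "n' < k ^ l'" "y = digit_prod k D l' n'"
      using \<open>x \<in> words k D\<close> \<open>y \<in> words k D\<close> by (auto simp: words_def)
    have "n * k ^ l' + n' < Suc n * k ^ l'"
      using * by simp
    also have "\<dots> \<le> k ^ l * k ^ l'"
      using * by (intro mult_le_mono1) simp
    finally have "n * k ^ l' + n' < k ^ (l + l')"
      by (simp add: power_add)
    then show ?thesis
      using *(2,4) digit_prod_concat[OF *(3), of D l n] unfolding words_def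
      by (intro CollectI exI[of _ "l + l'"] exI[of _ "n * k ^ l' + n'"]) simp
  qed
  have words_digit: "D j \<in> words k D" if "j < k" for j k D
    unfolding words_def using that by (intro CollectI exI[of _ 1] exI[of _ j]) simp
  let ?T = "words k D"
  have finT: "finite ?T"
    using fin by (simp add: words_def)
  obtain N where N: "2 \<le> N" "\<And>x. x \<in> ?T \<Longrightarrow> x ^ N * x ^ N = x ^ N"
    using finite_monoid_idempotent_power[OF finT words_one words_mult] by blast
  obtain z where z: "z \<in> ?T" "\<And>a b. a \<in> ?T \<Longrightarrow> b \<in> ?T \<Longrightarrow> \<exists>c\<in>?T. \<exists>d\<in>?T. z = c * (a * z * b) * d"
    using finite_monoid_kernel[OF finT words_one words_mult] by blast
  \<comment> \<open>The leading digit 1 makes the number representing \<open>w\<close> positive, and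
    hence also \<open>p\<close>; repdigits of \<open>p\<close> can then exceed any
    preperiod.\<close>
  define w where "w = D 1 * z"
  have D1: "D 1 \<in> ?T"
    using k by (intro words_digit) simp
  have w: "w \<in> ?T"
    unfolding w_def using D1 z(1) by (rule words_mult)
  have w_kernel: "\<exists>c\<in>?T. \<exists>d\<in>?T. w = c * (a * w * b) * d" if ab: "a \<in> ?T" "b \<in> ?T" for a b
  proof -
    obtain c d where cd: "c \<in> ?T" "d \<in> ?T" "z = c * ((a * D 1) * z * b) * d"
      using z(2)[OF words_mult[OF ab(1) D1] ab(2)] by blast
    then have "w = (D 1 * c) * (a * w * b) * d"
      unfolding w_def by (metis mult.assoc)
    then show ?thesis
      using cd D1 words_mult by blast
  qed
  have exponent: "(w ^ N * x * w ^ N) ^ N = w ^ N" if "x \<in> ?T" for x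
    using kernel_group_exponent[OF words_one words_mult N w w_kernel that] .
  obtain l n where n: "n < k ^ l" "z = digit_prod k D l n"
    using z(1) by (auto simp: words_def)
  have "w = digit_prod k D (1 + l) (1 * k ^ l + n)"
    unfolding digit_prod_concat[OF n(1)] using k by (simp add: w_def n(2))
  moreover have "1 * k ^ l + n < k ^ (1 + l)"
  proof -
    have "2 * k ^ l \<le> k * k ^ l"
      using k by (rule mult_le_mono1)
    then have "k ^ l + n < k * k ^ l"
      using n(1) by linarith
    then show ?thesis by simp
  qed
  moreover have "0 < 1 * k ^ l + n"
    using k by simp
  ultimately obtain l' p where p: "0 < l'" "0 < p" "p < k ^ l'" "w ^ Suc (N - 1) = digit_prod k D l' p"
    using digit_prod_power_positive[of "1 * k ^ l + n" k "1 + l" D "N - 1"] by auto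
  then have e: "digit_prod k D l' p = w ^ N"
    using N(1) by simp
  \<comment> \<open>Only words whose length is a multiple of \<open>l'\<close> are words in the new
    base. Their monoid may be smaller, but it inherits the exponent identity.\<close>
  let ?T' = "words (k ^ l') (digit_prod k D l')"
  have sub: "?T' \<subseteq> ?T"
  proof
    fix x assume "x \<in> ?T'"
    then obtain m n where "n < (k ^ l') ^ m" "x = digit_prod (k ^ l') (digit_prod k D l') m n"
      by (auto simp: words_def)
    then have "n < k ^ (l' * m)" "x = digit_prod k D (l' * m) n"
      by (simp_all add: power_mult digit_prod_base_power)
    then show "x \<in> ?T"
      unfolding words_def by blast
  qed
  have "word_monoid (k ^ l') p N (digit_prod k D l') ?T'"
  proof
    have "k \<le> k ^ l'"
      using p(1) k by (intro self_le_power) simp_all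
    with k show "2 \<le> k ^ l'" by simp
    show "finite ?T'"
      using finT sub by (rule finite_subset[rotated])
    show "\<exists>m n. n < (k ^ l') ^ m \<and> x = digit_prod (k ^ l') (digit_prod k D l') m n" if "x \<in> ?T'" for x
      using that unfolding words_def by blast
    show "(digit_prod k D l' p * x * digit_prod k D l' p) ^ N = digit_prod k D l' p" if "x \<in> ?T'" for x
      using exponent sub that by (simp only: e) blast
    show "digit_prod k D l' p * digit_prod k D l' p = digit_prod k D l' p"
      using N(2)[OF w] by (simp only: e)
  qed (use p N words_one words_mult words_digit in auto)
  with p(1) show ?thesis by blast
qed

text \<open>A type of its own, so that composition can serve as the multiplication of
  \<open>monoid_mult\<close>.\<close>

typedef 'a endo = "UNIV :: ('a \<Rightarrow> 'a) set" by simp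

setup_lifting type_definition_endo

text \<open>Words act from left to right, hence the order of composition.\<close>
instantiation endo :: (type) monoid_mult
begin

lift_definition one_endo :: "'a endo" is "\<lambda>x. x" .

lift_definition times_endo :: "'a endo \<Rightarrow> 'a endo \<Rightarrow> 'a endo" is "\<lambda>f g x. g (f x)" .

instance
  by standard (transfer; simp)+

end

lemma finite_endo:
  assumes "finite S"
  shows "finite {f. (\<forall>x\<in>S. Rep_endo f x \<in> S) \<and> (\<forall>x. x \<notin> S \<longrightarrow> Rep_endo f x = x)}" (is "finite ?F")
proof -
  let ?G = "{g. \<forall>x. (x \<in> S \<longrightarrow> g x \<in> S) \<and> (x \<notin> S \<longrightarrow> g x = undefined)}"
  have "?F \<subseteq> (\<lambda>g. Abs_endo (\<lambda>x. if x \<in> S then g x else x)) ` ?G"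
  proof
    fix f assume f: "f \<in> ?F"
    let ?g = "\<lambda>x. if x \<in> S then Rep_endo f x else undefined"
    have "(\<lambda>x. if x \<in> S then ?g x else x) = Rep_endo f"
      using f by auto
    then have "f = Abs_endo (\<lambda>x. if x \<in> S then ?g x else x)"
      by (simp only: Rep_endo_inverse)
    moreover have "?g \<in> ?G"
      using f by auto
    ultimately show "f \<in> (\<lambda>g. Abs_endo (\<lambda>x. if x \<in> S then g x else x)) ` ?G"
      by (rule image_eqI)
  qed
  moreover have "finite ?G"
    using assms by (rule finite_set_of_finite_funs[OF _ assms])
  ultimately show ?thesis
    by (meson finite_imageI finite_subset)
qed

text \<open>The additional state \<open>None\<close> absorbs leading zeros.\<close>
lemma automatic_digit_prod:
  fixes a :: "nat \<Rightarrow> 'o"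
  assumes k: "2 \<le> k" and "automatic_in_base k a"
  shows "\<exists>(D :: nat \<Rightarrow> nat option endo) f. finite {digit_prod k D l n |l n. n < k ^ l} \<and>
    (\<forall>l n. n < k ^ l \<longrightarrow> a n = f (digit_prod k D l n))"
proof -
  obtain A :: "(nat, 'o) automaton" where A: "k_automaton k A" and prod: "produces_forwards k A a"
    using assms(2) by (auto simp: automatic_in_base_def)
  \<comment> \<open>Values outside \<open>states A\<close> are fixed, so that all word maps are the
    identity off the finite set \<open>S\<close> and only finitely many arise.\<close>
  define st where "st j s = (case s of None \<Rightarrow> if j = 0 then None else Some (step A (init_state A) j)
    | Some s \<Rightarrow> Some (if s \<in> states A then step A s j else s))" for j s
  define D where "D j = Abs_endo (st j)" for j
  have Rep_D: "Rep_endo (D j) = st j" for j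
    by (simp add: D_def Abs_endo_inverse)
  have Rep_mult: "Rep_endo (x * y) s = Rep_endo y (Rep_endo x s)" for x y :: "nat option endo" and s
    by transfer simp
  have Rep_1: "Rep_endo 1 s = s" for s :: "nat option"
    by transfer simp
  define S where "S = insert None (Some ` states A)"
  have st_S: "st j s \<in> S" if "s \<in> S" "j < k" for j s
    using that A by (auto simp: S_def st_def k_automaton_def)
  have st_not_S: "st j s = s" if "s \<notin> S" for j s
    using that by (auto simp: S_def st_def split: option.splits)
  have "Rep_endo (digit_prod k D l n) s \<in> S" if "s \<in> S" for l n s
    using k st_S that by (induction l arbitrary: n) (simp_all add: Rep_1 Rep_mult Rep_D)
  moreover have "Rep_endo (digit_prod k D l n) s = s" if "s \<notin> S" for l n s
    using st_not_S that by (induction l arbitrary: n) (simp_all add: Rep_1 Rep_mult Rep_D)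
  moreover have "finite S"
    using A by (simp add: S_def k_automaton_def)
  ultimately have "finite {digit_prod k D l n |l n. n < k ^ l}"
    by (intro finite_subset[OF _ finite_endo[of S]]) auto
  moreover
  have reach: "Rep_endo (digit_prod k D l n) None =
      (if n = 0 then None else Some (run A (init_state A) (base_expansion k n)))" if "n < k ^ l" for l n
    using that
  proof (induction l arbitrary: n)
    case 0
    then show ?case by (simp add: Rep_1)
  next
    case (Suc l)
    have "n div k < k ^ l"
      using Suc.prems k by (simp add: div_less_iff_less_mult mult.commute)
    note IH = Suc.IH[OF this]
    show ?case
    proof (cases "n = 0")
      case True
      then show ?thesis
        using IH by (simp add: Rep_mult Rep_D st_def)
    next
      case False
      have exp: "base_expansion k n = base_expansion k (n div k) @ [n mod k]"
        using False k by (subst base_expansion.simps) simp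
      show ?thesis
      proof (cases "n div k = 0")
        case True
        then have "n < k" "n mod k = n"
          using k by (auto simp: div_eq_0_iff)
        moreover have "base_expansion k 0 = []"
          by (simp add: base_expansion.simps)
        ultimately show ?thesis
          using False IH True exp by (simp add: Rep_mult Rep_D st_def run_def)
      next
        case nz: False
        have "run A (init_state A) (base_expansion k (n div k)) \<in> states A"
          using A by (intro run_in_states[OF A] base_expansion_lists) (simp add: k_automaton_def)
        then show ?thesis
          using False IH nz exp by (simp add: Rep_mult Rep_D st_def run_def)
      qed
    qed
  qed
  define f where "f x = (case Rep_endo x None of None \<Rightarrow> out_map A (init_state A) | Some s \<Rightarrow> out_map A s)"
    for x :: "nat option endo"
  have "a n = f (digit_prod k D l n)" if "n < k ^ l" for l n
  proof (cases "n = 0")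
    case True
    have "base_expansion k 0 = []"
      by (simp add: base_expansion.simps)
    then show ?thesis
      using prod reach[OF that] True by (simp add: f_def produces_forwards_def run_def)
  next
    case False
    then show ?thesis
      using prod reach[OF that] by (simp add: f_def produces_forwards_def)
  qed
  ultimately show ?thesis by blast
qed

section \<open>Cancellation in blocks of digits\<close>

abbreviation box :: "nat \<Rightarrow> nat \<Rightarrow> (nat \<Rightarrow> nat) set" where
  "box d m \<equiv> {0..d} \<rightarrow>\<^sub>E {..<m}"

lemma card_box: "card (box d m) = m ^ Suc d"
  by (simp add: card_PiE)

lemma vertex_restrict: "A \<subseteq> {1..d} \<Longrightarrow> vertex (\<lambda>i\<in>{0..d}. f i) A = vertex f A"
proof -
  assume "A \<subseteq> {1..d}"
  then have "sum (\<lambda>i\<in>{0..d}. f i) A = sum f A"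
    by (intro sum.cong) auto
  then show ?thesis
    by (simp add: vertex_def)
qed

lemma vertex_split: "vertex (\<lambda>i. f i * c + g i) A = vertex f A * c + vertex g A" for c :: nat
  by (simp add: vertex_def sum.distrib algebra_simps flip: sum_distrib_left sum_distrib_right)

text \<open>Since \<open>(d + 1) * (K - 1) + d\<close> is still less than
  \<open>(d + 1) * K\<close>, an incoming carry of at most \<open>d\<close> produces an outgoing
  carry of at most \<open>d\<close>.\<close>

lemma vertex_box_bound:
  assumes "r \<in> box d K" "A \<subseteq> {1..d}" "b \<le> d"
  shows "vertex r A + b < Suc d * K"
proof -
  have K: "r i \<le> K - 1" "0 < K" if "i \<le> d" for i
    using PiE_mem[OF assms(1), of i] that by auto
  have finA: "finite A"
    using assms(2) finite_subset by blast
  have "sum r A \<le> card A * (K - 1)"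
    using sum_bounded_above[of A r "K - 1"] K assms(2) by fastforce
  also have "\<dots> \<le> d * (K - 1)"
    using card_mono[OF _ assms(2)] by (intro mult_le_mono1) simp
  finally have "vertex r A + b \<le> (K - 1) + d * (K - 1) + d"
    using K[of 0] assms(3) unfolding vertex_def by linarith
  also have "\<dots> < Suc d * K"
    using K(2)[of 0] by (cases K) auto
  finally show ?thesis .
qed

lemma sum_box_mult:
  fixes f :: "(nat \<Rightarrow> nat) \<Rightarrow> 'b::comm_monoid_add"
  shows "(\<Sum>r\<in>box d (a * b). f r) =
    (\<Sum>s\<in>box d b. \<Sum>r\<in>box d a. f (\<lambda>i\<in>{0..d}. r i * b + s i))"
proof -
  have "(\<Sum>s\<in>box d b. \<Sum>r\<in>box d a. f (\<lambda>i\<in>{0..d}. r i * b + s i)) =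
      (\<Sum>(s, r)\<in>box d b \<times> box d a. f (\<lambda>i\<in>{0..d}. r i * b + s i))"
    by (rule sum.cartesian_product)
  also have "\<dots> = (\<Sum>r\<in>box d (a * b). f r)"
  proof (rule sum.reindex_bij_witness[where
        i = "\<lambda>r. (\<lambda>i\<in>{0..d}. r i mod b, \<lambda>i\<in>{0..d}. r i div b)" and
        j = "\<lambda>(s, r). \<lambda>i\<in>{0..d}. r i * b + s i"], goal_cases)
    case (1 x)
    then obtain s r where x: "x = (s, r)" "s \<in> box d b" "r \<in> box d a" by auto
    have "(r i * b + s i) mod b = s i" "(r i * b + s i) div b = r i" if "i \<le> d" for i
      using PiE_mem[OF x(2), of i] that by auto
    moreover have "s i = undefined" "r i = undefined" if "\<not> i \<le> d" for i
      using PiE_arb[OF x(2), of i] PiE_arb[OF x(3), of i] that by simp_all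
    ultimately have "(\<lambda>i\<in>{0..d}. (\<lambda>i\<in>{0..d}. r i * b + s i) i mod b) = s"
      "(\<lambda>i\<in>{0..d}. (\<lambda>i\<in>{0..d}. r i * b + s i) i div b) = r"
      by (simp_all add: fun_eq_iff)
    then show ?case by (simp add: x(1))
  next
    case (2 x)
    then obtain s r where x: "x = (s, r)" "s \<in> box d b" "r \<in> box d a" by auto
    have "r i * b + s i < a * b" if "i \<le> d" for i
    proof -
      have "s i < b" "r i < a"
        using PiE_mem[OF x(2), of i] PiE_mem[OF x(3), of i] that by simp_all
      then have "r i * b + s i < Suc (r i) * b" by simp
      also have "\<dots> \<le> a * b"
        using \<open>r i < a\<close> by (intro mult_le_mono1) simp
      finally show ?thesis .
    qed
    then show ?case by (auto simp: x(1))
  next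
    case (3 r)
    then have "r i = undefined" if "\<not> i \<le> d" for i
      using PiE_arb[of r _ _ i] that by simp
    then show ?case
      by (simp add: fun_eq_iff)
  next
    case (4 r)
    have "r i mod b < b" "r i div b < a" if "i \<le> d" for i
    proof -
      have "r i < a * b"
        using PiE_mem[OF 4, of i] that by simp
      moreover from this have "0 < b"
        by (cases b) auto
      ultimately show "r i mod b < b" "r i div b < a"
        by (simp_all add: div_less_iff_less_mult)
    qed
    then show ?case by auto
  next
    case (5 x)
    then show ?case by auto
  qed
  finally show ?thesis ..
qed

context uniform_monoid
begin

text \<open>
  A digit \<open>p\<close>, a cube of \<open>H_cube\<close>, another digit \<open>p\<close>, and at the bottom \<open>d\<close> zeros which absorb a carry.
\<close>
lemma cancelling_family:
  "\<exists>l>0. \<exists>\<rho>. inj_on \<rho> H \<and> \<rho> ` H \<subseteq> box d (k ^ l) \<and>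
    (\<forall>g\<in>H. \<forall>A\<subseteq>{1..d}. \<forall>b\<le>d. vertex (\<rho> g) A + b < k ^ l \<and>
      E l (vertex (\<rho> g) A + b) = (if {1..d} \<subseteq> A then g else e) * E d b)"
proof -
  obtain L M where LM: "\<And>g. g \<in> H \<Longrightarrow> vertex (M g) {1..d} < k ^ L g"
    "\<And>g A. g \<in> H \<Longrightarrow> A \<subseteq> {1..d} \<Longrightarrow> h (L g) (vertex (M g) A) = (if {1..d} \<subseteq> A then g else e)"
    using H_cube[of _ d] by metis
  \<comment> \<open>One length for all cubes of the family; the successor leaves room for at least
    one leading \<open>p\<close>.\<close>
  define m where "m = Suc (Max (L ` H))"
  define s where "s g = m - L g" for g
  have s: "s g + L g = m" "0 < s g" if "g \<in> H" for g
  proof -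
    have "L g \<le> Max (L ` H)"
      using that finite_H by simp
    then show "s g + L g = m" "0 < s g"
      by (simp_all add: s_def m_def)
  qed
  define l where "l = (m + 1) + d"
  define \<sigma> where "\<sigma> g i = (if i = 0 then (repdigit k p (s g) * k ^ L g + M g 0) * k + p else M g i * k) * k ^ d" for g i
  have v: "vertex (\<sigma> g) A = ((repdigit k p (s g) * k ^ L g + vertex (M g) A) * k ^ 1 + p) * k ^ d"
    if "A \<subseteq> {1..d}" for g A
  proof -
    have "sum (\<sigma> g) A = (\<Sum>i\<in>A. M g i * (k * k ^ d))"
      using that by (intro sum.cong) (auto simp: \<sigma>_def)
    also have "\<dots> = sum (M g) A * (k * k ^ d)"
      by (simp only: sum_distrib_right)
    finally show ?thesis
      by (simp add: vertex_def \<sigma>_def algebra_simps)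
  qed
  have d_less: "b < k ^ d" if "b \<le> d" for b
  proof -
    have "b < 2 ^ d"
      by (rule le_less_trans[OF that less_exp])
    also have "\<dots> \<le> k ^ d"
      using k_ge by (intro power_mono) simp_all
    finally show ?thesis .
  qed
  have main: "vertex (\<sigma> g) A + b < k ^ l \<and>
      E l (vertex (\<sigma> g) A + b) = (if {1..d} \<subseteq> A then g else e) * E d b"
    if gA: "g \<in> H" "A \<subseteq> {1..d}" "b \<le> d" for g A b
  proof
    define x where "x = repdigit k p (s g) * k ^ L g + vertex (M g) A"
    have less: "vertex (M g) A < k ^ L g"
      using vertex_mono[OF gA(2), of "M g"] LM(1)[OF gA(1)] by simp
    have "x < k ^ m"
      using prepend_less[OF less, of "s g"] s(1)[OF gA(1)] by (simp add: x_def)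
    then have "x * k + k \<le> k ^ m * k"
      by (metis Suc_leI add.commute mult_Suc mult_le_mono1)
    then have "x * k + p < k ^ m * k"
      using p_less by linarith
    then have "x * k + p < k ^ (m + 1)"
      by (simp add: mult.commute)
    then have "Suc (x * k + p) * k ^ d \<le> k ^ (m + 1) * k ^ d"
      by (intro mult_le_mono1) simp
    then show "vertex (\<sigma> g) A + b < k ^ l"
      using d_less[OF gA(3)] v[OF gA(2), of g] by (simp add: l_def power_add flip: x_def)
    have "E l (vertex (\<sigma> g) A + b) = E (m + 1) (x * k ^ 1 + p) * E d b"
      unfolding l_def v[OF gA(2)] x_def by (rule digit_prod_concat[OF d_less[OF gA(3)]])
    also have "E (m + 1) (x * k ^ 1 + p) = E m x * E 1 p"
      using p_less by (intro digit_prod_concat) simp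
    also have "E m x = e * E (L g) (vertex (M g) A)"
      unfolding x_def s(1)[OF gA(1), symmetric] digit_prod_concat[OF less] E_repdigit e_power[OF s(2)[OF gA(1)]] ..
    also have "E 1 p = e"
      using p_less by simp
    finally show "E l (vertex (\<sigma> g) A + b) = (if {1..d} \<subseteq> A then g else e) * E d b"
      using LM(2)[OF gA(1,2)] unfolding h_def by simp
  qed
  define \<rho> where "\<rho> g = (\<lambda>i\<in>{0..d}. \<sigma> g i)" for g
  have v\<rho>: "vertex (\<rho> g) A = vertex (\<sigma> g) A" if "A \<subseteq> {1..d}" for g A
    unfolding \<rho>_def using that by (rule vertex_restrict)
  have "inj_on \<rho> H"
  proof (rule inj_onI)
    fix g g' assume g: "g \<in> H" "g' \<in> H" "\<rho> g = \<rho> g'"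
    \<comment> \<open>The top vertex reveals \<open>g\<close>: multiplied by \<open>e\<close>, the
      common factor \<open>E d 0\<close> becomes invertible in \<open>G\<close>.\<close>
    have "E l (vertex (\<rho> x) {1..d}) = x * E d 0" if "x \<in> H" for x
      using main[OF that, of "{1..d}" 0] v\<rho>[of "{1..d}" x] by simp
    then have "g * E d 0 * e = g' * E d 0 * e"
      using g by metis
    then have "g * h d 0 = g' * h d 0"
      unfolding h_def using g H_in_G by (simp add: mult.assoc)
    then have "g * h d 0 * ginv (h d 0) = g' * h d 0 * ginv (h d 0)"
      by simp
    then show "g = g'"
      using g by (simp add: mult.assoc h_in_G H_in_G)
  qed
  moreover have "\<rho> g \<in> box d (k ^ l)" if g: "g \<in> H" for g
  proof -
    have "\<sigma> g i < k ^ l" if "i \<le> d" for i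
    proof -
      have "\<sigma> g i \<le> vertex (\<sigma> g) {1..d}"
      proof (cases "i = 0")
        case False
        then have "vertex (\<sigma> g) {i} \<le> vertex (\<sigma> g) {1..d}"
          using that by (intro vertex_mono) auto
        then show ?thesis by (simp add: vertex_def)
      qed (simp add: vertex_def)
      also have "\<dots> < k ^ l"
        using main[OF g, of "{1..d}" 0] by simp
      finally show ?thesis .
    qed
    then show ?thesis by (auto simp: \<rho>_def)
  qed
  moreover have "0 < l"
    by (simp add: l_def)
  ultimately show ?thesis
    using main v\<rho> by (intro exI[of _ l] conjI exI[of _ \<rho>]) auto
qed

text \<open>In each block of \<open>l\<close> digits the choices from the cancelling family sum to
  zero, so at least one of the \<open>(k ^ l) ^ Suc d\<close> choices is saved. \<open>l\<close> is
  fixed before \<open>F\<close>, \<open>U\<close>, \<open>Z\<close> and \<open>m\<close>;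
  \<open>Z\<close> stands for the higher digits, which see the lower ones only through a
  carry.\<close>

lemma cube_sum_bound:
  "\<exists>l>0. \<forall>F U Z m. 0 \<le> U \<longrightarrow> (\<forall>A. \<forall>x\<in>T. cmod (F A x) \<le> U) \<longrightarrow>
     (\<forall>u\<in>T. \<forall>v\<in>T. (\<Sum>g\<in>H. F {1..d} (u * g * v)) = 0) \<longrightarrow> (\<forall>A c. Z A c \<in> T) \<longrightarrow>
     cmod (\<Sum>r\<in>box d (k ^ (m * l)). \<Prod>A\<in>Pow {1..d}.
       F A (Z A (vertex r A div k ^ (m * l)) * E (m * l) (vertex r A)))
     \<le> (real ((k ^ l) ^ Suc d) - 1) ^ m * U ^ (2 ^ d)"
proof -
  obtain l \<rho> where l: "0 < l" and inj: "inj_on \<rho> H" and box: "\<rho> ` H \<subseteq> box d (k ^ l)"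
    and fam: "\<forall>g\<in>H. \<forall>A\<subseteq>{1..d}. \<forall>b\<le>d. vertex (\<rho> g) A + b < k ^ l \<and>
      E l (vertex (\<rho> g) A + b) = (if {1..d} \<subseteq> A then g else e) * E d b"
    using cancelling_family[of d] by (elim exE conjE) (rule that; assumption)
  have less: "vertex (\<rho> g) A + b < k ^ l"
    and E\<rho>: "E l (vertex (\<rho> g) A + b) = (if {1..d} \<subseteq> A then g else e) * E d b"
    if "g \<in> H" "A \<subseteq> {1..d}" "b \<le> d" for g A b
    using fam that by blast+
  have main: "cmod (\<Sum>r\<in>box d (k ^ (m * l)). \<Prod>A\<in>Pow {1..d}.
       F A (Z A (vertex r A div k ^ (m * l)) * E (m * l) (vertex r A)))
     \<le> (real ((k ^ l) ^ Suc d) - 1) ^ m * U ^ (2 ^ d)"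
    if U: "0 \<le> U" "\<And>A x. x \<in> T \<Longrightarrow> cmod (F A x) \<le> U"
      and cancel: "\<And>u v. u \<in> T \<Longrightarrow> v \<in> T \<Longrightarrow> (\<Sum>g\<in>H. F {1..d} (u * g * v)) = 0"
      and Z: "\<And>A c. Z A c \<in> T" for F :: "nat set \<Rightarrow> 'a \<Rightarrow> complex" and U Z m
  proof -
    \<comment> \<open>The quantity for the induction: \<open>b A\<close> is the carry from the lower
      blocks already removed, \<open>y A\<close> the product of their digits.\<close>
    define S where "S L b y = (\<Sum>r\<in>box d (k ^ L). \<Prod>A\<in>Pow {1..d}.
       F A (Z A ((vertex r A + b A) div k ^ L) * E L (vertex r A + b A) * y A))" for L b y
    have S_split: "S (L + l) b y = (\<Sum>s\<in>box d (k ^ l).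
        S L (\<lambda>A. (vertex s A + b A) div k ^ l) (\<lambda>A. E l (vertex s A + b A) * y A))" for L b y
    proof -
      have "S (L + l) b y = (\<Sum>s\<in>box d (k ^ l). \<Sum>r\<in>box d (k ^ L). \<Prod>A\<in>Pow {1..d}.
          F A (Z A ((vertex (\<lambda>i\<in>{0..d}. r i * k ^ l + s i) A + b A) div k ^ (L + l)) *
            E (L + l) (vertex (\<lambda>i\<in>{0..d}. r i * k ^ l + s i) A + b A) * y A))"
        unfolding S_def power_add by (rule sum_box_mult)
      also have "\<dots> = (\<Sum>s\<in>box d (k ^ l). \<Sum>r\<in>box d (k ^ L). \<Prod>A\<in>Pow {1..d}.
          F A (Z A ((vertex r A + (vertex s A + b A) div k ^ l) div k ^ L) *
            E L (vertex r A + (vertex s A + b A) div k ^ l) * (E l (vertex s A + b A) * y A)))"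
      proof (intro sum.cong refl prod.cong)
        fix s r A assume "A \<in> Pow {1..d}"
        then have A: "A \<subseteq> {1..d}" by simp
        have v: "vertex (\<lambda>i\<in>{0..d}. r i * k ^ l + s i) A + b A =
            vertex r A * k ^ l + (vertex s A + b A)"
          unfolding vertex_restrict[OF A] vertex_split by simp
        have q: "(vertex r A * k ^ l + (vertex s A + b A)) div k ^ l =
            vertex r A + (vertex s A + b A) div k ^ l"
          using k_ge by (simp add: div_plus_div_distrib_dvd_left)
        have "E l (vertex r A * k ^ l + (vertex s A + b A)) = E l (vertex s A + b A)"
          by (metis digit_prod_mod mod_mult_self3)
        moreover have "x div k ^ (L + l) = x div k ^ l div k ^ L" for x
          by (simp add: power_add mult.commute[of "k ^ L"] div_mult2_eq)
        ultimately show "F A (Z A ((vertex (\<lambda>i\<in>{0..d}. r i * k ^ l + s i) A + b A) div k ^ (L + l)) *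
            E (L + l) (vertex (\<lambda>i\<in>{0..d}. r i * k ^ l + s i) A + b A) * y A) =
          F A (Z A ((vertex r A + (vertex s A + b A) div k ^ l) div k ^ L) *
            E L (vertex r A + (vertex s A + b A) div k ^ l) * (E l (vertex s A + b A) * y A))"
          unfolding v digit_prod_split[of k D L l] by (simp only: q mult.assoc)
      qed
      finally show ?thesis
        unfolding S_def .
    qed
    \<comment> \<open>On the cancelling family no carry leaves the block. Thus the higher digits are
      the same for all \<open>g\<close>, and only the factor at the top vertex varies.\<close>
    have S_cancel: "(\<Sum>s\<in>\<rho> ` H.
        S L (\<lambda>A. (vertex s A + b A) div k ^ l) (\<lambda>A. E l (vertex s A + b A) * y A)) = 0"
      if b: "\<And>A. b A \<le> d" and y: "\<And>A. y A \<in> T" for L b y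
    proof -
      define W where "W r A = Z A (vertex r A div k ^ L) * E L (vertex r A)" for r A
      define Y where "Y A = E d (b A) * y A" for A
      have W: "W r A \<in> T" and Y: "Y A \<in> T" for r A
        using Z y E_in by (auto simp: W_def Y_def intro: mult_in)
      have "(\<Sum>s\<in>\<rho> ` H. S L (\<lambda>A. (vertex s A + b A) div k ^ l) (\<lambda>A. E l (vertex s A + b A) * y A)) =
          (\<Sum>g\<in>H. S L (\<lambda>A. (vertex (\<rho> g) A + b A) div k ^ l) (\<lambda>A. E l (vertex (\<rho> g) A + b A) * y A))"
        using inj by (simp add: sum.reindex)
      also have "\<dots> = (\<Sum>g\<in>H. \<Sum>r\<in>box d (k ^ L). F {1..d} (W r {1..d} * g * Y {1..d}) *
          (\<Prod>A\<in>Pow {1..d} - {{1..d}}. F A (W r A * e * Y A)))"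
        unfolding S_def
      proof (intro sum.cong refl)
        fix g r assume g: "g \<in> H"
        have "(\<Prod>A\<in>Pow {1..d}. F A (Z A ((vertex r A + (vertex (\<rho> g) A + b A) div k ^ l) div k ^ L) *
            E L (vertex r A + (vertex (\<rho> g) A + b A) div k ^ l) * (E l (vertex (\<rho> g) A + b A) * y A))) =
          (\<Prod>A\<in>Pow {1..d}. F A (W r A * (if {1..d} \<subseteq> A then g else e) * Y A))"
          using less[OF g _ b] E\<rho>[OF g _ b] by (intro prod.cong refl) (simp add: W_def Y_def mult.assoc)
        also have "\<dots> = F {1..d} (W r {1..d} * g * Y {1..d}) *
            (\<Prod>A\<in>Pow {1..d} - {{1..d}}. F A (W r A * (if {1..d} \<subseteq> A then g else e) * Y A))"
          by (subst prod.remove[of _ "{1..d}"]) auto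
        also have "(\<Prod>A\<in>Pow {1..d} - {{1..d}}. F A (W r A * (if {1..d} \<subseteq> A then g else e) * Y A)) =
            (\<Prod>A\<in>Pow {1..d} - {{1..d}}. F A (W r A * e * Y A))"
          by (intro prod.cong refl) auto
        finally show "(\<Prod>A\<in>Pow {1..d}. F A (Z A ((vertex r A + (vertex (\<rho> g) A + b A) div k ^ l) div k ^ L) *
            E L (vertex r A + (vertex (\<rho> g) A + b A) div k ^ l) * (E l (vertex (\<rho> g) A + b A) * y A))) =
          F {1..d} (W r {1..d} * g * Y {1..d}) * (\<Prod>A\<in>Pow {1..d} - {{1..d}}. F A (W r A * e * Y A))" .
      qed
      also have "\<dots> = (\<Sum>r\<in>box d (k ^ L). (\<Sum>g\<in>H. F {1..d} (W r {1..d} * g * Y {1..d})) *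
          (\<Prod>A\<in>Pow {1..d} - {{1..d}}. F A (W r A * e * Y A)))"
        by (subst sum.swap) (simp only: sum_distrib_right)
      also have "\<dots> = 0"
        by (simp only: cancel[OF W Y]) simp
      finally show ?thesis .
    qed
    have bound: "cmod (S (m * l) b y) \<le> (real ((k ^ l) ^ Suc d) - 1) ^ m * U ^ (2 ^ d)"
      if "\<And>A. b A \<le> d" "\<And>A. y A \<in> T" for b y
      using that
    proof (induction m arbitrary: b y)
      case 0
      have "cmod (S 0 b y) \<le> (\<Sum>r\<in>box d 1. \<Prod>A\<in>Pow {1..d}. U)"
        unfolding S_def
      proof (rule order_trans[OF norm_sum], simp only: power_0, rule sum_mono)
        fix r
        show "cmod (\<Prod>A\<in>Pow {1..d}. F A (Z A ((vertex r A + b A) div 1) * E 0 (vertex r A + b A) * y A))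
            \<le> (\<Prod>A\<in>Pow {1..d}. U)"
          unfolding prod_norm[symmetric]
          by (intro prod_mono conjI norm_ge_zero U(2) mult_in Z 0 E_in)
      qed
      also have "\<dots> = U ^ (2 ^ d)"
        by (simp add: card_box card_Pow)
      finally show ?case by simp
    next
      case (Suc m)
      let ?S = "\<lambda>s. S (m * l) (\<lambda>A. (vertex s A + b A) div k ^ l) (\<lambda>A. E l (vertex s A + b A) * y A)"
      let ?B = "(real ((k ^ l) ^ Suc d) - 1) ^ m * U ^ (2 ^ d)"
      have fin_box: "finite (box d (k ^ l))"
        by (intro finite_PiE) auto
      have "0 < (k ^ l) ^ Suc d"
        using k_ge by simp
      then have pos: "1 \<le> real ((k ^ l) ^ Suc d)"
        by linarith
      have "S (Suc m * l) b y = (\<Sum>s\<in>box d (k ^ l). ?S s)"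
        using S_split[of "m * l" b y] by (simp add: add.commute)
      also have "\<dots> = (\<Sum>s\<in>box d (k ^ l) - \<rho> ` H. ?S s) + (\<Sum>s\<in>\<rho> ` H. ?S s)"
        by (rule sum.subset_diff[OF box fin_box])
      also have "(\<Sum>s\<in>\<rho> ` H. ?S s) = 0"
        using Suc.prems by (intro S_cancel)
      finally have "cmod (S (Suc m * l) b y) \<le> (\<Sum>s\<in>box d (k ^ l) - \<rho> ` H. cmod (?S s))"
        by (simp add: norm_sum)
      also have "\<dots> \<le> (\<Sum>s\<in>box d (k ^ l) - \<rho> ` H. ?B)"
      proof (rule sum_mono)
        fix s assume "s \<in> box d (k ^ l) - \<rho> ` H"
        then have s: "s \<in> box d (k ^ l)" by simp
        \<comment> \<open>The induction hypothesis wants the carry bound at every index; sets that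
          are not vertices get carry 0.\<close>
        define b' where "b' A = (if A \<subseteq> {1..d} then (vertex s A + b A) div k ^ l else 0)" for A
        have "b' A \<le> d" for A
        proof -
          have "(vertex s A + b A) div k ^ l < Suc d" if "A \<subseteq> {1..d}"
            using vertex_box_bound[OF s that Suc.prems(1)[of A]] k_ge by (intro less_mult_imp_div_less)
          then show ?thesis by (simp add: b'_def flip: less_Suc_eq_le)
        qed
        moreover have "E l (vertex s A + b A) * y A \<in> T" for A
          using Suc.prems(2) E_in by (intro mult_in)
        ultimately have "cmod (S (m * l) b' (\<lambda>A. E l (vertex s A + b A) * y A)) \<le> ?B"
          by (rule Suc.IH)
        moreover have "S (m * l) b' (\<lambda>A. E l (vertex s A + b A) * y A) = ?S s"
          unfolding S_def by (intro sum.cong refl prod.cong) (simp add: b'_def)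
        ultimately show "cmod (?S s) \<le> ?B" by simp
      qed
      also have "\<dots> = real (card (box d (k ^ l) - \<rho> ` H)) * ?B"
        by simp
      also have "\<dots> \<le> (real ((k ^ l) ^ Suc d) - 1) * ?B"
      proof (rule mult_right_mono)
        have "card (box d (k ^ l) - \<rho> ` H) = (k ^ l) ^ Suc d - card H"
          using box finite_H inj by (simp add: card_Diff_subset card_image card_box del: power_Suc)
        then show "real (card (box d (k ^ l) - \<rho> ` H)) \<le> real ((k ^ l) ^ Suc d) - 1"
          using card_H_pos pos by linarith
        show "0 \<le> ?B"
          using pos U(1) by simp
      qed
      finally show ?case by (simp add: mult.assoc)
    qed
    from bound[of "\<lambda>_. 0" "\<lambda>_. 1"] show ?thesis
      unfolding S_def using one_in by simp
  qed
  show ?thesis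
    by (intro exI[of _ l] conjI l allI impI main) simp_all
qed

end

section \<open>Gowers norms as averages over integer cubes\<close>

text \<open>The edges \<open>y i\<close> with \<open>i \<ge> 1\<close> may be negative.\<close>
definition cubes :: "nat \<Rightarrow> nat \<Rightarrow> (nat \<Rightarrow> int) set" where
  "cubes d N = {y \<in> {0..d} \<rightarrow>\<^sub>E UNIV. \<forall>A\<subseteq>{1..d}. vertex y A \<in> {0..<int N}}"

definition cube_sum :: "nat \<Rightarrow> nat \<Rightarrow> (nat \<Rightarrow> complex) \<Rightarrow> complex" where
  "cube_sum d N f = (\<Sum>y\<in>cubes d N. \<Prod>A\<in>Pow {1..d}. (cnj ^^ card A) (f (nat (vertex y A))))"

lemma cubes_range:
  assumes "y \<in> cubes d N"
  shows "y 0 \<in> {0..<int N}" "i \<in> {1..d} \<Longrightarrow> y i \<in> {- int N<..<int N}"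
proof -
  have v: "vertex y A \<in> {0..<int N}" if "A \<subseteq> {1..d}" for A
    using assms that by (auto simp: cubes_def)
  show y0: "y 0 \<in> {0..<int N}"
    using v[of "{}"] by (simp add: vertex_def)
  show "y i \<in> {- int N<..<int N}" if "i \<in> {1..d}"
    using v[of "{i}"] that y0 by (auto simp: vertex_def)
qed

lemma cubes_subset: "cubes d N \<subseteq> {0..d} \<rightarrow>\<^sub>E {- int N<..<int N}"
proof
  fix y assume y: "y \<in> cubes d N"
  have "y i \<in> {- int N<..<int N}" if "i \<le> d" for i
    using cubes_range(1)[OF y] cubes_range(2)[OF y, of i] that by (cases "i = 0") auto
  moreover have "y i = undefined" if "\<not> i \<le> d" for i
    using y that by (auto simp: cubes_def PiE_def extensional_def)
  ultimately show "y \<in> {0..d} \<rightarrow>\<^sub>E {- int N<..<int N}"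
    by (intro PiE_I) auto
qed

lemma finite_cubes: "finite (cubes d N)"
  by (rule finite_subset[OF cubes_subset]) (auto intro: finite_PiE)

lemma vertex_mod:
  fixes y :: "nat \<Rightarrow> int"
  assumes "A \<subseteq> {1..d}" "\<And>i. i \<le> d \<Longrightarrow> y i mod m = z i mod m"
  shows "vertex y A mod m = vertex z A mod m"
proof -
  have "sum y A mod m = (\<Sum>i\<in>A. y i mod m) mod m"
    by (rule mod_sum_eq[symmetric])
  also have "(\<Sum>i\<in>A. y i mod m) = (\<Sum>i\<in>A. z i mod m)"
    using assms by (intro sum.cong) auto
  also have "\<dots> mod m = sum z A mod m"
    by (rule mod_sum_eq)
  finally show ?thesis
    unfolding vertex_def using assms(2)[of 0] by (intro mod_add_cong) auto
qed

lemma finprod_integer_mod_group: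
  assumes "finite A" "f \<in> A \<rightarrow> carrier (integer_mod_group m)"
  shows "finprod (integer_mod_group m) f A = sum f A mod int m"
proof -
  interpret comm_group "integer_mod_group m" by simp
  show ?thesis
    using assms
  proof (induction A)
    case (insert x A)
    then have "finprod (integer_mod_group m) f (insert x A) = (f x + sum f A mod int m) mod int m"
      by (subst finprod_insert) auto
    then show ?case
      using insert.hyps by (simp add: mod_add_right_eq)
  qed simp
qed

lemma gowers_term:
  assumes "\<omega> \<in> {1..d} \<rightarrow>\<^sub>E {0, 1 :: nat}" "0 < m"
  shows "n 0 \<otimes>\<^bsub>integer_mod_group m\<^esub> (\<Otimes>\<^bsub>integer_mod_group m\<^esub>i\<in>{1..d}. n i [^]\<^bsub>integer_mod_group m\<^esub> \<omega> i) =
    vertex n {i \<in> {1..d}. \<omega> i = 1} mod int m"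
proof -
  have "(\<Otimes>\<^bsub>integer_mod_group m\<^esub>i\<in>{1..d}. n i [^]\<^bsub>integer_mod_group m\<^esub> \<omega> i) =
      (\<Sum>i\<in>{1..d}. n i [^]\<^bsub>integer_mod_group m\<^esub> \<omega> i) mod int m"
    using assms(2) by (intro finprod_integer_mod_group) (auto simp: carrier_integer_mod_group)
  also have "\<dots> = (\<Sum>i\<in>{1..d}. int (\<omega> i) * n i) mod int m"
    by (simp add: mod_sum_eq)
  also have "(\<Sum>i\<in>{1..d}. int (\<omega> i) * n i) = (\<Sum>i\<in>{i \<in> {1..d}. \<omega> i = 1}. n i)"
  proof (subst sum.inter_filter, simp, rule sum.cong[OF refl])
    fix i assume "i \<in> {1..d}"
    then have "\<omega> i = 0 \<or> \<omega> i = 1"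
      using PiE_mem[OF assms(1), of i] by auto
    then show "int (\<omega> i) * n i = (if \<omega> i = 1 then n i else 0)" by auto
  qed
  finally show ?thesis
    by (simp add: vertex_def mod_add_right_eq)
qed

lemma gowers_prod:
  assumes "0 < m"
  shows "(\<Prod>\<omega>\<in>{1..d} \<rightarrow>\<^sub>E {0, 1 :: nat}. (cnj ^^ (\<Sum>i\<in>{1..d}. \<omega> i))
      (F (n 0 \<otimes>\<^bsub>integer_mod_group m\<^esub> (\<Otimes>\<^bsub>integer_mod_group m\<^esub>i\<in>{1..d}. n i [^]\<^bsub>integer_mod_group m\<^esub> \<omega> i)))) =
    (\<Prod>A\<in>Pow {1..d}. (cnj ^^ card A) (F (vertex n A mod int m)))"
proof (rule prod.reindex_bij_witness[where
      i = "\<lambda>A. \<lambda>i\<in>{1..d}. if i \<in> A then 1 else 0" and j = "\<lambda>\<omega>. {i \<in> {1..d}. \<omega> i = 1}"], goal_cases)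
  case (1 \<omega>)
  have "\<omega> i = 0" if "i \<in> {1..d}" "\<omega> i \<noteq> 1" for i
    using PiE_mem[OF 1 that(1)] that(2) by auto
  moreover have "\<omega> i = undefined" if "i \<notin> {1..d}" for i
    using PiE_arb[OF 1 that] .
  ultimately show ?case
    by (auto simp: fun_eq_iff restrict_def)
next
  case (2 \<omega>)
  then show ?case by auto
next
  case (3 A)
  then show ?case by auto
next
  case (4 A)
  then show ?case by auto
next
  case (5 \<omega>)
  have "(\<Sum>i\<in>{1..d}. \<omega> i) = (\<Sum>i\<in>{1..d}. if \<omega> i = 1 then 1 else 0)"
  proof (rule sum.cong[OF refl])
    fix i assume "i \<in> {1..d}"
    then show "\<omega> i = (if \<omega> i = 1 then 1 else 0)"
      using PiE_mem[OF 5, of i] by auto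
  qed
  also have "\<dots> = card {i \<in> {1..d}. \<omega> i = 1}"
    by (subst sum.inter_filter[symmetric]) auto
  finally show ?case
    unfolding gowers_term[OF 5 assms] by simp
qed

lemma cnj_power_0 [simp]: "(cnj ^^ n) 0 = 0"
  by (induction n) auto

lemma cnj_power_1 [simp]: "(cnj ^^ n) 1 = 1"
  by (induction n) auto

lemma cmod_cnj_power [simp]: "cmod ((cnj ^^ n) z) = cmod z"
  by (induction n) auto

lemma cnj_power_sum: "(cnj ^^ n) (sum f S) = (\<Sum>x\<in>S. (cnj ^^ n) (f x))"
  by (induction n) auto

text \<open>
  Since \<open>m > 2N\<close>, a cube in the cyclic group with all vertices in \<open>[N]\<close> does not wrap around, and
  lifts uniquely to a cube in the integers.
\<close>
lemma gowers_sum_eq_cube_sum: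
  assumes m: "2 * N < m"
  shows "(\<Sum>n\<in>{0..d} \<rightarrow>\<^sub>E {0..<int m}. \<Prod>A\<in>Pow {1..d}.
      (cnj ^^ card A) (interval_restrict N f (vertex n A mod int m))) = cube_sum d N f"
proof -
  define P where "P = {n \<in> {0..d} \<rightarrow>\<^sub>E {0..<int m}. \<forall>A\<subseteq>{1..d}. vertex n A mod int m \<in> {0..<int N}}"
  \<comment> \<open>An edge joins two points of \<open>[0, N)\<close>, so a residue not below
    \<open>N\<close> has to represent a negative edge.\<close>
  define lift where "lift n = (\<lambda>i\<in>{0..d}. if i = 0 \<or> n i < int N then n i else n i - int m)" for n
  have lift_mod: "lift n i mod int m = n i mod int m" if "i \<le> d" for n i
    using that by (simp add: lift_def)
  have "(\<Sum>n\<in>{0..d} \<rightarrow>\<^sub>E {0..<int m}. \<Prod>A\<in>Pow {1..d}.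
      (cnj ^^ card A) (interval_restrict N f (vertex n A mod int m))) =
    (\<Sum>n\<in>P. \<Prod>A\<in>Pow {1..d}. (cnj ^^ card A) (interval_restrict N f (vertex n A mod int m)))"
  proof (rule sum.mono_neutral_right)
    show "finite ({0..d} \<rightarrow>\<^sub>E {0..<int m})"
      by (intro finite_PiE) auto
    show "P \<subseteq> {0..d} \<rightarrow>\<^sub>E {0..<int m}"
      by (auto simp: P_def)
    show "\<forall>n\<in>({0..d} \<rightarrow>\<^sub>E {0..<int m}) - P.
        (\<Prod>A\<in>Pow {1..d}. (cnj ^^ card A) (interval_restrict N f (vertex n A mod int m))) = 0"
    proof
      fix n assume "n \<in> ({0..d} \<rightarrow>\<^sub>E {0..<int m}) - P"
      then obtain A where "A \<subseteq> {1..d}" "vertex n A mod int m \<notin> {0..<int N}"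
        unfolding P_def by blast
      then show "(\<Prod>A\<in>Pow {1..d}. (cnj ^^ card A) (interval_restrict N f (vertex n A mod int m))) = 0"
        by (intro prod_zero bexI[of _ A]) (auto simp: interval_restrict_def)
    qed
  qed
  also have "\<dots> = cube_sum d N f"
    unfolding cube_sum_def
  proof (rule sum.reindex_bij_witness[where j = lift and i = "\<lambda>y. \<lambda>i\<in>{0..d}. y i mod int m"])
    fix n assume n: "n \<in> P"
    have n_box: "n \<in> {0..d} \<rightarrow>\<^sub>E {0..<int m}"
      using n by (simp add: P_def)
    have n_range: "0 \<le> n i" "n i < int m" if "i \<le> d" for i
      using that PiE_mem[OF n_box, of i] by simp_all
    have n_out: "n i = undefined" if "\<not> i \<le> d" for i
      using that PiE_arb[OF n_box, of i] by simp
    have nv: "vertex n A mod int m \<in> {0..<int N}" if "A \<subseteq> {1..d}" for A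
      using n that unfolding P_def by blast
    have vmod: "vertex (lift n) A mod int m = vertex n A mod int m" if "A \<subseteq> {1..d}" for A
      using vertex_mod[OF that] lift_mod by blast
    have n0: "0 \<le> n 0" "n 0 < int N"
      using nv[of "{}"] n_range[of 0] by (auto simp: vertex_def)
    have lift_range: "- int N < lift n i" "lift n i < int N" if "i \<in> {1..d}" for i
    proof -
      have *: "(n 0 + n i) mod int m < int N"
        using nv[of "{i}"] that by (auto simp: vertex_def)
      have "n i - int m > - int N" if "n i \<ge> int N"
      proof -
        have "\<not> n 0 + n i < int m"
        proof
          assume "n 0 + n i < int m"
          then have "(n 0 + n i) mod int m = n 0 + n i"
            using n0 n_range[of i] \<open>i \<in> {1..d}\<close> by simp
          then show False
            using * that n0 by simp
        qed
        then show ?thesis using n0 by simp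
      qed
      then show "- int N < lift n i" "lift n i < int N"
        using that n_range[of i] m by (auto simp: lift_def)
    qed
    \<comment> \<open>One more edge leads from \<open>[0, N)\<close> to a value strictly between
      \<open>-N\<close> and \<open>2 * N\<close>. As \<open>m > 2 * N\<close>, its residue is below
      \<open>N\<close> only if the value itself lies in \<open>[0, N)\<close>.\<close>
    have lift_vertex: "vertex (lift n) A \<in> {0..<int N}" if "A \<subseteq> {1..d}" for A
    proof -
      have "finite A"
        using that finite_subset by blast
      then show ?thesis
        using that
      proof (induction A)
        case empty
        then show ?case
          using n0 by (simp add: vertex_def lift_def)
      next
        case (insert i A)
        define v where "v = vertex (lift n) (insert i A)"
        have "v = vertex (lift n) A + lift n i"
          using insert.hyps by (simp add: v_def vertex_def)
        moreover have "vertex (lift n) A \<in> {0..<int N}"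
          using insert by blast
        ultimately have v: "- int N < v" "v < 2 * int N"
          using lift_range[of i] insert.prems by auto
        have vm: "v mod int m \<in> {0..<int N}"
          unfolding v_def vmod[OF insert.prems] by (rule nv[OF insert.prems])
        have "0 \<le> v"
        proof (rule ccontr)
          assume "\<not> 0 \<le> v"
          then have "(v + int m) mod int m = v + int m"
            using v m by (intro mod_pos_pos_trivial) auto
          then have "v mod int m = v + int m" by simp
          then show False
            using vm v m by simp
        qed
        moreover from this have "v mod int m = v"
          using v m by simp
        ultimately show ?case
          using vm by (simp add: v_def)
      qed
    qed
    show "(\<lambda>i\<in>{0..d}. lift n i mod int m) = n"
      using n_range n_out lift_mod by (auto simp: fun_eq_iff)
    show "lift n \<in> cubes d N"
      using lift_vertex by (auto simp: cubes_def lift_def)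
    show "(\<Prod>A\<in>Pow {1..d}. (cnj ^^ card A) (f (nat (vertex (lift n) A)))) =
        (\<Prod>A\<in>Pow {1..d}. (cnj ^^ card A) (interval_restrict N f (vertex n A mod int m)))"
    proof (intro prod.cong refl)
      fix A assume "A \<in> Pow {1..d}"
      then have A: "A \<subseteq> {1..d}" by simp
      have "vertex n A mod int m = vertex (lift n) A"
        using vmod[OF A] lift_vertex[OF A] m by simp
      then show "(cnj ^^ card A) (f (nat (vertex (lift n) A))) =
          (cnj ^^ card A) (interval_restrict N f (vertex n A mod int m))"
        using lift_vertex[OF A] by (simp add: interval_restrict_def)
    qed
  next
    fix y assume y: "y \<in> cubes d N"
    let ?n = "\<lambda>i\<in>{0..d}. y i mod int m"
    have y_out: "y i = undefined" if "\<not> i \<le> d" for i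
      using y that by (auto simp: cubes_def PiE_def extensional_def)
    show "lift ?n = y"
    proof
      fix i
      consider "i = 0" | "i \<in> {1..d}" | "\<not> i \<le> d" by fastforce
      then show "lift ?n i = y i"
      proof cases
        case 1
        then show ?thesis
          using cubes_range(1)[OF y] m by (simp add: lift_def)
      next
        case 2
        note r = cubes_range(2)[OF y 2]
        show ?thesis
        proof (cases "0 \<le> y i")
          case True
          then show ?thesis
            using 2 r m by (simp add: lift_def)
        next
          case False
          then have "(y i + int m) mod int m = y i + int m"
            using r m by (intro mod_pos_pos_trivial) auto
          then have "y i mod int m = y i + int m" by simp
          then show ?thesis
            using 2 r m by (simp add: lift_def)
        qed
      next
        case 3
        then show ?thesis
          by (simp add: lift_def y_out)
      qed
    qed
    show "?n \<in> P"
    proof -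
      have "vertex ?n A mod int m \<in> {0..<int N}" if "A \<subseteq> {1..d}" for A
      proof -
        have "vertex ?n A mod int m = vertex y A mod int m"
          using that by (intro vertex_mod) auto
        moreover have "vertex y A \<in> {0..<int N}"
          using y that by (auto simp: cubes_def)
        ultimately show ?thesis
          using m by simp
      qed
      then show ?thesis
        using m by (auto simp: P_def)
    qed
  qed
  finally show ?thesis .
qed

section \<open>Normalisation and counting of cubes\<close>

lemma zero_in_cubes:
  assumes "1 \<le> N"
  shows "(\<lambda>i\<in>{0..d}. 0) \<in> cubes d N"
proof -
  have "vertex (\<lambda>i\<in>{0..d}. 0 :: int) A = 0" if "A \<subseteq> {1..d}" for A
    unfolding vertex_restrict[OF that] by (simp add: vertex_def)
  then show ?thesis
    using assms by (auto simp: cubes_def)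
qed

lemma card_cubes_pos: "1 \<le> N \<Longrightarrow> 0 < card (cubes d N)"
  using zero_in_cubes[of N d] finite_cubes by (auto simp: card_gt_0_iff)

text \<open>The size of the group cancels in the quotient, and for the constant 1 the sum counts the
  cubes.\<close>

lemma gowers_norm_interval_eq:
  assumes "1 \<le> d" "1 \<le> N"
  shows "gowers_norm_interval d N f = root (2 ^ d) (cmod (cube_sum d N f) / real (card (cubes d N)))"
proof -
  define m where "m = interval_modulus d N"
  have "\<exists>p. prime p \<and> p > 2 * d * N"
    using bigger_prime by blast
  then have "2 * d * N < m"
    unfolding m_def interval_modulus_def by (rule LeastI2_ex) simp
  moreover have "2 * N \<le> 2 * d * N"
    using assms by simp
  ultimately have m: "2 * N < m" by linarith
  define V where "V = card ({0..d} \<rightarrow>\<^sub>E {0..<int m})"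
  have carrier: "carrier (integer_mod_group m) = {0..<int m}"
    using m by (simp add: carrier_integer_mod_group)
  have norm: "gowers_norm d (integer_mod_group m) (interval_restrict N g) =
      root (2 ^ d) (cmod (cube_sum d N g) / real V)" for g
  proof -
    have "gowers_norm d (integer_mod_group m) (interval_restrict N g) =
      root (2 ^ d) (cmod ((\<Sum>n\<in>{0..d} \<rightarrow>\<^sub>E {0..<int m}. \<Prod>A\<in>Pow {1..d}.
        (cnj ^^ card A) (interval_restrict N g (vertex n A mod int m))) / of_nat V))"
      using m unfolding gowers_norm_def carrier V_def by (subst gowers_prod) auto
    then show ?thesis
      unfolding gowers_sum_eq_cube_sum[OF m] by (simp add: norm_divide)
  qed
  have V: "0 < V"
    using m unfolding V_def by (simp add: card_PiE)
  have one: "cmod (cube_sum d N (\<lambda>_. 1)) = real (card (cubes d N))"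
    by (simp add: cube_sum_def)
  show ?thesis
    unfolding gowers_norm_interval_def m_def[symmetric] norm one real_root_divide[symmetric]
    using V by simp
qed

lemma card_cubes_ge:
  assumes "1 \<le> N"
  shows "(real N / real (Suc d)) ^ Suc d \<le> real (card (cubes d N))"
proof -
  \<comment> \<open>\<open>N / (d + 1)\<close> rounded up: \<open>d + 1\<close> coordinates of at
    most \<open>t - 1\<close> add up to at most \<open>N - 1\<close>.\<close>
  define t where "t = Suc ((N - 1) div Suc d)"
  have "N \<le> t * Suc d"
    using assms dividend_less_div_times[of "Suc d" "N - 1"] by (simp add: t_def)
  then have "real N \<le> real t * real (Suc d)"
    by (metis of_nat_le_iff of_nat_mult)
  then have "real N / real (Suc d) \<le> real t"
    by (simp add: divide_le_eq)
  then have "(real N / real (Suc d)) ^ Suc d \<le> real t ^ Suc d"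
    by (intro power_mono) simp_all
  also have "\<dots> = real (card ({0..d} \<rightarrow>\<^sub>E {0..<int t}))"
    by (simp add: card_PiE)
  also have "\<dots> \<le> real (card (cubes d N))"
  proof (intro of_nat_mono card_mono finite_cubes subsetI)
    fix y assume y: "y \<in> {0..d} \<rightarrow>\<^sub>E {0..<int t}"
    have yi: "0 \<le> y i" "y i \<le> int ((N - 1) div Suc d)" if "i \<le> d" for i
      using PiE_mem[OF y, of i] that by (auto simp: t_def)
    have "vertex y A \<in> {0..<int N}" if A: "A \<subseteq> {1..d}" for A
    proof -
      have pos: "0 \<le> sum y A"
        using A yi by (intro sum_nonneg) auto
      have "sum y A \<le> of_nat (card A) * int ((N - 1) div Suc d)"
        using A yi by (intro sum_bounded_above) auto
      also have "\<dots> \<le> int d * int ((N - 1) div Suc d)"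
        using card_mono[OF _ A] by (intro mult_right_mono) auto
      finally have "vertex y A \<le> int ((N - 1) div Suc d) + int d * int ((N - 1) div Suc d)"
        using yi[of 0] unfolding vertex_def by linarith
      also have "\<dots> = int (Suc d) * int ((N - 1) div Suc d)"
        by (simp only: of_nat_Suc distrib_right mult_1_left)
      also have "\<dots> = int (Suc d * ((N - 1) div Suc d))"
        by (rule of_nat_mult[symmetric])
      also have "\<dots> \<le> int (N - 1)"
        by (intro of_nat_mono times_div_less_eq_dividend)
      also have "\<dots> < int N"
        using assms by simp
      finally show ?thesis
        using pos yi[of 0] by (simp add: vertex_def)
    qed
    then show "y \<in> cubes d N"
      using y by (auto simp: cubes_def)
  qed
  finally show ?thesis .
qed

text \<open>One vertex and the edges determine a cube, and every edge lies strictly between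
  \<open>-N\<close> and \<open>N\<close>.\<close>

lemma card_cubes_vertex_le:
  assumes "A \<subseteq> {1..d}" "finite W"
  shows "card {y \<in> cubes d N. vertex y A \<in> W} \<le> card W * (2 * N) ^ d"
proof -
  define \<phi> where "\<phi> y = (vertex y A, restrict y {1..d})" for y :: "nat \<Rightarrow> int"
  have "card {y \<in> cubes d N. vertex y A \<in> W} \<le> card (W \<times> ({1..d} \<rightarrow>\<^sub>E {- int N<..<int N}))"
  proof (rule card_inj_on_le)
    show "inj_on \<phi> {y \<in> cubes d N. vertex y A \<in> W}"
    proof (rule inj_onI)
      fix y z assume *: "y \<in> {y \<in> cubes d N. vertex y A \<in> W}" "z \<in> {y \<in> cubes d N. vertex y A \<in> W}"
        "\<phi> y = \<phi> z"
      have eq: "y i = z i" if "i \<in> {1..d}" for i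
        using *(3) that by (auto simp: \<phi>_def fun_eq_iff restrict_def dest: spec[of _ i])
      have "sum y A = sum z A"
        using assms(1) eq by (intro sum.cong) auto
      then have "y 0 = z 0"
        using *(3) by (simp add: \<phi>_def vertex_def)
      moreover have "y i = z i" if "\<not> i \<le> d" for i
        using *(1,2) that by (auto simp: cubes_def PiE_def extensional_def)
      ultimately show "y = z"
        using eq by (metis atLeastAtMost_iff ext less_one not_le)
    qed
    show "\<phi> ` {y \<in> cubes d N. vertex y A \<in> W} \<subseteq> W \<times> ({1..d} \<rightarrow>\<^sub>E {- int N<..<int N})"
      using cubes_range by (fastforce simp: \<phi>_def)
    show "finite (W \<times> ({1..d} \<rightarrow>\<^sub>E {- int N<..<int N}))"
      using assms(2) by (intro finite_cartesian_product finite_PiE) auto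
  qed
  also have "\<dots> = card W * card {- int N<..<int N} ^ d"
    by (simp add: card_cartesian_product card_PiE)
  also have "\<dots> \<le> card W * (2 * N) ^ d"
    by (intro mult_le_mono2 power_mono) simp_all
  finally show ?thesis .
qed

section \<open>Gowers uniformity\<close>

text \<open>The boundary error \<open>K ^ m / N\<close> is balanced against the gain
  \<open>\<theta> ^ m\<close> by taking \<open>K ^ m\<close> near the square root of
  \<open>N\<close>.\<close>

lemma block_decay:
  fixes K :: nat and \<theta> :: real
  assumes "2 \<le> K" "\<theta> < 1" "0 \<le> \<theta>"
  shows "\<exists>c>0. \<exists>C\<ge>0. \<forall>N\<ge>1. \<exists>m. real K ^ m / real N + \<theta> ^ m \<le> C * real N powr (- c)"
proof -
  define \<eta> where "\<eta> = max \<theta> (1 / real K)"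
  have \<eta>: "0 < \<eta>" "\<eta> < 1" "\<theta> \<le> \<eta>" "1 / real K \<le> \<eta>"
    using assms by (auto simp: \<eta>_def less_max_iff_disj)
  \<comment> \<open>Solves \<open>(K ^ 2) powr (- c) = \<eta>\<close>, as \<open>N\<close> will be
    placed between consecutive powers of \<open>K ^ 2\<close>.\<close>
  define c where "c = - ln \<eta> / (2 * ln (real K))"
  have lnK: "0 < ln (real K)"
    using assms by simp
  have "0 < c"
    unfolding c_def using \<eta> lnK by (intro divide_pos_pos) simp_all
  have \<eta>_powr: "(real K ^ 2) powr (- c) = \<eta>"
  proof -
    have "ln (real K ^ 2) * (- c) = ln \<eta>"
      using lnK by (simp add: c_def ln_realpow)
    moreover have "(real K ^ 2) powr (- c) = exp (ln (real K ^ 2) * (- c))"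
      using assms by (simp add: powr_def)
    ultimately show ?thesis
      using \<eta>(1) by simp
  qed
  have power_powr: "(x ^ j) powr (- c) = (x powr (- c)) ^ j" if "0 \<le> x" for x :: real and j
    using that by (induction j) (simp_all add: powr_mult)
  have "\<exists>m. real K ^ m / real N + \<theta> ^ m \<le> 2 / \<eta> * real N powr (- c)" if N: "1 \<le> N" for N :: nat
  proof -
    have "2 * 1 \<le> K * K"
      using assms(1) by (intro mult_le_mono) auto
    then obtain m where m: "(K ^ 2) ^ m \<le> N" "N < (K ^ 2) ^ (m + 1)"
      using ex_power_ivl1[of "K ^ 2" N] N by (auto simp: power2_eq_square)
    have Km: "real K ^ m / real N \<le> \<eta> ^ m"
    proof -
      have "real ((K ^ 2) ^ m) \<le> real N"
        using m(1) by (rule of_nat_mono)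
      then have "real K ^ m * real K ^ m \<le> real N"
        by (simp add: power2_eq_square power_mult_distrib)
      then have "real K ^ m \<le> real N / real K ^ m"
        using assms(1) by (simp add: pos_le_divide_eq)
      then have "real K ^ m / real N \<le> 1 / real K ^ m"
        using N assms(1) by (simp add: field_simps)
      also have "\<dots> = (1 / real K) ^ m"
        by (simp add: power_one_over)
      also have "\<dots> \<le> \<eta> ^ m"
        using \<eta>(4) by (intro power_mono) auto
      finally show ?thesis .
    qed
    \<comment> \<open>The step from \<open>m + 1\<close> back to \<open>m\<close> costs
      \<open>1 / \<eta>\<close>; with two summands this gives the constant
      \<open>2 / \<eta>\<close>.\<close>
    have "\<eta> ^ (m + 1) = ((real K ^ 2) ^ (m + 1)) powr (- c)"
      unfolding \<eta>_powr[symmetric] by (rule power_powr[symmetric]) simp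
    also have "\<dots> \<le> real N powr (- c)"
    proof (rule powr_mono2')
      have "real N \<le> real ((K ^ 2) ^ (m + 1))"
        using m(2) by (intro of_nat_mono less_imp_le)
      then show "real N \<le> (real K ^ 2) ^ (m + 1)"
        by simp
    qed (use N \<open>0 < c\<close> in auto)
    finally have "\<eta> ^ m \<le> real N powr (- c) / \<eta>"
      using \<eta>(1) by (simp add: pos_le_divide_eq mult.commute)
    moreover have "\<theta> ^ m \<le> \<eta> ^ m"
      using \<eta>(3) assms(3) by (intro power_mono)
    ultimately have "real K ^ m / real N + \<theta> ^ m \<le> 2 / \<eta> * real N powr (- c)"
      using Km by simp
    then show ?thesis ..
  qed
  then show ?thesis
    using \<open>0 < c\<close> \<eta>(1) by (intro exI[of _ c] conjI exI[of _ "2 / \<eta>"]) auto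
qed

text \<open>
  The cube sum is split according to the quotients of the coordinates by \<open>Q\<close>; the second summand
  accounts for the cubes with a vertex near one end of \<open>[N]\<close>.
\<close>
lemma cube_sum_block_estimate:
  fixes u :: "nat \<Rightarrow> complex"
  assumes Q: "0 < Q" and U: "0 \<le> U" "\<And>n. cmod (u n) \<le> U"
    and block: "\<And>M. (\<And>A. A \<subseteq> {1..d} \<Longrightarrow> 0 < vertex M A) \<Longrightarrow>
      cmod (\<Sum>r\<in>box d Q. \<Prod>A\<in>Pow {1..d}.
        (cnj ^^ card A) (u (nat (vertex M A) * Q + vertex r A))) \<le> B"
  shows "cmod (cube_sum d N u) \<le> real (card (cubes d N)) * B / real Q ^ Suc d +
    2 ^ d * (2 * real (Suc d) * real Q) * (2 * real N) ^ d * U ^ (2 ^ d)"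
proof -
  define t where "t y = (\<Prod>A\<in>Pow {1..d}. (cnj ^^ card A) (u (nat (vertex y A))))" for y :: "nat \<Rightarrow> int"
  \<comment> \<open>Quotients for which all remainders yield cubes in \<open>[0, N)\<close>, since
    vertices of remainders are below \<open>(d + 1) * Q\<close>. Positivity is what
    \<open>block\<close> demands.\<close>
  define I where "I = {M \<in> {0..d} \<rightarrow>\<^sub>E (UNIV :: int set). \<forall>A\<subseteq>{1..d}.
    0 < vertex M A \<and> (vertex M A + int (Suc d)) * int Q \<le> int N}"
  define join where "join = (\<lambda>(M, r). \<lambda>i\<in>{0..d}. M i * int Q + int (r i))"
  have vertex_join: "vertex (join (M, r)) A = vertex M A * int Q + int (vertex r A)"
    if "A \<subseteq> {1..d}" for M r A
    unfolding join_def prod.case vertex_restrict[OF that]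
    by (simp add: vertex_def sum.distrib algebra_simps flip: sum_distrib_left sum_distrib_right)
  have r_less: "vertex r A < Suc d * Q" if "r \<in> box d Q" "A \<subseteq> {1..d}" for r A
    using vertex_box_bound[OF that, of 0] by simp
  define good where "good = join ` (I \<times> box d Q)"
  have inj: "inj_on join (I \<times> box d Q)"
  proof (rule inj_on_inverseI[where
        g = "\<lambda>y. (\<lambda>i\<in>{0..d}. y i div int Q, \<lambda>i\<in>{0..d}. nat (y i mod int Q))"])
    fix x assume "x \<in> I \<times> box d Q"
    then obtain M r where x: "x = (M, r)" "M \<in> I" "r \<in> box d Q" by auto
    have "M \<in> {0..d} \<rightarrow>\<^sub>E UNIV"
      using x(2) by (simp add: I_def)
    then have M_out: "M i = undefined" "r i = undefined" if "\<not> i \<le> d" for i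
      using PiE_arb[of M "{0..d}" "\<lambda>_. UNIV" i] PiE_arb[OF x(3), of i] that by simp_all
    have "r i < Q" if "i \<le> d" for i
      using PiE_mem[OF x(3), of i] that by simp
    then have "(M i * int Q + int (r i)) div int Q = M i" "(M i * int Q + int (r i)) mod int Q = int (r i)"
      if "i \<le> d" for i
      using that Q by simp_all
    then show "(\<lambda>i\<in>{0..d}. join x i div int Q, \<lambda>i\<in>{0..d}. nat (join x i mod int Q)) = x"
      using M_out by (simp add: x(1) join_def fun_eq_iff)
  qed
  have good_sub: "good \<subseteq> cubes d N"
  proof
    fix y assume "y \<in> good"
    then obtain M r where y: "y = join (M, r)" "M \<in> I" "r \<in> box d Q"
      by (auto simp: good_def)
    have "vertex y A \<in> {0..<int N}" if A: "A \<subseteq> {1..d}" for A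
    proof -
      have M: "0 < vertex M A" "(vertex M A + int (Suc d)) * int Q \<le> int N"
        using y(2) A by (auto simp: I_def)
      have "int (vertex r A) < int (Suc d * Q)"
        using r_less[OF y(3) A] by (simp only: of_nat_less_iff)
      then have "vertex y A < (vertex M A + int (Suc d)) * int Q"
        unfolding y(1) vertex_join[OF A] by (simp add: algebra_simps)
      moreover have "0 \<le> vertex y A"
        unfolding y(1) vertex_join[OF A] using M(1) by simp
      ultimately show ?thesis
        using M(2) by simp
    qed
    moreover have "y \<in> {0..d} \<rightarrow>\<^sub>E UNIV"
      by (simp add: y(1) join_def)
    ultimately show "y \<in> cubes d N"
      by (simp add: cubes_def)
  qed
  have term_le: "cmod (t y) \<le> U ^ (2 ^ d)" for y
  proof -
    have "cmod (t y) \<le> (\<Prod>A\<in>Pow {1..d}. U)"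
      unfolding t_def prod_norm[symmetric] by (intro prod_mono) (simp add: U)
    then show ?thesis
      by (simp add: card_Pow)
  qed
  \<comment> \<open>\<open>B\<close> bounds a modulus as soon as some \<open>M\<close> is
    admissible: base point 1 with edges 0.\<close>
  have B: "0 \<le> B"
  proof (rule order_trans[OF norm_ge_zero block])
    fix A :: "nat set" assume "A \<subseteq> {1..d}"
    then have "(\<Sum>i\<in>A. if i = 0 then 1 else 0 :: int) = 0"
      by (intro sum.neutral) auto
    then show "0 < vertex (\<lambda>i. if i = 0 then 1 else 0 :: int) A"
      by (simp only: vertex_def) simp
  qed
  have good_bound: "cmod (\<Sum>y\<in>good. t y) \<le> real (card (cubes d N)) * B / real Q ^ Suc d"
  proof -
    have "(\<Sum>y\<in>good. t y) = (\<Sum>M\<in>I. \<Sum>r\<in>box d Q. t (join (M, r)))"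
      unfolding good_def by (subst sum.reindex[OF inj]) (simp add: sum.cartesian_product)
    also have "cmod \<dots> \<le> (\<Sum>M\<in>I. B)"
    proof (rule sum_norm_le)
      fix M assume M: "M \<in> I"
      have "(\<Sum>r\<in>box d Q. t (join (M, r))) =
          (\<Sum>r\<in>box d Q. \<Prod>A\<in>Pow {1..d}. (cnj ^^ card A) (u (nat (vertex M A) * Q + vertex r A)))"
        unfolding t_def
      proof (intro sum.cong prod.cong refl)
        fix r A assume "A \<in> Pow {1..d}"
        then have A: "A \<subseteq> {1..d}" by simp
        then have "0 < vertex M A"
          using M by (auto simp: I_def)
        then have "vertex (join (M, r)) A = int (nat (vertex M A) * Q + vertex r A)"
          unfolding vertex_join[OF A] by simp
        then show "(cnj ^^ card A) (u (nat (vertex (join (M, r)) A))) =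
            (cnj ^^ card A) (u (nat (vertex M A) * Q + vertex r A))"
          by (simp only: nat_int)
      qed
      also have "cmod \<dots> \<le> B"
        using M by (intro block) (auto simp: I_def)
      finally show "cmod (\<Sum>r\<in>box d Q. t (join (M, r))) \<le> B" .
    qed
    also have "\<dots> = real (card I) * B"
      by simp
    also have "\<dots> \<le> real (card (cubes d N)) / real Q ^ Suc d * B"
    proof (rule mult_right_mono[OF _ B])
      have "card I * Q ^ Suc d = card good"
        unfolding good_def card_image[OF inj] card_cartesian_product card_box ..
      also have "\<dots> \<le> card (cubes d N)"
        by (rule card_mono[OF finite_cubes good_sub])
      finally have "real (card I * Q ^ Suc d) \<le> real (card (cubes d N))"
        by (rule of_nat_mono)
      then show "real (card I) \<le> real (card (cubes d N)) / real Q ^ Suc d"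
        using Q by (simp add: pos_le_divide_eq)
    qed
    finally show ?thesis by simp
  qed
  \<comment> \<open>Strips of width \<open>(d + 1) * Q\<close> at both ends; a cube with no vertex
    in them has its quotients in \<open>I\<close>.\<close>
  define W where "W = {0..<int (Suc d * Q)} \<union> {int N - int (Suc d * Q)..<int N}"
  have bad_sub: "cubes d N - good \<subseteq> (\<Union>A\<in>Pow {1..d}. {y \<in> cubes d N. vertex y A \<in> W})"
  proof
    fix y assume y: "y \<in> cubes d N - good"
    show "y \<in> (\<Union>A\<in>Pow {1..d}. {y \<in> cubes d N. vertex y A \<in> W})"
    proof (rule ccontr)
      assume "\<not> ?thesis"
      then have notW: "vertex y A \<notin> W" if "A \<subseteq> {1..d}" for A
        using y that by blast
      define M where "M = (\<lambda>i\<in>{0..d}. y i div int Q)"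
      define r where "r = (\<lambda>i\<in>{0..d}. nat (y i mod int Q))"
      have y_out: "y i = undefined" if "\<not> i \<le> d" for i
        using y that by (auto simp: cubes_def PiE_def extensional_def)
      have y_join: "y = join (M, r)"
        using Q y_out by (simp add: fun_eq_iff join_def M_def r_def)
      have "nat (y i mod int Q) < Q" for i
        using Q by (simp add: nat_less_iff)
      then have r: "r \<in> box d Q"
        by (simp add: r_def)
      have "0 < vertex M A \<and> (vertex M A + int (Suc d)) * int Q \<le> int N" if A: "A \<subseteq> {1..d}" for A
      proof -
        have "vertex y A \<in> {0..<int N}"
          using y A by (auto simp: cubes_def)
        then have far: "int (Suc d * Q) \<le> vertex y A" "vertex y A < int N - int (Suc d * Q)"
          using notW[OF A] by (auto simp: W_def)
        have v: "vertex y A = vertex M A * int Q + int (vertex r A)"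
          using vertex_join[OF A] y_join by simp
        have "int (vertex r A) < int (Suc d * Q)"
          using r_less[OF r A] by (simp only: of_nat_less_iff)
        then have "0 < vertex M A * int Q"
          using far(1) v by linarith
        then have "0 < vertex M A"
          using Q by (simp add: zero_less_mult_iff)
        moreover have "vertex M A * int Q + int (Suc d * Q) \<le> int N"
          using far(2) v by linarith
        then have "(vertex M A + int (Suc d)) * int Q \<le> int N"
          by (simp add: algebra_simps)
        ultimately show ?thesis ..
      qed
      then have "M \<in> I"
        by (auto simp: I_def M_def)
      then have "y \<in> good"
        using r y_join by (auto simp: good_def)
      then show False
        using y by blast
    qed
  qed
  have finW: "finite W"
    by (simp add: W_def)
  have "card ({0..<int x} \<union> {int N - int x..<int N}) \<le> 2 * x" for x
    by (rule order_trans[OF card_Un_le]) simp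
  then have cardW: "card W \<le> 2 * (Suc d * Q)"
    unfolding W_def .
  have "card (cubes d N - good) \<le> card (\<Union>A\<in>Pow {1..d}. {y \<in> cubes d N. vertex y A \<in> W})"
    using finite_cubes by (intro card_mono[OF _ bad_sub] finite_UN_I) auto
  also have "\<dots> \<le> (\<Sum>A\<in>Pow {1..d}. card {y \<in> cubes d N. vertex y A \<in> W})"
    by (intro card_UN_le) simp
  also have "\<dots> \<le> (\<Sum>A\<in>Pow {1..d}. 2 * (Suc d * Q) * (2 * N) ^ d)"
  proof (rule sum_mono)
    fix A assume "A \<in> Pow {1..d}"
    then have "card {y \<in> cubes d N. vertex y A \<in> W} \<le> card W * (2 * N) ^ d"
      using finW by (intro card_cubes_vertex_le) auto
    also have "\<dots> \<le> 2 * (Suc d * Q) * (2 * N) ^ d"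
      using cardW by (rule mult_le_mono1)
    finally show "card {y \<in> cubes d N. vertex y A \<in> W} \<le> 2 * (Suc d * Q) * (2 * N) ^ d" .
  qed
  also have "\<dots> = 2 ^ d * (2 * Suc d * Q) * (2 * N) ^ d"
    by (simp add: card_Pow)
  finally have "real (card (cubes d N - good)) \<le> real (2 ^ d * (2 * Suc d * Q) * (2 * N) ^ d)"
    by (rule of_nat_mono)
  then have bad_card: "real (card (cubes d N - good)) \<le> 2 ^ d * (2 * real (Suc d) * real Q) * (2 * real N) ^ d"
    by (simp only: of_nat_mult of_nat_power of_nat_numeral)
  have "cube_sum d N u = (\<Sum>y\<in>cubes d N - good. t y) + (\<Sum>y\<in>good. t y)"
    unfolding cube_sum_def t_def[symmetric] by (rule sum.subset_diff[OF good_sub finite_cubes])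
  then have "cmod (cube_sum d N u) \<le> cmod (\<Sum>y\<in>cubes d N - good. t y) + cmod (\<Sum>y\<in>good. t y)"
    by (simp add: norm_triangle_ineq)
  moreover have "cmod (\<Sum>y\<in>cubes d N - good. t y) \<le> real (card (cubes d N - good)) * U ^ (2 ^ d)"
    using term_le by (intro sum_norm_bound)
  moreover have "\<dots> \<le> 2 ^ d * (2 * real (Suc d) * real Q) * (2 * real N) ^ d * U ^ (2 ^ d)"
    using U(1) by (intro mult_right_mono[OF bad_card]) simp
  ultimately show ?thesis
    using good_bound by linarith
qed

lemma gowers_norm_interval_decay:
  fixes u :: "nat \<Rightarrow> complex"
  assumes d: "1 \<le> d" and K: "2 \<le> K" and U: "0 \<le> U" "\<And>n. cmod (u n) \<le> U"
    and block: "\<And>m M. (\<And>A. A \<subseteq> {1..d} \<Longrightarrow> 0 < vertex M A) \<Longrightarrow>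
      cmod (\<Sum>r\<in>box d (K ^ m). \<Prod>A\<in>Pow {1..d}.
        (cnj ^^ card A) (u (nat (vertex M A) * K ^ m + vertex r A)))
      \<le> (real (K ^ Suc d) - 1) ^ m * U ^ (2 ^ d)"
  shows "\<exists>c>0. \<exists>C. \<forall>N\<ge>1. gowers_norm_interval d N u \<le> C * real N powr (- c)"
proof -
  define \<theta> where "\<theta> = (real (K ^ Suc d) - 1) / real (K ^ Suc d)"
  have "0 < K ^ Suc d"
    using K by simp
  then have Kpos: "1 \<le> real (K ^ Suc d)"
    by linarith
  have "0 \<le> (x - 1) / x" "(x - 1) / x < 1" if "1 \<le> x" for x :: real
    using that by (simp_all add: field_simps)
  from this[OF Kpos] have \<theta>: "0 \<le> \<theta>" "\<theta> < 1"
    by (simp_all only: \<theta>_def)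
  obtain c C where c: "0 < c" and C: "0 \<le> C"
    and decay: "\<And>N :: nat. 1 \<le> N \<Longrightarrow> \<exists>m. real K ^ m / real N + \<theta> ^ m \<le> C * real N powr (- c)"
    using block_decay[OF K \<theta>(2,1)] by blast
  \<comment> \<open>The factors come from the number of vertices, the two strips,
    \<open>(2 * N) ^ d\<close> and the lower bound for the number of cubes.\<close>
  define C1 where "C1 = 2 ^ d * (2 * real (Suc d)) * 2 ^ d * real (Suc d) ^ Suc d"
  have "1 \<le> C1"
  proof -
    have "1 * 1 * 1 * 1 \<le> C1"
      unfolding C1_def by (intro mult_mono one_le_power) auto
    then show ?thesis by simp
  qed
  define C2 where "C2 = C1 * U ^ (2 ^ d) * C"
  have bound: "cmod (cube_sum d N u) / real (card (cubes d N)) \<le> C2 * real N powr (- c)" if N: "1 \<le> N" for N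
  proof -
    obtain m where m: "real K ^ m / real N + \<theta> ^ m \<le> C * real N powr (- c)"
      using decay[OF N] by blast
    define V where "V = real (card (cubes d N))"
    have V: "0 < V" "(real N / real (Suc d)) ^ Suc d \<le> V"
      using card_cubes_pos[OF N] card_cubes_ge[OF N] by (simp_all add: V_def)
    define V0 where "V0 = (real N / real (Suc d)) ^ Suc d"
    have V0: "0 < V0"
      using N by (simp add: V0_def)
    have "cmod (cube_sum d N u) \<le> V * ((real (K ^ Suc d) - 1) ^ m * U ^ (2 ^ d)) / real (K ^ m) ^ Suc d +
        2 ^ d * (2 * real (Suc d) * real (K ^ m)) * (2 * real N) ^ d * U ^ (2 ^ d)"
      unfolding V_def using K U block by (intro cube_sum_block_estimate) auto
    also have "real (K ^ m) ^ Suc d = real (K ^ Suc d) ^ m"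
      by (simp only: of_nat_power power_mult[symmetric] mult.commute)
    also have "V * ((real (K ^ Suc d) - 1) ^ m * U ^ (2 ^ d)) / real (K ^ Suc d) ^ m = V * \<theta> ^ m * U ^ (2 ^ d)"
      by (simp only: \<theta>_def power_divide times_divide_eq_left times_divide_eq_right mult.assoc)
    finally have "cmod (cube_sum d N u) / V \<le> (V * \<theta> ^ m * U ^ (2 ^ d) +
        2 ^ d * (2 * real (Suc d) * real (K ^ m)) * (2 * real N) ^ d * U ^ (2 ^ d)) / V"
      using V(1) by (intro divide_right_mono) simp_all
    also have "\<dots> = \<theta> ^ m * U ^ (2 ^ d) +
        2 ^ d * (2 * real (Suc d) * real (K ^ m)) * (2 * real N) ^ d * U ^ (2 ^ d) / V"
      using V(1) by (simp add: add_divide_distrib)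
    also have "2 ^ d * (2 * real (Suc d) * real (K ^ m)) * (2 * real N) ^ d * U ^ (2 ^ d) / V \<le>
        2 ^ d * (2 * real (Suc d) * real (K ^ m)) * (2 * real N) ^ d * U ^ (2 ^ d) / V0"
      by (rule divide_left_mono[OF V(2)[folded V0_def] _ mult_pos_pos[OF V(1) V0]]) (use U(1) in simp)
    also have "\<dots> = C1 * (real K ^ m / real N) * U ^ (2 ^ d)"
      using N by (simp add: V0_def C1_def power_divide power_mult_distrib field_simps)
    also have "\<theta> ^ m * U ^ (2 ^ d) \<le> C1 * \<theta> ^ m * U ^ (2 ^ d)"
      using \<open>1 \<le> C1\<close> \<theta>(1) U(1) mult_right_mono[of 1 C1 "\<theta> ^ m * U ^ (2 ^ d)"] by (simp add: mult.assoc)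
    finally have "cmod (cube_sum d N u) / V \<le> C1 * U ^ (2 ^ d) * (real K ^ m / real N + \<theta> ^ m)"
      by (simp add: algebra_simps)
    also have "\<dots> \<le> C1 * U ^ (2 ^ d) * (C * real N powr (- c))"
      using \<open>1 \<le> C1\<close> U(1) by (intro mult_left_mono m) simp
    finally show ?thesis
      by (simp add: V_def C2_def mult.assoc)
  qed
  have "gowers_norm_interval d N u \<le> root (2 ^ d) C2 * real N powr (- (c / 2 ^ d))" if N: "1 \<le> N" for N
  proof -
    have "gowers_norm_interval d N u \<le> root (2 ^ d) (C2 * real N powr (- c))"
      unfolding gowers_norm_interval_eq[OF d N] by (intro real_root_le_mono bound N) simp
    also have "\<dots> = root (2 ^ d) C2 * real N powr (- (c / 2 ^ d))"
      using N by (simp add: real_root_mult root_powr_inverse powr_powr)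
    finally show ?thesis .
  qed
  then show ?thesis
    using c by (intro exI[of _ "c / 2 ^ d"] conjI exI[of _ "root (2 ^ d) C2"]) auto
qed

context uniform_monoid
begin

lemma highly_gowers_uniform_deviation:
  "highly_gowers_uniform (\<lambda>n. f (X n) - coset_mean f (X n))"
proof -
  define F where "F x = f x - coset_mean f x" for x
  define U where "U = (\<Sum>x\<in>T. cmod (F x))"
  have U0: "0 \<le> U"
    by (simp add: U_def sum_nonneg)
  have FU: "cmod (F x) \<le> U" if "x \<in> T" for x
    unfolding U_def using fin that by (intro member_le_sum) auto
  have "bounded (range (\<lambda>n. F (X n)))"
  proof (rule finite_imp_bounded)
    have "range (\<lambda>n. F (X n)) \<subseteq> F ` T"
      using X_in by blast
    then show "finite (range (\<lambda>n. F (X n)))"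
      using finite_imageI[OF fin] by (rule finite_subset)
  qed
  moreover have "\<exists>c>0. \<exists>C. \<forall>N\<ge>1. gowers_norm_interval d N (\<lambda>n. F (X n)) \<le> C * real N powr (- c)"
    if d: "1 \<le> d" for d
  proof -
    from cube_sum_bound[of d] obtain l where l: "0 < l"
      and bound: "\<forall>F U Z m. 0 \<le> U \<longrightarrow> (\<forall>A. \<forall>x\<in>T. cmod (F A x) \<le> U) \<longrightarrow>
     (\<forall>u\<in>T. \<forall>v\<in>T. (\<Sum>g\<in>H. F {1..d} (u * g * v)) = 0) \<longrightarrow> (\<forall>A c. Z A c \<in> T) \<longrightarrow>
     cmod (\<Sum>r\<in>box d (k ^ (m * l)). \<Prod>A\<in>Pow {1..d}.
       F A (Z A (vertex r A div k ^ (m * l)) * E (m * l) (vertex r A)))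
     \<le> (real ((k ^ l) ^ Suc d) - 1) ^ m * U ^ (2 ^ d)"
      by (elim exE conjE)
    \<comment> \<open>Elements of \<open>H\<close> absorb \<open>e\<close>, so \<open>u\<close> and
      \<open>v\<close> may be replaced by \<open>u * e\<close> and \<open>e * v\<close>, as
      \<open>coset_mean_cancel\<close> requires.\<close>
    have cancel: "(\<Sum>g\<in>H. (cnj ^^ card {1..d}) (F (u * g * v))) = 0" if uv: "u \<in> T" "v \<in> T" for u v
    proof -
      have "(\<Sum>g\<in>H. F (u * g * v)) = (\<Sum>g\<in>H. F ((u * e) * g * (e * v)))"
        using H_in_G by (intro sum.cong refl) (simp add: mult.assoc)
      also have "\<dots> = 0"
        unfolding F_def using uv e_in mult_in by (intro coset_mean_cancel) (auto simp: mult.assoc idem idem_left)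
      finally show ?thesis
        by (simp flip: cnj_power_sum)
    qed
    show ?thesis
    proof (rule gowers_norm_interval_decay[OF d _ U0, where K = "k ^ l"])
      show "2 \<le> k ^ l"
        using l k_ge self_le_power[of k l] by linarith
      show "cmod (F (X n)) \<le> U" for n
        by (rule FU[OF X_in])
      fix m and M :: "nat \<Rightarrow> int"
      assume M: "\<And>A. A \<subseteq> {1..d} \<Longrightarrow> 0 < vertex M A"
      have pow: "(k ^ l) ^ m = k ^ (m * l)"
        by (simp only: power_mult[symmetric] mult.commute)
      have "(\<Sum>r\<in>box d (k ^ (m * l)). \<Prod>A\<in>Pow {1..d}.
          (cnj ^^ card A) (F (X (nat (vertex M A) * k ^ (m * l) + vertex r A)))) =
        (\<Sum>r\<in>box d (k ^ (m * l)). \<Prod>A\<in>Pow {1..d}. (cnj ^^ card A)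
          (F (X (nat (vertex M A) + vertex r A div k ^ (m * l)) * E (m * l) (vertex r A))))"
      proof (intro sum.cong prod.cong refl)
        fix r A assume "A \<in> Pow {1..d}"
        then have "0 < nat (vertex M A)"
          using M by simp
        have "nat (vertex M A) * k ^ (m * l) + vertex r A =
            (nat (vertex M A) + vertex r A div k ^ (m * l)) * k ^ (m * l) + vertex r A mod k ^ (m * l)"
          by (simp only: distrib_right add.assoc div_mult_mod_eq)
        also have "X \<dots> = X (nat (vertex M A) + vertex r A div k ^ (m * l)) *
            E (m * l) (vertex r A mod k ^ (m * l))"
          using \<open>0 < nat (vertex M A)\<close> k_ge by (intro X_concat) auto
        finally show "(cnj ^^ card A) (F (X (nat (vertex M A) * k ^ (m * l) + vertex r A))) =
            (cnj ^^ card A) (F (X (nat (vertex M A) + vertex r A div k ^ (m * l)) * E (m * l) (vertex r A)))"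
          by (simp only: digit_prod_mod)
      qed
      also have "cmod \<dots> \<le> (real ((k ^ l) ^ Suc d) - 1) ^ m * U ^ (2 ^ d)"
      \<comment> \<open>The higher digits form a nonzero prefix plus the carry \<open>c\<close>,
        whence this choice of \<open>Z\<close>.\<close>
      proof (rule bound[rule_format, of U "\<lambda>A x. (cnj ^^ card A) (F x)" "\<lambda>A c. X (nat (vertex M A) + c)" m])
        show "(\<Sum>g\<in>H. (cnj ^^ card {1..d}) (F (u * g * v))) = 0" if "u \<in> T" "v \<in> T" for u v
          using that by (rule cancel)
      qed (simp_all only: U0 FU X_in cmod_cnj_power)
      finally show "cmod (\<Sum>r\<in>box d ((k ^ l) ^ m). \<Prod>A\<in>Pow {1..d}.
          (cnj ^^ card A) (F (X (nat (vertex M A) * (k ^ l) ^ m + vertex r A))))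
        \<le> (real ((k ^ l) ^ Suc d) - 1) ^ m * U ^ (2 ^ d)"
        unfolding pow .
    qed
  qed
  ultimately show ?thesis
    unfolding highly_gowers_uniform_def F_def by blast
qed

end

theorem theoremC:
  fixes a :: "nat \<Rightarrow> complex"
  assumes "automatic a"
  shows "\<exists>a_str a_uni :: nat \<Rightarrow> complex.
           (\<forall>n. a n = a_str n + a_uni n) \<and>
           weakly_structured a_str \<and>
           highly_gowers_uniform a_uni"
proof -
  obtain k where k: "2 \<le> k" "automatic_in_base k a"
    using assms by (auto simp: automatic_def)
  obtain D :: "nat \<Rightarrow> nat option endo" and f where fin: "finite {digit_prod k D l n |l n. n < k ^ l}"
    and a: "\<And>l n. n < k ^ l \<Longrightarrow> a n = f (digit_prod k D l n)"
    using automatic_digit_prod[OF k] by blast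
  obtain l p N T where word: "word_monoid (k ^ l) p N (digit_prod k D l) T"
    using word_monoid_exists[OF k(1) fin] by blast
  obtain q t where uniform: "uniform_monoid ((k ^ l) ^ t) (repdigit (k ^ l) p t) N
      (digit_prod (k ^ l) (digit_prod k D l) t) T (word_monoid.G0 (k ^ l) p (digit_prod k D l)) q"
    using word_monoid.uniform_monoid_power[OF word] by blast
  interpret uniform_monoid "(k ^ l) ^ t" "repdigit (k ^ l) p t" N
      "digit_prod (k ^ l) (digit_prod k D l) t" T "word_monoid.G0 (k ^ l) p (digit_prod k D l)" q
    by (rule uniform)
  \<comment> \<open>Expanding all digits back to base \<open>k\<close> may create leading zeros, to
    which \<open>f\<close> is insensitive.\<close>
  have a_X: "a n = f (X n)" for n
  proof -
    obtain m where "n < ((k ^ l) ^ t) ^ m" "X n = E m n"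
      using X_eq_E by blast
    then have "n < k ^ (l * (t * m))" "X n = digit_prod k D (l * (t * m)) n"
      by (simp_all only: digit_prod_base_power power_mult)
    then show ?thesis
      using a by simp
  qed
  show ?thesis
  proof (intro exI conjI allI)
    show "a n = coset_mean f (X n) + (f (X n) - coset_mean f (X n))" for n
      by (simp add: a_X)
    show "weakly_structured (\<lambda>n. coset_mean f (X n))"
      unfolding weakly_structured_def using k_ge weakly_structured_coset_mean by blast
    show "highly_gowers_uniform (\<lambda>n. f (X n) - coset_mean f (X n))"
      by (rule highly_gowers_uniform_deviation)
  qed
qed

end
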